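(* Let $\mathfrak{g}$ be a nonzero finite-dimensional real solvable Lie algebra. Let $\mathfrak{n}$ be the nilradical of $\mathfrak{g}$ and let $\mathfrak{z}$ be the centre of $\mathfrak{n}$. Then: (1) If $\mathfrak{g}$ admits an inner product of negative Ricci curvature, then there exists $Y\in\mathfrak{g}$ such that $\operatorname{Tr}\operatorname{ad}_Y>0$ and all the (complex) eigenvalues of the restriction of the operator $\operatorname{ad}_Y$ to $\mathfrak{z}$ have positive real part. (2) If there exists $Y\in\mathfrak{g}$ such that all the (complex) eigenvalues of the restriction of $\operatorname{ad}_Y$ to $\mathfrak{n}$ have positive real part, then $\mathfrak{g}$ admits an inner product of negative Ricci curvature.
   Context: The nilradical of $\mathfrak{g}$ is its maximal nilpotent ideal; its centre $\mathfrak{z}$ is an ideal of $\mathfrak{g}$, so the restrictions of $\operatorname{ad}_Y$ to $\mathfrak{n}$ and to $\mathfrak{z}$ are well-defined endomorphisms. Ricci curvature: given an inner product $\langle\cdot,\cdot\rangle$ on a finite-dimensional real Lie algebra $\mathfrak{g}$, let $B$ be the Killing form of $\mathfrak{g}$, let $H\in\mathfrak{g}$ be defined by $\langle H,X\rangle=\operatorname{Tr}\operatorname{ad}_X$ for all $X\in\mathfrak g$, and let $\{E_i\}$ be any orthonormal basis of $(\mathfrak{g},\langle\cdot,\cdot\rangle)$. The Ricci curvature of the metric Lie algebra $(\mathfrak{g},\langle\cdot,\cdot\rangle)$ is the quadratic form $$\mathrm{ric}(X)=-\langle[H,X],X\rangle-\tfrac12 B(X,X)-\tfrac12\sum_i\|[X,E_i]\|^2+\tfrac14\sum_{i,j}\langle[E_i,E_j],X\rangle^2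 ,\quad X\in\mathfrak g$$ (this is the Ricci curvature at the identity of the corresponding left-invariant metric on a Lie group with Lie algebra $\mathfrak{g}$). The inner product $\langle\cdot,\cdot\rangle$ is said to be of negative Ricci curvature if $\mathrm{ric}(X)<0$ for all $X\ne0$. *)

theory Defs
  imports "HOL-Analysis.Analysis"
begin

section \<open>Real Lie algebras\<close>

locale lie_algebra =
  fixes br :: "'a::real_vector \<Rightarrow> 'a \<Rightarrow> 'a"
  assumes bilinear: "bilinear br"
    and alternating: "br x x = 0"
    and jacobi: "br x (br y z) + br y (br z x) + br z (br x y) = 0"

definition bracket_span :: "('a::real_vector \<Rightarrow> 'a \<Rightarrow> 'a) \<Rightarrow> 'a set \<Rightarrow> 'a set \<Rightarrow> 'a set" where
  "bracket_span br A B = span {br x y | x y. x \<in> A \<and> y \<in> B}"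

primrec derived_series :: "('a::real_vector \<Rightarrow> 'a \<Rightarrow> 'a) \<Rightarrow> nat \<Rightarrow> 'a set" where
  "derived_series br 0 = UNIV"
| "derived_series br (Suc k) = bracket_span br (derived_series br k) (derived_series br k)"

definition solvable :: "('a::real_vector \<Rightarrow> 'a \<Rightarrow> 'a) \<Rightarrow> bool" where
  "solvable br \<longleftrightarrow> (\<exists>k. derived_series br k = {0})"

primrec lower_central_series :: "('a::real_vector \<Rightarrow> 'a \<Rightarrow> 'a) \<Rightarrow> 'a set \<Rightarrow> nat \<Rightarrow> 'a set" where
  "lower_central_series br I 0 = I"
| "lower_central_series br I (Suc k) = bracket_span br I (lower_central_series br I k)"

definition nilpotent :: "('a::real_vector \<Rightarrow> 'a \<Rightarrow> 'a) \<Rightarrow> 'a set \<Rightarrow> bool" where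
  "nilpotent br I \<longleftrightarrow> (\<exists>k. lower_central_series br I k = {0})"

definition lie_ideal :: "('a::real_vector \<Rightarrow> 'a \<Rightarrow> 'a) \<Rightarrow> 'a set \<Rightarrow> bool" where
  "lie_ideal br I \<longleftrightarrow> subspace I \<and> (\<forall>x. \<forall>y\<in>I. br x y \<in> I)"

text \<open>The order is inclusion. In finite dimension a greatest nilpotent ideal exists, because
  the sum of two nilpotent ideals is again a nilpotent ideal.\<close>

definition nilradical :: "('a::real_vector \<Rightarrow> 'a \<Rightarrow> 'a) \<Rightarrow> 'a set" where
  "nilradical br = (GREATEST I. lie_ideal br I \<and> nilpotent br I)"

definition centre :: "('a::real_vector \<Rightarrow> 'a \<Rightarrow> 'a) \<Rightarrow> 'a set \<Rightarrow> 'a set" where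
  "centre br I = {x \<in> I. \<forall>y\<in>I. br x y = 0}"


section \<open>Trace and complex eigenvalues of a real endomorphism\<close>

text \<open>The term \<open>extend_basis {}\<close> is a chosen basis of the whole space. In finite dimension the
  trace of a linear map does not depend on it.\<close>

definition endo_trace :: "('a::real_vector \<Rightarrow> 'a) \<Rightarrow> real" where
  "endo_trace f = (\<Sum>b\<in>extend_basis {}. representation (extend_basis {}) (f b) b)"

text \<open>The complexification of a real space \<open>W\<close> is \<open>W \<times> W\<close>, the pair \<open>(u, v)\<close> standing for
  \<open>u + i v\<close>; the complexification of \<open>T\<close> is \<open>map_prod T T\<close>.\<close>

definition complex_scale :: "complex \<Rightarrow> 'a::real_vector \<times> 'a \<Rightarrow> 'a \<times> 'a" where
  "complex_scale c w =
     (Re c *\<^sub>R fst w - Im c *\<^sub>R snd w, Im c *\<^sub>R fst w + Re c *\<^sub>R snd w)"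

text \<open>Complex eigenvalues of the restriction of \<open>T\<close> to a \<open>T\<close>-invariant subspace \<open>W\<close>.\<close>

definition complex_eigenvalue_on :: "('a::real_vector \<Rightarrow> 'a) \<Rightarrow> 'a set \<Rightarrow> complex \<Rightarrow> bool" where
  "complex_eigenvalue_on T W c \<longleftrightarrow>
     (\<exists>w \<in> W \<times> W. w \<noteq> 0 \<and> map_prod T T w = complex_scale c w)"


section \<open>Ricci curvature of a metric Lie algebra\<close>

definition inner_product :: "('a::real_vector \<Rightarrow> 'a \<Rightarrow> real) \<Rightarrow> bool" where
  "inner_product ip \<longleftrightarrow> bilinear ip \<and> (\<forall>x y. ip x y = ip y x) \<and> (\<forall>x. x \<noteq> 0 \<longrightarrow> ip x x > 0)"

definition orthonormal_basis :: "('a::real_vector \<Rightarrow> 'a \<Rightarrow> real) \<Rightarrow> 'a set \<Rightarrow> bool" where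
  "orthonormal_basis ip E \<longleftrightarrow>
     finite E \<and> span E = UNIV \<and> (\<forall>e\<in>E. \<forall>f\<in>E. ip e f = (if e = f then 1 else 0))"

definition killing_form :: "('a::real_vector \<Rightarrow> 'a \<Rightarrow> 'a) \<Rightarrow> 'a \<Rightarrow> 'a \<Rightarrow> real" where
  "killing_form br x y = endo_trace (br x \<circ> br y)"

definition mean_curvature_vector ::
  "('a::real_vector \<Rightarrow> 'a \<Rightarrow> 'a) \<Rightarrow> ('a \<Rightarrow> 'a \<Rightarrow> real) \<Rightarrow> 'a" where
  "mean_curvature_vector br ip = (THE h. \<forall>x. ip h x = endo_trace (br x))"

text \<open>The orthonormal basis is chosen; the value does not depend on the choice.\<close>

definition ricci ::
  "('a::real_vector \<Rightarrow> 'a \<Rightarrow> 'a) \<Rightarrow> ('a \<Rightarrow> 'a \<Rightarrow> real) \<Rightarrow> 'a \<Rightarrow> real" where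
  "ricci br ip x =
     (let E = (SOME E. orthonormal_basis ip E); h = mean_curvature_vector br ip in
        - ip (br h x) x
        - 1/2 * killing_form br x x
        - 1/2 * (\<Sum>e\<in>E. ip (br x e) (br x e))
        + 1/4 * (\<Sum>e\<in>E. \<Sum>f\<in>E. (ip (br e f) x)\<^sup>2))"

definition negative_ricci ::
  "('a::real_vector \<Rightarrow> 'a \<Rightarrow> 'a) \<Rightarrow> ('a \<Rightarrow> 'a \<Rightarrow> real) \<Rightarrow> bool" where
  "negative_ricci br ip \<longleftrightarrow> (\<forall>x. x \<noteq> 0 \<longrightarrow> ricci br ip x < 0)"

end

theory Submission
  imports Defs "HOL-Computational_Algebra.Fundamental_Theorem_Algebra"
begin

text \<open>
  Let \<open>\<nn>\<close> be the nilradical of the solvable algebra \<open>\<gg>\<close>, \<open>\<zz>\<close> its centre, and \<open>H\<close> the mean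
  curvature vector of an inner product.

  Both halves rest on Lie's theorem (\<open>lie_theorem\<close>). In a minimal invariant subspace of a complex
  representation one goes down the derived series: if an ideal acts by commuting operators, its
  commutators with \<open>\<gg>\<close> can only have the eigenvalue \<open>0\<close> (\<open>commutator_eigenvalue_zero\<close>, an argument
  of Jacobson), and minimality turns this into the vanishing of the action. Applied to quotients of
  ideals, Lie's theorem gives every ideal a real basis in which all \<open>ad x\<close> are block triangular, a
  block being \<open>1 \<times> 1\<close>, or \<open>2 \<times> 2\<close> and standing for a complex number (\<open>flag_basis_exists\<close>).
  The nilradical is the common kernel of these weights. Hence it contains all brackets and all
  ad-nilpotent elements (\<open>nilradical_solvable\<close>).

  For the first half take \<open>Y = H\<close>. Brackets lie in \<open>\<nn>\<close> and so act trivially on \<open>\<zz>\<close>; every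
  eigenspace of \<open>ad H\<close> in the complexification of \<open>\<zz>\<close> is therefore invariant and contains a common
  eigenvector \<open>u + i w\<close> of all \<open>ad x\<close>. On the abelian ideal \<open>\<zz>\<close> the Ricci form is at least
  \<open>- \<langle>[H, X], X\<rangle>\<close> plus half the sum over an orthonormal basis of
  \<open>\<parallel>A\<^sup>* X\<parallel>\<^sup>2 - \<parallel>A X\<parallel>\<^sup>2\<close>, where \<open>A\<close> is the restriction of \<open>ad e\<close> to \<open>\<zz>\<close>
  (\<open>ricci_abelian_ideal\<close>). Adding the values at \<open>u\<close> and \<open>w\<close>, the second part is nonnegative by
  Cauchy-Schwarz, and the first is minus the real part of the eigenvalue times a positive number
  (\<open>eigenvalue_positive\<close>). Finally \<open>Tr ad H\<close> is the squared length of \<open>H\<close>, and \<open>H \<noteq> 0\<close> because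
  \<open>ad 0\<close> has the eigenvalue \<open>0\<close> on \<open>\<zz> \<noteq> 0\<close>.

  For the second half, \<open>ad Y\<close> is invertible on \<open>\<nn>\<close>, so its kernel \<open>\<aa>\<close> is an abelian complement
  of \<open>\<nn>\<close>. Multiply the basis vectors of \<open>\<nn>\<close> on level \<open>k = 1, 2, \<dots>\<close> of the flag by \<open>t\<^sup>k\<close>. As \<open>t \<rightarrow> 0\<close>
  the structure constants tend to those of a semidirect product of \<open>\<aa>\<close> with an abelian algebra on
  which \<open>\<aa>\<close> acts through the diagonal blocks only. Negative definiteness of the Ricci form is an open
  condition on the structure constants (\<open>coord_ricci_negative_limit\<close>), so it is enough to have it in the limit.
  There the Ricci form can be computed exactly (\<open>coord_ricci_const\<close>). In a metric in which the blocks are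
  conformal, it is \<open>- (Tr ad Y) Re \<lambda>(Y)\<close> on the block with weight \<open>\<lambda>\<close>, once \<open>Y\<close> is a unit
  vector orthogonal to the traceless elements of \<open>\<aa>\<close>; but on \<open>\<aa>\<close> it is minus the sum of the
  \<open>(Re \<lambda>)\<^sup>2\<close> and vanishes at elements acting by rotations. Scaling the two vectors of each
  rotation block slightly differently removes this degeneracy and disturbs the rest by little
  (\<open>coord_ricci_const_negative\<close>).
\<close>

section \<open>Polynomials in an operator\<close>

definition (in vector_space) poly_app :: "'a poly \<Rightarrow> ('b \<Rightarrow> 'b) \<Rightarrow> 'b \<Rightarrow> 'b" where
  "poly_app p T v = fold_coeffs (\<lambda>a w. scale a v + T w) p 0"

context vector_space
begin

lemma poly_app_0 [simp]: "poly_app 0 T v = 0"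
  by (simp add: poly_app_def)

context
  fixes T :: "'b \<Rightarrow> 'b"
  assumes T: "Vector_Spaces.linear scale scale T"
begin

interpretation T: Vector_Spaces.linear scale scale T by (rule T)

lemma poly_app_pCons [simp]: "poly_app (pCons a p) T v = scale a v + T (poly_app p T v)"
  by (cases "p = 0 \<and> a = 0") (auto simp: poly_app_def T.zero fold_coeffs_def cCons_def)

lemma poly_app_add: "poly_app (p + q) T v = poly_app p T v + poly_app q T v"
  by (induction p q rule: poly_induct2) (simp_all add: T.add scale_left_distrib)

lemma poly_app_smult: "poly_app (smult a p) T v = scale a (poly_app p T v)"
  by (induction p) (simp_all add: T.scale scale_right_distrib)

lemma poly_app_in:
  assumes M: "subspace M" and "v \<in> M" "\<And>u. u \<in> M \<Longrightarrow> T u \<in> M"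
  shows "poly_app p T v \<in> M"
  by (induction p) (use assms in \<open>auto intro!: subspace_add subspace_scale subspace_0[OF M]\<close>)

text \<open>Commutation is only available on the invariant subspace \<open>M\<close>, which is why it appears here instead
  of the whole space.\<close>

lemma poly_app_commute:
  assumes S: "Vector_Spaces.linear scale scale S" and M: "subspace M"
    and "v \<in> M" "\<And>u. u \<in> M \<Longrightarrow> T u \<in> M" "\<And>u. u \<in> M \<Longrightarrow> S (T u) = T (S u)"
  shows "S (poly_app p T v) = poly_app p T (S v)"
proof -
  interpret S: Vector_Spaces.linear scale scale S by (rule S)
  show ?thesis
    by (induction p) (use assms poly_app_in[OF M] in \<open>auto simp: S.add S.scale S.zero\<close>)
qed

lemma poly_app_linear: "Vector_Spaces.linear scale scale (poly_app p T)"
proof (induction p)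
  case 0 show ?case by unfold_locales simp_all
next
  case (pCons a p)
  interpret P: Vector_Spaces.linear scale scale "poly_app p T" by fact
  show ?case
    by unfold_locales (simp_all add: P.add P.scale T.add T.scale algebra_simps)
qed

lemma poly_app_mult: "poly_app (p * q) T v = poly_app p T (poly_app q T v)"
  by (induction p) (simp_all add: mult_pCons_left poly_app_add poly_app_smult)

lemma poly_app_sum: "poly_app (\<Sum>i\<in>I. f i) T v = (\<Sum>i\<in>I. poly_app (f i) T v)"
  by (induction I rule: infinite_finite_induct) (simp_all add: poly_app_add)

lemma poly_app_monom: "poly_app (monom a n) T v = scale a ((T ^^ n) v)"
  by (induction n) (simp_all add: monom_0 monom_Suc T.scale T.zero)

end

end

context finite_dimensional_vector_space
begin

lemma annihilating_poly_vector:
  assumes T: "Vector_Spaces.linear scale scale T"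
  shows "\<exists>p. p \<noteq> 0 \<and> poly_app p T v = 0"
proof -
  define f where "f i = (T ^^ i) v" for i
  define I where "I = {..dimension}"
  obtain c i where c: "i \<in> I" "c i \<noteq> (0::'a)" "(\<Sum>i\<in>I. scale (c i) (f i)) = 0"
  proof (cases "inj_on f I")
    case True
    have "dim (f ` I) < card (f ` I)"
      using True dim_subset_UNIV[of "f ` I"] by (simp add: card_image I_def)
    then have "dependent (f ` I)"
      by (intro dependent_biggerset_general) simp
    then obtain u v where u: "v \<in> f ` I" "u v \<noteq> 0" "(\<Sum>v\<in>f ` I. scale (u v) v) = 0"
      using dependent_finite[of "f ` I"] by (auto simp: I_def)
    then obtain i where "i \<in> I" "v = f i" by auto
    with u True show ?thesis by (intro that[of i "u \<circ> f"]) (auto simp: sum.reindex)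
  next
    case False
    then obtain i j where ij: "i \<in> I" "j \<in> I" "f i = f j" "i \<noteq> j" by (auto simp: inj_on_def)
    define c :: "nat \<Rightarrow> 'a" where "c k = (if k = i then 1 else if k = j then -1 else 0)" for k
    have "(\<Sum>k\<in>I. scale (c k) (f k)) = (\<Sum>k\<in>{i,j}. scale (c k) (f k))"
      using ij by (intro sum.mono_neutral_right) (auto simp: I_def c_def)
    also have "\<dots> = 0" using ij by (simp add: c_def)
    finally show ?thesis using ij by (intro that[of i c]) (auto simp: c_def)
  qed
  define p where "p = (\<Sum>i\<in>I. monom (c i) i)"
  have "coeff p i = c i" using c(1) by (simp add: p_def coeff_sum I_def)
  with c(2) have "p \<noteq> 0" by auto
  moreover have "poly_app p T v = 0"
    using c(3) T by (simp add: p_def poly_app_sum poly_app_monom f_def)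
  ultimately show ?thesis by blast
qed

text \<open>The product of annihilating polynomials of the basis vectors; it avoids the vector space of
  endomorphisms.\<close>

lemma annihilating_poly:
  assumes T: "Vector_Spaces.linear scale scale T"
  shows "\<exists>p. p \<noteq> 0 \<and> (\<forall>v. poly_app p T v = 0)"
proof -
  have "\<exists>p. p \<noteq> 0 \<and> (\<forall>v\<in>S. poly_app p T v = 0)" if "finite S" for S
    using that
  proof induction
    case empty show ?case by (intro exI[of _ 1]) simp
  next
    case (insert b S)
    then obtain p where p: "p \<noteq> 0" "\<forall>v\<in>S. poly_app p T v = 0" by blast
    obtain q where q: "q \<noteq> 0" "poly_app q T b = 0" using annihilating_poly_vector[OF T] by blast
    interpret P: Vector_Spaces.linear scale scale "poly_app p T" by (rule poly_app_linear[OF T])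
    interpret Q: Vector_Spaces.linear scale scale "poly_app q T" by (rule poly_app_linear[OF T])
    have "poly_app (p * q) T v = 0" if "v \<in> insert b S" for v
    proof (cases "v = b")
      case True then show ?thesis using q by (simp add: poly_app_mult[OF T] P.zero)
    next
      case False
      then have "poly_app (q * p) T v = 0" using p that by (simp add: poly_app_mult[OF T] Q.zero)
      then show ?thesis by (simp add: mult.commute)
    qed
    then show ?case using p q by (intro exI[of _ "p * q"]) auto
  qed
  from this[OF finite_Basis] obtain p where p: "p \<noteq> 0" "\<forall>v\<in>Basis. poly_app p T v = 0" by blast
  interpret P: Vector_Spaces.linear scale scale "poly_app p T" by (rule poly_app_linear[OF T])
  have "poly_app p T v = 0" for v
  proof -
    have "v \<in> span Basis" by (simp add: span_Basis)
    then show ?thesis using p(2) P.eq_0_on_span by blast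
  qed
  with p show ?thesis by blast
qed

end

section \<open>Common eigenvectors\<close>

locale complex_fd_space = finite_dimensional_vector_space scale Basis
  for scale :: "complex \<Rightarrow> 'v::ab_group_add \<Rightarrow> 'v" and Basis
begin

text \<open>Take a nonzero polynomial \<open>p\<close> of least degree that kills some nonzero vector \<open>v\<close> of \<open>M\<close>, and
  split off a root: \<open>p = (X - c) q\<close>. By minimality \<open>q\<close> does not kill \<open>v\<close>, so the image of \<open>v\<close>
  under \<open>q\<close> is an eigenvector.\<close>

lemma eigenvector_exists:
  assumes T: "Vector_Spaces.linear scale scale T"
    and M: "subspace M" "M \<noteq> {0}" "\<And>v. v \<in> M \<Longrightarrow> T v \<in> M"
  shows "\<exists>c. \<exists>v\<in>M. v \<noteq> 0 \<and> T v = scale c v"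
proof -
  let ?P = "\<lambda>p. p \<noteq> 0 \<and> (\<exists>v\<in>M. v \<noteq> 0 \<and> poly_app p T v = 0)"
  obtain v where "v \<in> M" "v \<noteq> 0" using M(1,2) subspace_0 by fastforce
  then have "\<exists>p. ?P p" using annihilating_poly_vector[OF T, of v] by blast
  then obtain p0 where "?P p0" by blast
  from ex_has_least_nat[of ?P, OF this, of degree]
  obtain p where p: "?P p" and min: "\<And>q. ?P q \<Longrightarrow> degree p \<le> degree q" by blast
  from p obtain v where v: "v \<in> M" "v \<noteq> 0" "poly_app p T v = 0" "p \<noteq> 0" by blast
  interpret T: Vector_Spaces.linear scale scale T by (rule T)
  have "\<not> constant (poly p)"
  proof
    assume "constant (poly p)"
    then have "degree p = 0" by (simp add: constant_degree)
    then obtain a where "p = [:a:]" using degree_eq_zeroE by blast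
    then show False using v T by (simp add: T.zero)
  qed
  then obtain c where "poly p c = 0" using fundamental_theorem_of_algebra by blast
  then obtain q where q: "p = [:- c, 1:] * q" using poly_eq_0_iff_dvd by blast
  with v(4) have q0: "q \<noteq> 0" by auto
  have deg: "degree p = Suc (degree q)" unfolding q using q0 by (subst degree_mult_eq) auto
  define w where "w = poly_app q T v"
  have "w \<noteq> 0"
    using min[of q] deg q0 v by (auto simp: w_def)
  moreover have "w \<in> M" unfolding w_def using poly_app_in[OF T M(1) v(1) M(3)] .
  moreover have "T w = scale c w"
    using v(3) unfolding q w_def by (simp add: poly_app_mult[OF T] T T.zero del: mult_pCons_left)
  ultimately show ?thesis by blast
qed

text \<open>Irreducibility is used throughout in this form, with \<open>P\<close> saying that a nonzero subspace is invariant.\<close>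

lemma minimal_subspace:
  assumes "P K" "\<And>M. P M \<Longrightarrow> subspace M"
  shows "\<exists>M. P M \<and> (\<forall>N. P N \<and> N \<subseteq> M \<longrightarrow> N = M)"
proof -
  obtain M where M: "P M" "\<And>N. P N \<Longrightarrow> dim M \<le> dim N"
    using ex_has_least_nat[of P K dim] assms(1) by blast
  moreover have "N = M" if "P N" "N \<subseteq> M" for N
    using that M assms(2) subspace_dim_equal[of N M] by blast
  ultimately show ?thesis by blast
qed

lemma eigenspace_subspace:
  assumes T: "Vector_Spaces.linear scale scale T" and M: "subspace M"
  shows "subspace {v \<in> M. T v = scale c v}"
proof -
  interpret T: Vector_Spaces.linear scale scale T by (rule T)
  show ?thesis
    using subspace_0[OF M] subspace_add[OF M] subspace_scale[OF M]
    by (auto simp: subspace_def T.zero T.add T.scale scale_right_distrib mult.commute)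
qed

text \<open>Eigenspaces of one operator are invariant under the others. On a minimal invariant subspace each
  operator is therefore a scalar.\<close>

lemma commuting_common_eigenvector:
  assumes lin: "\<And>T. T \<in> F \<Longrightarrow> Vector_Spaces.linear scale scale T"
    and K: "subspace K" "K \<noteq> {0}" "\<And>T v. T \<in> F \<Longrightarrow> v \<in> K \<Longrightarrow> T v \<in> K"
    and comm: "\<And>S T v. S \<in> F \<Longrightarrow> T \<in> F \<Longrightarrow> v \<in> K \<Longrightarrow> S (T v) = T (S v)"
  shows "\<exists>v\<in>K. v \<noteq> 0 \<and> (\<forall>T\<in>F. \<exists>c. T v = scale c v)"
proof -
  let ?P = "\<lambda>M. subspace M \<and> M \<noteq> {0} \<and> M \<subseteq> K \<and> (\<forall>T\<in>F. \<forall>v\<in>M. T v \<in> M)"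
  have "?P K" using K by auto
  then have "\<exists>M. ?P M \<and> (\<forall>N. ?P N \<and> N \<subseteq> M \<longrightarrow> N = M)"
    by (rule minimal_subspace) auto
  then obtain M where M: "?P M" and min: "\<And>N. ?P N \<Longrightarrow> N \<subseteq> M \<Longrightarrow> N = M"
    by (elim exE conjE) auto
  have ev: "\<exists>c. \<forall>v\<in>M. T v = scale c v" if T: "T \<in> F" for T
  proof -
    obtain c v where v: "v \<in> M" "v \<noteq> 0" "T v = scale c v"
      using eigenvector_exists[OF lin[OF T], of M] M T by blast
    let ?N = "{v \<in> M. T v = scale c v}"
    have "S v \<in> ?N" if "S \<in> F" "v \<in> ?N" for S v
    proof -
      interpret S: Vector_Spaces.linear scale scale S using lin that by blast
      have "v \<in> K" using that M by blast
      then show ?thesis using that M comm[OF T \<open>S \<in> F\<close>] by (auto simp: S.scale)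
    qed
    then have "?P ?N" using eigenspace_subspace[OF lin[OF T]] M v by blast
    then have "?N = M" using min by blast
    then show ?thesis by blast
  qed
  obtain v where "v \<in> M" "v \<noteq> 0" using M subspace_0[of M] by fastforce
  moreover have "v \<in> K" using M \<open>v \<in> M\<close> by blast
  moreover have "\<forall>T\<in>F. \<exists>c. T v = scale c v" using ev \<open>v \<in> M\<close> by meson
  ultimately show ?thesis by blast
qed

text \<open>A form of Jacobson's lemma: with \<open>C = [A, B]\<close> and \<open>D = [A, C]\<close>, suppose that \<open>C\<close> commutes with
  \<open>B\<close> and \<open>D\<close>. If \<open>p(B) = 0\<close>, then commuting with \<open>A\<close> repeatedly, and multiplying by \<open>C\<close> each
  time to remove the term with \<open>D\<close>, gives \<open>p\<^sup>(\<^sup>k\<^sup>)(B) C\<^sup>2\<^sup>k = 0\<close>. For \<open>k = deg p\<close>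
  the derivative is a nonzero constant, so \<open>C\<close> is nilpotent on \<open>M\<close>. This takes the place of the usual
  trace argument.\<close>

lemma commutator_eigenvalue_zero:
  assumes A: "Vector_Spaces.linear scale scale A" and B: "Vector_Spaces.linear scale scale B"
    and C: "Vector_Spaces.linear scale scale C"
    and M: "subspace M" and inv: "\<And>v. v \<in> M \<Longrightarrow> A v \<in> M" "\<And>v. v \<in> M \<Longrightarrow> B v \<in> M"
    and AB: "\<And>v. v \<in> M \<Longrightarrow> C v = A (B v) - B (A v)"
    and BC: "\<And>v. v \<in> M \<Longrightarrow> B (C v) = C (B v)"
    and D: "\<And>v. v \<in> M \<Longrightarrow> D v = A (C v) - C (A v)"
    and DC: "\<And>v. v \<in> M \<Longrightarrow> C (D v) = D (C v)"
    and v: "v \<in> M" "v \<noteq> 0" "C v = scale c v"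
  shows "c = 0"
proof -
  interpret A: Vector_Spaces.linear scale scale A by (rule A)
  interpret B: Vector_Spaces.linear scale scale B by (rule B)
  interpret C: Vector_Spaces.linear scale scale C by (rule C)
  have CM: "C v \<in> M" if "v \<in> M" for v using that AB inv subspace_diff[OF M] by simp
  have DM: "D v \<in> M" if "v \<in> M" for v using that D inv CM subspace_diff[OF M] by simp
  have CjM: "(C ^^ j) v \<in> M" if "v \<in> M" for j v
    using that by (induction j) (auto intro: CM)
  have pM: "poly_app q B v \<in> M" if "v \<in> M" for q v
    using poly_app_in[OF B M that inv(2)] .
  have Cp: "C (poly_app q B v) = poly_app q B (C v)" if "v \<in> M" for q v
    using poly_app_commute[OF B C M that inv(2)] BC by simp
  have Ap: "A (poly_app q B v) = poly_app q B (A v) + poly_app (pderiv q) B (C v)"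
    if v: "v \<in> M" for q v
  proof (induction q)
    case 0 show ?case by (simp add: A.zero)
  next
    case (pCons a q)
    have "A (B (poly_app q B v)) = C (poly_app q B v) + B (A (poly_app q B v))"
      using AB[OF pM[OF v]] by simp
    then show ?case
      using pCons.IH Cp[OF v]
      by (simp add: B A.add A.scale B.add pderiv_pCons poly_app_add[OF B] scale_right_distrib algebra_simps)
  qed
  have DCj: "(C ^^ j) (D v) = D ((C ^^ j) v)" if "v \<in> M" for j v
    using that by (induction j) (auto simp: DC CjM)
  have ACj: "C (A ((C ^^ j) v)) = C ((C ^^ j) (A v)) + scale (of_nat j) ((C ^^ j) (D v))"
    if "v \<in> M" for j v
  proof (induction j)
    case (Suc j)
    let ?w = "(C ^^ j) v"
    have w: "?w \<in> M" using CjM that by blast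
    have "C (A (C ?w)) = C (D ?w) + C (C (A ?w))"
      using D[OF w] by (simp flip: C.add)
    also have "C (C (A ?w)) = C (C ((C ^^ j) (A v))) + scale (of_nat j) (C ((C ^^ j) (D v)))"
      by (simp add: Suc.IH C.add C.scale)
    also have "C (D ?w) = C ((C ^^ j) (D v))" by (simp add: DCj that)
    finally show ?case by (simp add: scale_left_distrib)
  qed simp
  obtain p where p: "p \<noteq> 0" "\<And>v. poly_app p B v = 0"
    using annihilating_poly[OF B] by blast
  have step: "\<forall>v\<in>M. poly_app ((pderiv ^^ k) p) B ((C ^^ (2 * k)) v) = 0" for k
  proof (induction k)
    case 0 show ?case using p by simp
  next
    case (Suc k)
    define q where "q = (pderiv ^^ k) p"
    let ?j = "2 * k"
    show ?case
    proof
      fix v assume v: "v \<in> M"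
      let ?w = "(C ^^ ?j) v"
      interpret Q: Vector_Spaces.linear scale scale "poly_app q B" by (rule poly_app_linear[OF B])
      have w: "?w \<in> M" by (rule CjM[OF v])
      have IH: "poly_app q B ((C ^^ ?j) u) = 0" if "u \<in> M" for u
        using Suc.IH that by (simp add: q_def)
      have "0 = C (A (poly_app q B ?w))" using IH[OF v] by (simp add: A.zero C.zero)
      also have "\<dots> = C (poly_app q B (A ?w)) + C (poly_app (pderiv q) B (C ?w))"
        by (simp add: Ap[OF w] C.add)
      also have "C (poly_app q B (A ?w)) = poly_app q B (C (A ?w))"
        using Cp inv(1)[OF w] by simp
      also have "\<dots> = C (poly_app q B ((C ^^ ?j) (A v))) + scale (of_nat ?j) (poly_app q B ((C ^^ ?j) (D v)))"
        using Cp[OF CjM[OF inv(1)[OF v]]] by (simp add: ACj[OF v] Q.add Q.scale)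
      also have "\<dots> = 0" using IH inv(1)[OF v] DM[OF v] by (simp add: C.zero)
      also have "C (poly_app (pderiv q) B (C ?w)) = poly_app (pderiv q) B (C (C ?w))"
        using Cp CM[OF w] by simp
      finally show "poly_app ((pderiv ^^ Suc k) p) B ((C ^^ (2 * Suc k)) v) = 0"
        by (simp add: q_def)
    qed
  qed
  have deg: "degree ((pderiv ^^ k) p) = degree p - k" for k
    by (induction k) (simp_all add: degree_pderiv)
  have nz: "(pderiv ^^ k) p \<noteq> 0" if "k \<le> degree p" for k
    using that
  proof (induction k)
    case (Suc k)
    then have "degree ((pderiv ^^ k) p) \<noteq> 0" using deg by simp
    then show ?case using pderiv_eq_0_iff[of "(pderiv ^^ k) p"] by simp
  qed (use p in simp)
  define d where "d = degree p"
  obtain a where a: "(pderiv ^^ d) p = [:a:]" using deg[of d] degree_eq_zeroE by (metis d_def diff_self_eq_0)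
  then have "a \<noteq> 0" using nz[of d] by (auto simp: d_def)
  moreover have Cv: "(C ^^ j) v = scale (c ^ j) v" for j
    by (induction j) (simp_all add: v C.scale mult.commute)
  have "scale a (scale (c ^ (2 * d)) v) = 0"
    using step[rule_format, of v d] v(1) a B by (simp add: Cv B.zero)
  ultimately show ?thesis using v(2) by simp
qed

end

section \<open>Lie's theorem\<close>

context lie_algebra
begin

lemma br_simps:
  "br (x + y) z = br x z + br y z" "br x (y + z) = br x y + br x z"
  "br (x - y) z = br x z - br y z" "br x (y - z) = br x y - br x z"
  "br (r *\<^sub>R x) z = r *\<^sub>R br x z" "br x (r *\<^sub>R z) = r *\<^sub>R br x z"
  "br 0 z = 0" "br x 0 = 0" "br (- x) z = - br x z" "br x (- z) = - br x z"
  using bilinear by (simp_all add: bilinear_ladd bilinear_radd bilinear_lsub bilinear_rsub bilinear_lmul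
      bilinear_rmul bilinear_lzero bilinear_rzero bilinear_lneg bilinear_rneg)

lemma br_anticomm: "br x y = - br y x"
proof -
  have "br (x + y) (x + y) = 0" by (rule alternating)
  then have "br x y + br y x = 0" unfolding br_simps by (simp add: alternating add.commute)
  then show ?thesis by (simp only: eq_neg_iff_add_eq_0)
qed

lemma linear_br: "linear (br x)"
  by (rule linearI) (simp_all add: br_simps)

lemma linear_br_left: "linear (\<lambda>x. br x y)"
  by (rule linearI) (simp_all add: br_simps)

lemma br_br: "br (br x y) z = br x (br y z) - br y (br x z)"
  using jacobi[of x y z] br_anticomm[of z "br x y"] br_anticomm[of z x]
  by (simp add: br_simps algebra_simps eq_neg_iff_add_eq_0)

lemma lie_ideal_bracket_span:
  assumes "lie_ideal br I" "lie_ideal br J"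
  shows "lie_ideal br (bracket_span br I J)"
  unfolding lie_ideal_def
proof (intro conjI allI ballI)
  fix x y assume "y \<in> bracket_span br I J"
  then show "br x y \<in> bracket_span br I J"
    unfolding bracket_span_def
  proof (induction rule: span_induct_alt)
    case base show ?case by (simp add: br_simps span_0)
  next
    case (step r a b)
    then obtain i j where "i \<in> I" "j \<in> J" "a = br i j" by blast
    moreover have "br x (br i j) = br (br x i) j + br i (br x j)" using br_br[of x i j] by simp
    moreover have "br x i \<in> I" "br x j \<in> J" using assms calculation by (auto simp: lie_ideal_def)
    ultimately have "br x a \<in> span {br x y |x y. x \<in> I \<and> y \<in> J}"
      by simp (intro span_add span_base; blast)
    then show ?case using step by (simp add: br_simps span_add span_scale)
  qed
qed (simp add: bracket_span_def)

lemma derived_series_ideal: "lie_ideal br (derived_series br k)"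
  by (induction k) (simp add: lie_ideal_def, simp add: lie_ideal_bracket_span)

end

locale lie_representation = lie_algebra br + complex_fd_space scale Basis
  for br :: "'g::real_vector \<Rightarrow> 'g \<Rightarrow> 'g" and scale :: "complex \<Rightarrow> 'v::ab_group_add \<Rightarrow> 'v" and Basis +
  fixes rho :: "'g \<Rightarrow> 'v \<Rightarrow> 'v"
  assumes rho_linear: "Vector_Spaces.linear scale scale (rho x)"
    and rho_add: "rho (x + y) v = rho x v + rho y v"
    and rho_scaleR: "rho (r *\<^sub>R x) v = scale (of_real r) (rho x v)"
    and rho_br: "rho (br x y) v = rho x (rho y v) - rho y (rho x v)"
begin

lemma rho_0 [simp]: "rho 0 v = 0" "rho x 0 = 0"
proof -
  show "rho 0 v = 0" using rho_scaleR[of 0 0 v] by simp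
  interpret R: Vector_Spaces.linear scale scale "rho x" by (rule rho_linear)
  show "rho x 0 = 0" by (rule R.zero)
qed

lemma rho_zero_on_span:
  assumes "\<And>x. x \<in> S \<Longrightarrow> rho x v = 0" "x \<in> Real_Vector_Spaces.span S"
  shows "rho x v = 0"
  using assms(2) by (induction rule: real_vector.span_induct_alt) (auto simp: assms(1) rho_add rho_scaleR)

text \<open>The inductive step of Lie's theorem on a minimal invariant subspace \<open>M\<close>. Let \<open>N\<close> be the common
  kernel in \<open>M\<close> of all \<open>[x, y]\<close> with \<open>y\<close> in \<open>D\<close>; it is invariant because \<open>D\<close> is an ideal, and
  nonzero because a common eigenvector of \<open>D\<close> lies in it, by Jacobson's lemma. So \<open>N = M\<close>, that is,
  \<open>D\<close> commutes with the whole action. The generators \<open>[y, z]\<close> of \<open>D\<close> are now themselves commutators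
  that commute with both factors; Jacobson's lemma gives them a nonzero kernel, and this kernel is
  invariant, hence all of \<open>M\<close>.\<close>

lemma rho_ideal_zero:
  assumes M: "subspace M" "M \<noteq> {0}" "\<And>x v. v \<in> M \<Longrightarrow> rho x v \<in> M"
    and irred: "\<And>N. subspace N \<Longrightarrow> N \<noteq> {0} \<Longrightarrow> N \<subseteq> M \<Longrightarrow> (\<And>x v. v \<in> N \<Longrightarrow> rho x v \<in> N) \<Longrightarrow> N = M"
    and I: "lie_ideal br I" and D_def: "D = bracket_span br I I"
    and abel: "\<And>x y v. x \<in> D \<Longrightarrow> y \<in> D \<Longrightarrow> v \<in> M \<Longrightarrow> rho (br x y) v = 0"
    and x: "x \<in> D" and v: "v \<in> M"
  shows "rho x v = 0"
proof -
  have D: "lie_ideal br D" unfolding D_def by (rule lie_ideal_bracket_span[OF I I])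
  have Dcomm: "rho x (rho y v) = rho y (rho x v)" if "x \<in> D" "y \<in> D" "v \<in> M" for x y v
    using abel[OF that] by (simp add: rho_br)
  have brD: "br x y \<in> D" if "y \<in> D" for x y using that D by (auto simp: lie_ideal_def)
  define N where "N = {v \<in> M. \<forall>x. \<forall>y\<in>D. rho (br x y) v = 0}"
  have "N = M"
  proof (rule irred)
    show "subspace N"
      unfolding subspace_def
    proof (intro conjI ballI allI)
      show "0 \<in> N" using M(1) by (simp add: N_def subspace_0)
    next
      fix a b assume ab: "a \<in> N" "b \<in> N"
      have "rho x (a + b) = rho x a + rho x b" for x
      proof -
        interpret R: Vector_Spaces.linear scale scale "rho x" by (rule rho_linear)
        show ?thesis by (rule R.add)
      qed
      then show "a + b \<in> N" using ab M(1) by (simp add: N_def subspace_add)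
    next
      fix c a assume a: "a \<in> N"
      have "rho x (scale c a) = scale c (rho x a)" for x
      proof -
        interpret R: Vector_Spaces.linear scale scale "rho x" by (rule rho_linear)
        show ?thesis by (rule R.scale)
      qed
      then show "scale c a \<in> N" using a M(1) by (simp add: N_def subspace_scale)
    qed
    show "N \<subseteq> M" by (auto simp: N_def)
    show "N \<noteq> {0}"
    proof -
      have "\<exists>w\<in>M. w \<noteq> 0 \<and> (\<forall>T\<in>rho ` D. \<exists>c. T w = scale c w)"
        by (rule commuting_common_eigenvector) (use rho_linear M Dcomm in auto)
      then obtain w where w: "w \<in> M" "w \<noteq> 0" and ev: "\<And>T. T \<in> rho ` D \<Longrightarrow> \<exists>c. T w = scale c w"
        by blast
      have "rho (br x y) w = 0" if y: "y \<in> D" for x y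
      proof -
        obtain c where c: "rho (br x y) w = scale c w" using ev brD[OF y] by blast
        have "c = 0"
        proof (rule commutator_eigenvalue_zero[OF rho_linear[of x] rho_linear[of y] rho_linear[of "br x y"] M(1),
              where D = "rho (br x (br x y))"])
          show "w \<in> M" "w \<noteq> 0" "rho (br x y) w = scale c w" by fact+
        qed (use Dcomm brD y M(3) in \<open>auto simp: rho_br[symmetric]\<close>)
        then show ?thesis by (simp add: c)
      qed
      then have "w \<in> N" using w by (simp add: N_def)
      then show ?thesis using w by blast
    qed
    show "rho x v \<in> N" if v: "v \<in> N" for x v
    proof -
      have "rho (br z y) (rho x v) = 0" if y: "y \<in> D" for z y
      proof -
        have "rho (br z y) (rho x v) = rho x (rho (br z y) v) - rho (br x (br z y)) v"
          by (simp add: rho_br)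
        then show ?thesis using v y brD[OF y] by (simp add: N_def)
      qed
      then show ?thesis using v M(3) by (simp add: N_def)
    qed
  qed
  then have central: "rho x (rho y v) = rho y (rho x v)" if "y \<in> D" "v \<in> M" for x y v
  proof -
    have "rho (br x y) v = 0" using \<open>N = M\<close> that by (auto simp: N_def)
    then show ?thesis by (simp add: rho_br)
  qed
  have gen: "rho (br y z) v = 0" if yz: "y \<in> I" "z \<in> I" for y z
  proof -
    have CD: "br y z \<in> D" unfolding D_def bracket_span_def using yz by (blast intro: real_vector.span_base)
    obtain c w where w: "w \<in> M" "w \<noteq> 0" "rho (br y z) w = scale c w"
      using eigenvector_exists[OF rho_linear M(1,2,3)] by blast
    have c0: "c = 0"
    proof (rule commutator_eigenvalue_zero[OF rho_linear[of y] rho_linear[of z] rho_linear[of "br y z"] M(1),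
          where D = "rho (br y (br y z))"])
      show "w \<in> M" "w \<noteq> 0" "rho (br y z) w = scale c w" by fact+
    qed (fact M(3) | rule rho_br | erule central[OF CD] | erule central[OF brD[OF CD]])+
    have "{v \<in> M. rho (br y z) v = scale 0 v} = M"
    proof (rule irred)
      show "{v \<in> M. rho (br y z) v = scale 0 v} \<noteq> {0}" using w c0 by auto
      show "rho x v \<in> {v \<in> M. rho (br y z) v = scale 0 v}"
        if "v \<in> {v \<in> M. rho (br y z) v = scale 0 v}" for x v
        using that M(3) central[OF CD, of v x, symmetric] by simp
    qed (use eigenspace_subspace[OF rho_linear M(1), of "br y z" 0] in auto)
    then have "v \<in> {v \<in> M. rho (br y z) v = scale 0 v}" using v by simp
    then show ?thesis by simp
  qed
  show ?thesis
    using x unfolding D_def bracket_span_def by (rule rho_zero_on_span[rotated]) (auto simp: gen)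
qed

text \<open>On a minimal invariant subspace the first derived algebra acts by \<open>0\<close>, so the remaining operators
  commute.\<close>

theorem lie_theorem:
  assumes solv: "solvable br"
    and K: "subspace K" "K \<noteq> {0}" "\<And>x v. v \<in> K \<Longrightarrow> rho x v \<in> K"
  obtains v c where "v \<in> K" "v \<noteq> 0" "\<And>x. rho x v = scale (c x) v"
    "\<And>x y. c (x + y) = c x + c y" "\<And>r x. c (r *\<^sub>R x) = of_real r * c x" "\<And>x y. c (br x y) = 0"
proof -
  let ?P = "\<lambda>M. subspace M \<and> M \<noteq> {0} \<and> M \<subseteq> K \<and> (\<forall>x. \<forall>v\<in>M. rho x v \<in> M)"
  have "?P K" using K by auto
  then have "\<exists>M. ?P M \<and> (\<forall>N. ?P N \<and> N \<subseteq> M \<longrightarrow> N = M)"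
    by (rule minimal_subspace) auto
  then obtain M where M: "?P M" and min: "\<And>N. ?P N \<Longrightarrow> N \<subseteq> M \<Longrightarrow> N = M"
    by (elim exE conjE) auto
  have irred: "N = M" if "subspace N" "N \<noteq> {0}" "N \<subseteq> M" "\<And>x v. v \<in> N \<Longrightarrow> rho x v \<in> N" for N
    using min[of N] M that by blast
  obtain m where m: "derived_series br m = {0}" using solv by (auto simp: solvable_def)
  have zero: "\<forall>x\<in>derived_series br (Suc k). \<forall>v\<in>M. rho x v = 0" if "k \<le> m" for k
    using that
  proof (induction rule: inc_induct)
    case base show ?case using m by (auto simp: bracket_span_def br_simps)
  next
    case (step k)
    let ?D = "derived_series br (Suc k)"
    have "rho x v = 0" if "x \<in> ?D" "v \<in> M" for x v
    proof (rule rho_ideal_zero[of M "derived_series br k" ?D])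
      show "rho (br x y) v = 0" if "x \<in> ?D" "y \<in> ?D" "v \<in> M" for x y v
      proof -
        have "br x y \<in> derived_series br (Suc (Suc k))"
          using that unfolding derived_series.simps(2)[of br "Suc k"] bracket_span_def
          by (blast intro: real_vector.span_base)
        then show ?thesis using step.IH that by blast
      qed
    qed (use M irred that derived_series_ideal in auto)
    then show ?case by blast
  qed
  have br0: "rho (br x y) v = 0" if "v \<in> M" for x y v
  proof -
    have "br x y \<in> derived_series br (Suc 0)" by (auto simp: bracket_span_def intro!: real_vector.span_base)
    then show ?thesis using zero[of 0] that by blast
  qed
  have "\<exists>v\<in>M. v \<noteq> 0 \<and> (\<forall>T\<in>range rho. \<exists>c. T v = scale c v)"
    by (rule commuting_common_eigenvector) (use rho_linear M br0 in \<open>auto simp: rho_br\<close>)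
  then obtain v where v: "v \<in> M" "v \<noteq> 0" "\<forall>x. \<exists>c. rho x v = scale c v" by blast
  then obtain c where c: "\<And>x. rho x v = scale (c x) v" by metis
  show thesis
  proof (rule that[of v c])
    show "c (x + y) = c x + c y" for x y
    proof -
      have "scale (c (x + y)) v = scale (c x + c y) v"
        using rho_add[of x y v] by (simp add: c scale_left_distrib)
      then show ?thesis using v(2) by simp
    qed
    show "c (r *\<^sub>R x) = of_real r * c x" for r x
      using rho_scaleR[of r x v] v(2) by (simp add: c)
    show "c (br x y) = 0" for x y
      using br0[OF v(1), of x y] v(2) by (simp add: c)
  qed (use v M c in auto)
qed

end

section \<open>Complexification\<close>

lemma vector_space_complex_scale: "vector_space (complex_scale :: complex \<Rightarrow> 'a::real_vector \<times> 'a \<Rightarrow> 'a \<times> 'a)"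
  by unfold_locales (auto simp: complex_scale_def algebra_simps)

lemma complexification_finite_dimensional:
  fixes S :: "'a::real_vector set"
  assumes "finite S" "span S = UNIV"
  obtains B :: "('a::real_vector \<times> 'a) set" where "complex_fd_space complex_scale B"
proof -
  interpret V: vector_space "complex_scale :: complex \<Rightarrow> 'a \<times> 'a \<Rightarrow> 'a \<times> 'a"
    by (rule vector_space_complex_scale)
  let ?S = "(\<lambda>b. (b, 0)) ` S"
  obtain B where B: "B \<subseteq> ?S" "\<not> V.dependent B" "?S \<subseteq> V.span B"
    using V.maximal_independent_subset[of ?S] by blast
  have real: "(x, 0) \<in> V.span B" for x
  proof -
    have "x \<in> span S" using assms by simp
    then show ?thesis
    proof (induction rule: span_induct_alt)
      case base show ?case using V.span_zero by (simp add: zero_prod_def)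
    next
      case (step c x y)
      have "(x, 0) \<in> V.span B" using step B by blast
      then have "complex_scale (of_real c) (x, 0) + (y, 0) \<in> V.span B"
        using step by (intro V.span_add V.span_scale)
      moreover have "complex_scale (of_real c) (x, 0) + (y, 0) = (c *\<^sub>R x + y, 0)"
        by (simp add: complex_scale_def)
      ultimately show ?case by simp
    qed
  qed
  have "(x, y) \<in> V.span B" for x y
  proof -
    have "(x, 0) + complex_scale \<i> (y, 0) \<in> V.span B"
      by (intro V.span_add V.span_scale real)
    moreover have "(x, 0) + complex_scale \<i> (y, 0) = (x, y)" by (simp add: complex_scale_def)
    ultimately show ?thesis by simp
  qed
  then have "V.span B = UNIV" by auto
  moreover have "finite B" using B(1) assms(1) finite_subset by blast
  ultimately have "complex_fd_space complex_scale B"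
    using B by unfold_locales auto
  then show thesis by (rule that)
qed

section \<open>Triangular bases of ideals\<close>

text \<open>Composing with such a projection replaces a quotient by \<open>U\<close>, whose type would depend on \<open>U\<close>,
  by a complement of \<open>U\<close>.\<close>

lemma projection_along_subspace:
  fixes U :: "'a::real_vector set"
  assumes "subspace U"
  obtains E where "linear E" "\<And>u. u \<in> U \<Longrightarrow> E u = (0::'a)" "\<And>v. E v - v \<in> U"
proof -
  obtain C where C: "C \<subseteq> U" "independent C" "U \<subseteq> span C"
    using real_vector.maximal_independent_subset[of U] by blast
  obtain B where B: "C \<subseteq> B" "independent B" "UNIV \<subseteq> span B"
    by (rule real_vector.maximal_independent_subset_extend[OF subset_UNIV C(2)]) auto
  obtain E where E: "linear E" "\<forall>b\<in>B. E b = (if b \<in> C then 0 else b)"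
    using real_vector.linear_independent_extend[OF B(2), of "\<lambda>b. if b \<in> C then 0 else b"] by (elim exE conjE)
  have "E u = 0" if "u \<in> U" for u
  proof -
    have "u \<in> span C" using that C by blast
    then show ?thesis
      using B(1) E by (induction rule: span_induct_alt) (auto simp: linear_add linear_scale linear_0)
  qed
  moreover have "E v - v \<in> U" for v
  proof -
    have "v \<in> span B" using B by blast
    then show ?thesis
    proof (induction rule: span_induct_alt)
      case base show ?case using E assms by (simp add: linear_0 subspace_0)
    next
      case (step c x y)
      have "E (c *\<^sub>R x + y) - (c *\<^sub>R x + y) = c *\<^sub>R (E x - x) + (E y - y)"
        using E by (simp add: linear_add linear_scale algebra_simps)
      moreover have "E x - x \<in> U"
        using step(1) E(2) C(1) assms by (auto simp: subspace_0 subspace_neg)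
      ultimately show ?case
        using step(2) assms by (metis subspace_add subspace_scale)
    qed
  qed
  ultimately show thesis using that E(1) by blast
qed

lemma representation_zero_outside:
  assumes "independent B" "S \<subseteq> B" "v \<in> span S" "b \<notin> S"
  shows "representation B v b = 0"
proof -
  have "representation B v = representation S v"
    using assms by (intro real_vector.representation_extend)
  then show ?thesis using assms(4) real_vector.representation_ne_zero by metis
qed

locale fd_lie_algebra = lie_algebra br for br :: "'g::real_vector \<Rightarrow> 'g \<Rightarrow> 'g" +
  fixes gens :: "'g set"
  assumes finite_gens: "finite gens" and span_gens: "span gens = UNIV"
begin

lemma finite_independent: "independent (B::'g set) \<Longrightarrow> finite B"
  and card_independent: "independent (B::'g set) \<Longrightarrow> card B \<le> card gens"
  using real_vector.independent_span_bound[OF finite_gens, of B] span_gens by auto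

text \<open>Lie's theorem for the complexification of \<open>V / U\<close>. The quotient is realised on the image of \<open>V\<close>
  under a projection \<open>E\<close> along \<open>U\<close>; the maps \<open>E \<circ> ad x\<close> represent the Lie algebra on the whole
  space since \<open>U\<close> is an ideal. The eigenvector is \<open>u + i w\<close>, with eigenvalue \<open>al x + i be x\<close>.\<close>

lemma lie_quotient:
  assumes solv: "solvable br" and U: "lie_ideal br U" and V: "lie_ideal br V" and UV: "U \<subseteq> V" "U \<noteq> V"
  obtains u w al be where "u \<in> V" "w \<in> V" "u \<notin> U \<or> w \<notin> U"
    "\<And>x. br x u - al x *\<^sub>R u + be x *\<^sub>R w \<in> U" "\<And>x. br x w - be x *\<^sub>R u - al x *\<^sub>R w \<in> U"
    "linear al" "linear be" "\<And>x y. al (br x y) = (0::real)" "\<And>x y. be (br x y) = (0::real)"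
proof -
  have sU: "subspace U" and sV: "subspace V" using U V by (auto simp: lie_ideal_def)
  obtain E where E: "linear E" and E0: "\<And>u. u \<in> U \<Longrightarrow> E u = 0" and EU: "\<And>v. E v - v \<in> U"
    using projection_along_subspace[OF sU] by metis
  obtain BB :: "('g \<times> 'g) set" where BB: "complex_fd_space complex_scale BB"
    using complexification_finite_dimensional[OF finite_gens span_gens] by blast
  interpret C: complex_fd_space complex_scale BB by (rule BB)
  define r where "r x v = E (br x v)" for x v
  have lin_r: "linear (r x)" for x
    using linear_compose[OF linear_br E, of x] by (simp add: r_def[abs_def] o_def)
  have Ebr: "E (br x (E v)) = E (br x v)" for x v
  proof -
    have "br x (E v - v) \<in> U" using EU U by (auto simp: lie_ideal_def)
    then have "E (br x (E v - v)) = 0" by (rule E0)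
    then show ?thesis by (simp add: br_simps linear_diff[OF E])
  qed
  have r_br: "r (br x y) v = r x (r y v) - r y (r x v)" for x y v
    by (simp add: r_def Ebr br_br linear_diff[OF E])
  interpret R: lie_representation br complex_scale BB "\<lambda>x. map_prod (r x) (r x)"
  proof unfold_locales
    fix x y :: 'g and c :: real and v :: "'g \<times> 'g"
    show "map_prod (r (x + y)) (r (x + y)) v = map_prod (r x) (r x) v + map_prod (r y) (r y) v"
      by (cases v) (simp add: r_def br_simps linear_add[OF E])
    show "map_prod (r (c *\<^sub>R x)) (r (c *\<^sub>R x)) v = complex_scale (complex_of_real c) (map_prod (r x) (r x) v)"
      by (cases v) (simp add: r_def br_simps linear_scale[OF E] complex_scale_def)
    show "map_prod (r (br x y)) (r (br x y)) v =
       map_prod (r x) (r x) (map_prod (r y) (r y) v) - map_prod (r y) (r y) (map_prod (r x) (r x) v)"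
      by (cases v) (simp add: r_br)
  qed (simp_all add: prod_eq_iff complex_scale_def linear_add[OF lin_r] linear_diff[OF lin_r] linear_scale[OF lin_r])
  have EV: "E v \<in> V" if "v \<in> V" for v
    using subspace_add[OF sV, of "E v - v" v] that EU UV by auto
  let ?W = "E ` V"
  have sW: "subspace ?W" by (rule linear_subspace_image[OF E sV])
  define K where "K = ?W \<times> ?W"
  have "C.subspace K"
    using sW by (auto simp: C.subspace_def K_def complex_scale_def subspace_0 zero_prod_def
        simp del: scaleR_conv_of_real intro!: subspace_add subspace_diff subspace_scale)
  moreover have "K \<noteq> {0}"
  proof -
    obtain v where v: "v \<in> V" "v \<notin> U" using UV by blast
    have "E v \<noteq> 0" using EU[of v] v sU subspace_neg by fastforce
    moreover have "(E v, 0) \<in> K" using v sW by (auto simp: K_def subspace_0)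
    ultimately show ?thesis by (auto simp: zero_prod_def)
  qed
  moreover have "map_prod (r x) (r x) v \<in> K" if "v \<in> K" for x v
  proof -
    have "r x y \<in> ?W" if "y \<in> ?W" for y
      using that EV V by (auto simp: r_def lie_ideal_def)
    then show ?thesis using that by (auto simp: K_def)
  qed
  ultimately obtain v c where v: "v \<in> K" "v \<noteq> 0"
      and ev: "\<And>x. map_prod (r x) (r x) v = complex_scale (c x) v"
      and c: "\<And>x y. c (x + y) = c x + c y" "\<And>r x. c (r *\<^sub>R x) = of_real r * c x" "\<And>x y. c (br x y) = 0"
    by (rule R.lie_theorem[OF solv]) (assumption | rule that)+
  obtain u w where uw: "v = (u, w)" by (cases v)
  have W: "u \<in> ?W" "w \<in> ?W" using v uw by (auto simp: K_def)
  have fixW: "E y = y" if "y \<in> ?W" for y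
  proof -
    obtain z where z: "y = E z" using \<open>y \<in> ?W\<close> by blast
    have "E (E z - z) = 0" by (rule E0[OF EU])
    then show ?thesis by (simp add: z linear_diff[OF E])
  qed
  have e: "E (br x u) = Re (c x) *\<^sub>R u - Im (c x) *\<^sub>R w" "E (br x w) = Im (c x) *\<^sub>R u + Re (c x) *\<^sub>R w" for x
    using ev[of x] by (auto simp: uw r_def complex_scale_def)
  show thesis
  proof (rule that[of u w "\<lambda>x. Re (c x)" "\<lambda>x. Im (c x)"])
    show "u \<in> V" "w \<in> V" using W EV by auto
    show "u \<notin> U \<or> w \<notin> U"
    proof (rule ccontr)
      assume "\<not> (u \<notin> U \<or> w \<notin> U)"
      then have "u = 0 \<and> w = 0" using E0 fixW W by metis
      then show False using v uw by (simp add: zero_prod_def)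
    qed
    show "br x u - Re (c x) *\<^sub>R u + Im (c x) *\<^sub>R w \<in> U" for x
      using subspace_neg[OF sU EU[of "br x u"]] by (simp add: e algebra_simps)
    show "br x w - Im (c x) *\<^sub>R u - Re (c x) *\<^sub>R w \<in> U" for x
      using subspace_neg[OF sU EU[of "br x w"]] by (simp add: e algebra_simps)
    show "linear (\<lambda>x. Re (c x))" "linear (\<lambda>x. Im (c x))"
      by (rule linearI; simp add: c)+
  qed (simp_all add: c)
qed

text \<open>A simultaneous block triangularisation of all \<open>ad x\<close> on the ideal \<open>V\<close>, with levels counted by
  \<open>lev\<close>. Modulo lower levels the vectors \<open>b\<close> and \<open>star b\<close> span an invariant plane on which
  \<open>ad x\<close> is multiplication by the complex number \<open>al b x + i be b x\<close>. A one-dimensional block is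
  encoded by \<open>star b = b\<close>, and then \<open>be (star b) = - be b\<close> forces \<open>be b = 0\<close>.\<close>

definition flag_basis :: "'g set \<Rightarrow> 'g set \<Rightarrow> ('g \<Rightarrow> nat) \<Rightarrow> ('g \<Rightarrow> 'g) \<Rightarrow> ('g \<Rightarrow> 'g \<Rightarrow> real) \<Rightarrow> ('g \<Rightarrow> 'g \<Rightarrow> real) \<Rightarrow> bool" where
  "flag_basis V B lev star al be \<longleftrightarrow> independent B \<and> span B = V \<and>
     (\<forall>b\<in>B. star b \<in> B \<and> star (star b) = b \<and> lev (star b) = lev b \<and> linear (al b) \<and> linear (be b) \<and>
        (\<forall>x. al (star b) x = al b x \<and> be (star b) x = - be b x) \<and>
        (\<forall>x y. al b (br x y) = 0 \<and> be b (br x y) = 0) \<and>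
        (\<forall>x. br x b - al b x *\<^sub>R b - be b x *\<^sub>R star b \<in> span {b' \<in> B. lev b' < lev b}))"

lemma flag_basisD:
  assumes "flag_basis V B lev star al be"
  shows "independent B" "span B = V" "finite B"
    "\<And>b. b \<in> B \<Longrightarrow> star b \<in> B" "\<And>b. b \<in> B \<Longrightarrow> star (star b) = b" "\<And>b. b \<in> B \<Longrightarrow> lev (star b) = lev b"
    "\<And>b. b \<in> B \<Longrightarrow> linear (al b)" "\<And>b. b \<in> B \<Longrightarrow> linear (be b)"
    "\<And>b x. b \<in> B \<Longrightarrow> al (star b) x = al b x" "\<And>b x. b \<in> B \<Longrightarrow> be (star b) x = - be b x"
    "\<And>b x y. b \<in> B \<Longrightarrow> al b (br x y) = 0" "\<And>b x y. b \<in> B \<Longrightarrow> be b (br x y) = 0"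
    "\<And>b x. b \<in> B \<Longrightarrow> br x b - al b x *\<^sub>R b - be b x *\<^sub>R star b \<in> span {b' \<in> B. lev b' < lev b}"
  using assms finite_independent unfolding flag_basis_def by blast+

lemma flag_invariant:
  assumes fl: "flag_basis V B lev star al be" and v: "v \<in> span {b \<in> B. lev b < k}"
  shows "br x v \<in> span {b \<in> B. lev b < k}"
  using v
proof (induction rule: span_induct_alt)
  case base show ?case by (simp add: br_simps span_0)
next
  case (step c b v)
  let ?F = "{b \<in> B. lev b < k}"
  have b: "b \<in> B" "lev b < k" using step by auto
  have "br x b - al b x *\<^sub>R b - be b x *\<^sub>R star b \<in> span ?F"
    using flag_basisD(13)[OF fl b(1), of x] by (rule rev_subsetD[OF _ span_mono]) (use b(2) in auto)
  moreover have "al b x *\<^sub>R b + be b x *\<^sub>R star b \<in> span ?F"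
    using b flag_basisD(4,6)[OF fl b(1)] by (intro span_add span_scale span_base) auto
  ultimately have "(br x b - al b x *\<^sub>R b - be b x *\<^sub>R star b) + (al b x *\<^sub>R b + be b x *\<^sub>R star b) \<in> span ?F"
    by (rule span_add)
  then show ?case using step by (simp add: br_simps span_add span_scale)
qed

lemma flag_space_top:
  assumes "finite B"
  obtains k where "{b \<in> B. lev b < (k::nat)} = B"
proof
  show "{b \<in> B. lev b < Suc (Max (lev ` B))} = B" using assms by (auto simp: less_Suc_eq_le)
qed

lemma flag_ideal:
  assumes fl: "flag_basis V B lev star al be"
  shows "lie_ideal br V"
proof -
  obtain k where k: "{b \<in> B. lev b < k} = B" using flag_space_top flag_basisD(3)[OF fl] by blast
  show ?thesis
    using flag_invariant[OF fl, of _ k] flag_basisD(2)[OF fl] by (auto simp: k lie_ideal_def)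
qed

text \<open>The vectors of \<open>N\<close> are put on a new level above those of \<open>B\<close>, so triangularity for them only
  has to hold modulo \<open>U\<close>.\<close>

lemma flag_extend:
  assumes fl: "flag_basis U B lev star al be"
    and N: "independent (B \<union> N)" "N \<inter> B = {}"
    and new: "\<And>b. b \<in> N \<Longrightarrow> st b \<in> N" "\<And>b. b \<in> N \<Longrightarrow> st (st b) = b"
    "\<And>b. b \<in> N \<Longrightarrow> linear (al' b)" "\<And>b. b \<in> N \<Longrightarrow> linear (be' b)"
    "\<And>b x. b \<in> N \<Longrightarrow> al' (st b) x = al' b x" "\<And>b x. b \<in> N \<Longrightarrow> be' (st b) x = - be' b x"
    "\<And>b x y. b \<in> N \<Longrightarrow> al' b (br x y) = 0" "\<And>b x y. b \<in> N \<Longrightarrow> be' b (br x y) = 0"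
    "\<And>b x. b \<in> N \<Longrightarrow> br x b - al' b x *\<^sub>R b - be' b x *\<^sub>R st b \<in> U"
  shows "\<exists>lev star al be. flag_basis (span (B \<union> N)) (B \<union> N) lev star al be"
proof -
  obtain L where L: "{b \<in> B. lev b < L} = B" using flag_space_top flag_basisD(3)[OF fl] by blast
  let ?lev = "\<lambda>b. if b \<in> N then L else lev b" and ?star = "\<lambda>b. if b \<in> N then st b else star b"
  let ?al = "\<lambda>b. if b \<in> N then al' b else al b" and ?be = "\<lambda>b. if b \<in> N then be' b else be b"
  have notN: "b \<notin> N" if "b \<in> B" for b using that N by blast
  have "flag_basis (span (B \<union> N)) (B \<union> N) ?lev ?star ?al ?be"
    unfolding flag_basis_def
  proof (intro conjI ballI N(1) refl)
    fix b assume b: "b \<in> B \<union> N"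
    show "\<forall>x. br x b - ?al b x *\<^sub>R b - ?be b x *\<^sub>R ?star b \<in> span {b' \<in> B \<union> N. ?lev b' < ?lev b}"
    proof (cases "b \<in> N")
      case True
      have "{b' \<in> B \<union> N. ?lev b' < ?lev b} = B"
        using True L notN by auto
      then show ?thesis using True new(9) flag_basisD(2)[OF fl] by simp
    next
      case False
      then have "b \<in> B" using b by blast
      then have "lev b < L" using L by blast
      then have "{b' \<in> B \<union> N. ?lev b' < ?lev b} = {b' \<in> B. lev b' < lev b}"
        using False notN by auto
      then show ?thesis using False flag_basisD(13)[OF fl \<open>b \<in> B\<close>] by simp
    qed
  qed (use new flag_basisD(4-12)[OF fl] notN in auto)
  then show ?thesis by blast
qed

text \<open>Enlarge the ideal one block at a time. The eigenvector \<open>u + i w\<close> modulo \<open>U\<close> contributes a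
  rotation block if \<open>u\<close> and \<open>w\<close> are independent modulo \<open>U\<close>; otherwise a single vector is added, on
  which the action modulo \<open>U\<close> is by a real weight.\<close>

lemma flag_basis_exists_above:
  assumes solv: "solvable br" and V: "lie_ideal br V"
    and "flag_basis U B lev star al be" "U \<subseteq> V"
  shows "\<exists>B lev star al be. flag_basis V B lev star al be"
  using assms(3,4)
proof (induction "card gens - card B" arbitrary: U B lev star al be rule: less_induct)
  case less
  note fl = less.prems(1)
  have indB: "independent B" and spB: "span B = U" and finB: "finite B" using flag_basisD[OF fl] by auto
  have sV: "subspace V" using V by (simp add: lie_ideal_def)
  show ?case
  proof (cases "U = V")
    case True then show ?thesis using fl by blast
  next
    case False
    obtain u w a e where uw: "u \<in> V" "w \<in> V" "u \<notin> U \<or> w \<notin> U"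
      and act: "\<And>x. br x u - a x *\<^sub>R u + e x *\<^sub>R w \<in> U" "\<And>x. br x w - e x *\<^sub>R u - a x *\<^sub>R w \<in> U"
      and lin: "linear a" "linear e" and zero: "\<And>x y. a (br x y) = 0" "\<And>x y. e (br x y) = 0"
      using lie_quotient[OF solv flag_ideal[OF fl] V less.prems(2) False] by metis
    have sU: "subspace U" using spB by auto
    define Q where "Q N st al' be' \<longleftrightarrow> N \<noteq> {} \<and> N \<subseteq> V \<and> independent (B \<union> N) \<and> N \<inter> B = {} \<and>
      (\<forall>b\<in>N. st b \<in> N \<and> st (st b) = b \<and> linear (al' b) \<and> linear (be' b) \<and>
       (\<forall>x. al' (st b) x = al' b x \<and> be' (st b) x = - be' b x) \<and>
       (\<forall>x y. al' b (br x y) = 0 \<and> be' b (br x y) = 0) \<and>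
       (\<forall>x. br x b - al' b x *\<^sub>R b - be' b x *\<^sub>R st b \<in> U))"
      for N :: "'g set" and st :: "'g \<Rightarrow> 'g" and al' be' :: "'g \<Rightarrow> 'g \<Rightarrow> real"
    have "\<exists>N st al' be'. Q N st al' be'"
    proof -
      have one: ?thesis
        if b: "b \<in> V" "b \<notin> U" and f: "linear f" "\<And>x y. f (br x y) = (0::real)"
          and fb: "\<And>x. br x b - f x *\<^sub>R b \<in> U" for b f
      proof -
        have "independent (insert b B)" "b \<notin> B"
          using b indB spB by (auto simp: real_vector.independent_insert intro: span_base)
        with b f fb have "Q {b} id (\<lambda>_. f) (\<lambda>_ _. 0)"
          by (auto simp: Q_def linear_zero)
        then show ?thesis by blast
      qed
      consider "u \<notin> U" "w \<in> span (insert u B)" | "u \<in> U" "w \<notin> U" | "u \<notin> U" "w \<notin> span (insert u B)"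
        using uw by blast
      then show ?thesis
      proof cases
        case 1
        obtain k where k: "w - k *\<^sub>R u \<in> U"
          using 1(2) spB by (auto simp: span_insert)
        show ?thesis
        proof (rule one[of u "\<lambda>x. a x - k * e x"])
          show "linear (\<lambda>x. a x - k * e x)"
            using lin by (auto intro!: linearI simp: linear_add linear_scale algebra_simps)
          fix x
          have "(br x u - a x *\<^sub>R u + e x *\<^sub>R w) - e x *\<^sub>R (w - k *\<^sub>R u) \<in> U"
            by (rule subspace_diff[OF sU act(1) subspace_scale[OF sU k]])
          then show "br x u - (a x - k * e x) *\<^sub>R u \<in> U" by (simp add: algebra_simps)
        qed (use uw 1 zero in auto)
      next
        case 2
        show ?thesis
        proof (rule one[of w a])
          fix x
          have "(br x w - e x *\<^sub>R u - a x *\<^sub>R w) + e x *\<^sub>R u \<in> U"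
            by (rule subspace_add[OF sU act(2) subspace_scale[OF sU 2(1)]])
          then show "br x w - a x *\<^sub>R w \<in> U" by simp
        qed (use uw 2 zero lin in auto)
      next
        case 3
        have uB: "u \<notin> B" and wuB: "w \<notin> insert u B" using 3 spB by (auto intro: span_base)
        have "independent (insert u B)" using 3 indB spB by (simp add: real_vector.independent_insert uB)
        then have "independent (insert w (insert u B))" using 3 wuB by (simp add: real_vector.independent_insert)
        moreover have "B \<union> {u, w} = insert w (insert u B)" by auto
        ultimately have ind: "independent (B \<union> {u, w})" by simp
        \<comment> \<open>\<open>w\<close> corresponds to \<open>be = e\<close> and \<open>u\<close> to \<open>be = - e\<close>, as
            the eigenvector is \<open>u + i w\<close>\<close>
        let ?st = "\<lambda>b. if b = u then w else u" and ?be = "\<lambda>b x. if b = u then - e x else e x"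
        have "linear (\<lambda>x. - e x)" using lin by (auto intro!: linearI simp: linear_add linear_scale)
        then have "Q {u, w} ?st (\<lambda>_. a) ?be"
          using ind uw wuB uB act lin zero by (auto simp: Q_def algebra_simps)
        then show ?thesis by blast
      qed
    qed
    then obtain N st al' be' where "Q N st al' be'" by (elim exE)
    note Q = this[unfolded Q_def]
    have "\<exists>lev star al be. flag_basis (span (B \<union> N)) (B \<union> N) lev star al be"
      by (rule flag_extend[OF fl, of N st al' be']) (use Q in auto)
    then obtain lev' star' al'' be'' where fl': "flag_basis (span (B \<union> N)) (B \<union> N) lev' star' al'' be''"
      by blast
    have "B \<union> N \<subseteq> V" using Q spB less.prems(2) by (auto intro: span_base)
    then have "span (B \<union> N) \<subseteq> V" using sV by (rule span_minimal)
    moreover have "card gens - card (B \<union> N) < card gens - card B"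
    proof -
      have "finite (B \<union> N)" using Q finite_independent by blast
      then have "card B < card (B \<union> N)" using Q by (intro psubset_card_mono) auto
      moreover have "card (B \<union> N) \<le> card gens" using Q card_independent by blast
      ultimately show ?thesis by simp
    qed
    ultimately show ?thesis using less.hyps[OF _ fl'] by blast
  qed
qed

theorem flag_basis_exists:
  assumes "solvable br" "lie_ideal br V"
  obtains B lev star al be where "flag_basis V B lev star al be"
proof -
  have "flag_basis {0} {} (\<lambda>_. 0) id (\<lambda>_ _. 0) (\<lambda>_ _. 0)"
    by (simp add: flag_basis_def real_vector.independent_empty)
  moreover have "{0} \<subseteq> V" using assms by (auto simp: lie_ideal_def subspace_0)
  ultimately have "\<exists>B lev star al be. flag_basis V B lev star al be"
    by (rule flag_basis_exists_above[OF assms])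
  then show thesis using that by (elim exE)
qed

lemma flag_strict:
  assumes fl: "flag_basis V B lev star al be" and x: "\<forall>b\<in>B. al b x = 0 \<and> be b x = 0"
    and v: "v \<in> span {b \<in> B. lev b < Suc k}"
  shows "br x v \<in> span {b \<in> B. lev b < k}"
  using v
proof (induction rule: span_induct_alt)
  case base show ?case by (simp add: br_simps span_0)
next
  case (step c b v)
  have b: "b \<in> B" "lev b \<le> k" using step by auto
  have "br x b \<in> span {b' \<in> B. lev b' < lev b}"
    using flag_basisD(13)[OF fl b(1), of x] x b(1) by simp
  then have "br x b \<in> span {b \<in> B. lev b < k}"
    using b by (elim rev_subsetD[OF _ span_mono]) auto
  then show ?case using step by (simp add: br_simps span_add span_scale)
qed

text \<open>For an ad-nilpotent \<open>x\<close> this shows that a power of each weight vanishes, hence the weight itself.\<close>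

lemma flag_power:
  assumes fl: "flag_basis V B lev star al be" and b: "b \<in> B"
  shows "(br x ^^ m) b - Re (Complex (al b x) (be b x) ^ m) *\<^sub>R b - Im (Complex (al b x) (be b x) ^ m) *\<^sub>R star b
    \<in> span {b' \<in> B. lev b' < lev b}"
proof (induction m)
  case 0 show ?case by (simp add: span_0)
next
  case (Suc m)
  let ?F = "span {b' \<in> B. lev b' < lev b}"
  define p where "p = Re (Complex (al b x) (be b x) ^ m)"
  define q where "q = Im (Complex (al b x) (be b x) ^ m)"
  define v where "v = (br x ^^ m) b"
  note s = flag_basisD[OF fl]
  have "br x (v - p *\<^sub>R b - q *\<^sub>R star b) \<in> ?F"
    using flag_invariant[OF fl Suc.IH] by (simp add: v_def p_def q_def)
  moreover have "br x b - al b x *\<^sub>R b - be b x *\<^sub>R star b \<in> ?F" using s(13)[OF b] .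
  moreover have "br x (star b) - al b x *\<^sub>R star b + be b x *\<^sub>R b \<in> ?F"
    using s(13)[OF s(4)[OF b], of x] s(5,6,9,10)[OF b] by simp
  ultimately have "br x (v - p *\<^sub>R b - q *\<^sub>R star b) + p *\<^sub>R (br x b - al b x *\<^sub>R b - be b x *\<^sub>R star b)
      + q *\<^sub>R (br x (star b) - al b x *\<^sub>R star b + be b x *\<^sub>R b) \<in> ?F"
    by (meson span_add span_scale)
  then show ?case
    by (simp add: br_simps algebra_simps v_def[symmetric] p_def[symmetric] q_def[symmetric])
qed

lemma flag_weights_zero:
  assumes fl: "flag_basis V B lev star al be" and nil: "\<And>v. v \<in> V \<Longrightarrow> (br x ^^ m) v = 0" and b: "b \<in> B"
  shows "al b x = 0" "be b x = 0"
proof -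
  note s = flag_basisD[OF fl]
  define c where "c = Complex (al b x) (be b x)"
  have "b \<in> V" using b s(2) by (auto intro: span_base)
  then have in_F: "- Re (c ^ m) *\<^sub>R b - Im (c ^ m) *\<^sub>R star b \<in> span {b' \<in> B. lev b' < lev b}"
    using flag_power[OF fl b, of m x] nil by (simp add: c_def)
  have sp: "b \<in> span B" "star b \<in> span B" using b s(4) by (auto intro: span_base)
  have rep: "representation B (- Re (c ^ m) *\<^sub>R b - Im (c ^ m) *\<^sub>R star b) d =
      - Re (c ^ m) * (if d = b then 1 else 0) - Im (c ^ m) * (if d = star b then 1 else 0)" for d
    using s(1) sp b s(4)[OF b]
    by (simp add: real_vector.representation_diff real_vector.representation_scale real_vector.representation_neg
        real_vector.representation_basis span_scale span_neg)
  have z: "- Re (c ^ m) * (if d = b then 1 else 0) - Im (c ^ m) * (if d = star b then 1 else 0) = 0"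
    if "d = b \<or> d = star b" for d
    using representation_zero_outside[OF s(1) _ in_F, of d] that s(6)[OF b] rep[of d] by auto
  have "c ^ m = 0"
  proof (cases "star b = b")
    case True
    then have "be b x = 0" using s(10)[OF b, of x] by simp
    then have "c = of_real (al b x)" by (simp add: c_def complex_eq_iff)
    then have "Im (c ^ m) = 0" by (metis Im_complex_of_real of_real_power)
    moreover have "Re (c ^ m) = 0" using z[of b] True calculation by simp
    ultimately show ?thesis by (simp add: complex_eq_iff)
  next
    case False
    then show ?thesis using z[of b] z[of "star b"] by (simp add: complex_eq_iff)
  qed
  then have "c = 0" by simp
  then show "al b x = 0" "be b x = 0" by (simp_all add: c_def complex_eq_iff)
qed

section \<open>The nilradical\<close>

lemma lower_central_series_contains_powers:
  assumes "lie_ideal br I" "x \<in> I"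
  shows "(br x ^^ Suc k) v \<in> lower_central_series br I k"
proof (induction k)
  case 0
  have "- br v x \<in> I" using assms by (auto simp: lie_ideal_def subspace_neg)
  then show ?case using br_anticomm[of x v] by simp
next
  case (Suc k)
  then show ?case using assms(2) by (auto simp: bracket_span_def intro!: span_base)
qed

text \<open>Take a triangular basis of the whole algebra and let \<open>N\<close> be the common kernel of its weights. Weights
  vanish on brackets, so \<open>N\<close> is an ideal; elements of \<open>N\<close> lower the level, so it is nilpotent; and an
  ad-nilpotent element, in particular any element of a nilpotent ideal, has only zero weights. This
  identifies \<open>N\<close> as the greatest nilpotent ideal.\<close>

lemma nilradical_solvable:
  assumes solv: "solvable br"
  shows "lie_ideal br (nilradical br)" "nilpotent br (nilradical br)" "br x y \<in> nilradical br"
    "(\<And>v. (br z ^^ m) v = 0) \<Longrightarrow> z \<in> nilradical br"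
proof -
  have "lie_ideal br UNIV" by (simp add: lie_ideal_def)
  then obtain B lev star al be where fl: "flag_basis UNIV B lev star al be"
    using flag_basis_exists[OF solv] by blast
  note s = flag_basisD[OF fl]
  define N where "N = {x. \<forall>b\<in>B. al b x = 0 \<and> be b x = 0}"
  have brN: "br x y \<in> N" for x y using s(11,12) by (auto simp: N_def)
  have ad: "z \<in> N" if "\<And>v. (br z ^^ m) v = 0" for z m
    using flag_weights_zero[OF fl that] by (auto simp: N_def)
  have sN: "subspace N"
    using s(7,8) by (auto simp: N_def subspace_def linear_0 linear_add linear_scale)
  have idN: "lie_ideal br N" using sN brN by (simp add: lie_ideal_def)
  obtain K where K: "{b \<in> B. lev b < K} = B" using flag_space_top s(3) by blast
  have lcs: "lower_central_series br N j \<subseteq> span {b \<in> B. lev b < K - j}" for j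
  proof (induction j)
    case 0 show ?case using K s(2) by simp
  next
    case (Suc j)
    have "br x y \<in> span {b \<in> B. lev b < K - Suc j}" if x: "x \<in> N" and y: "y \<in> lower_central_series br N j" for x y
    proof (cases "j < K")
      case True
      then have "y \<in> span {b \<in> B. lev b < Suc (K - Suc j)}" using Suc y by (auto simp: Suc_diff_Suc)
      then show ?thesis using flag_strict[OF fl] x by (auto simp: N_def)
    next
      case False
      then have "y = 0" using Suc y by auto
      then show ?thesis by (simp add: br_simps span_0)
    qed
    then show ?case unfolding lower_central_series.simps bracket_span_def
      by (intro span_minimal) auto
  qed
  have "0 \<in> lower_central_series br N K"
    using sN by (cases K) (auto simp: subspace_0 bracket_span_def span_0)
  then have "lower_central_series br N K = {0}" using lcs[of K] by auto
  then have nilN: "nilpotent br N" by (auto simp: nilpotent_def)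
  have greatest: "I \<subseteq> N" if I: "lie_ideal br I" "nilpotent br I" for I
  proof
    fix x assume x: "x \<in> I"
    obtain k where "lower_central_series br I k = {0}" using I by (auto simp: nilpotent_def)
    then have "(br x ^^ Suc k) v = 0" for v
      using lower_central_series_contains_powers[OF I(1) x, of k v] by simp
    then show "x \<in> N" by (rule ad)
  qed
  have "nilradical br = N"
    unfolding nilradical_def by (rule Greatest_equality) (use idN nilN greatest in auto)
  then show "lie_ideal br (nilradical br)" "nilpotent br (nilradical br)" "br x y \<in> nilradical br"
    "(\<And>v. (br z ^^ m) v = 0) \<Longrightarrow> z \<in> nilradical br"
    using idN nilN brN ad[of m z] by auto
qed

lemma nilradical_nonzero:
  assumes "solvable br" "\<exists>x::'g. x \<noteq> 0"
  shows "nilradical br \<noteq> {0}"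
proof
  assume n: "nilradical br = {0}"
  have "br x y = 0" for x y using nilradical_solvable(3)[OF assms(1), of x y] n by simp
  then have "x \<in> nilradical br" for x
    using nilradical_solvable(4)[OF assms(1), of 1 x] by simp
  then show False using n assms(2) by blast
qed

text \<open>The last nonzero term of the lower central series is central.\<close>

lemma centre_of_nilpotent_nonzero:
  assumes N: "lie_ideal br N" "nilpotent br N" "N \<noteq> {0}"
  shows "\<exists>x\<in>centre br N. x \<noteq> 0"
proof -
  let ?L = "lower_central_series br N"
  have sN: "subspace N" using N by (simp add: lie_ideal_def)
  have sub: "?L k \<subseteq> N" for k
  proof (induction k)
    case (Suc k)
    then have "br x y \<in> N" if "y \<in> ?L k" for x y using that N by (auto simp: lie_ideal_def)
    then show ?case unfolding lower_central_series.simps bracket_span_def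
      using sN by (intro span_minimal) auto
  qed simp
  have z: "0 \<in> ?L k" for k using sN by (cases k) (auto simp: subspace_0 bracket_span_def span_0)
  obtain k where "?L k = {0}" using N by (auto simp: nilpotent_def)
  then obtain k where k: "?L k = {0}" and least: "\<And>j. j < k \<Longrightarrow> ?L j \<noteq> {0}"
    using LeastI[of "\<lambda>k. ?L k = {0}"] not_less_Least[of _ "\<lambda>k. ?L k = {0}"] by metis
  obtain j where j: "k = Suc j" using k N(3) by (cases k) auto
  then obtain x where x: "x \<in> ?L j" "x \<noteq> 0" using least[of j] z[of j] by blast
  have "br x y = 0" if "y \<in> N" for y
  proof -
    have "br y x \<in> ?L k" using that x j by (auto simp: bracket_span_def intro!: span_base)
    then show ?thesis using k br_anticomm[of x y] by simp
  qed
  then have "x \<in> centre br N" using x sub by (auto simp: centre_def)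
  then show ?thesis using x by blast
qed

lemma centre_ideal:
  assumes "lie_ideal br N"
  shows "lie_ideal br (centre br N)"
proof -
  have sN: "subspace N" and iN: "\<And>x y. y \<in> N \<Longrightarrow> br x y \<in> N" using assms by (auto simp: lie_ideal_def)
  have "br (br x y) z = 0" if "y \<in> centre br N" "z \<in> N" for x y z
    using that iN by (simp add: br_br centre_def br_simps)
  then show ?thesis
    using sN iN by (auto simp: lie_ideal_def centre_def subspace_def br_simps)
qed

end

section \<open>Inner products and traces\<close>

text \<open>The usual exchange of two bases, which is \<open>Tr (S T) = Tr (T S)\<close> written out in coordinates.\<close>

lemma endo_trace_basis:
  fixes f :: "'a::real_vector \<Rightarrow> 'a"
  assumes f: "linear f" and B: "finite B" "independent B" "span B = UNIV"
  shows "endo_trace f = (\<Sum>b\<in>B. representation B (f b) b)"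
proof -
  define C :: "'a set" where "C = extend_basis {}"
  have C: "independent C" "span C = UNIV"
    using real_vector.independent_extend_basis[of "{}"] real_vector.span_extend_basis[of "{}"]
    by (simp_all add: C_def real_vector.independent_empty)
  have fC: "finite C" using real_vector.independent_span_bound[OF B(1) C(1)] B(3) by auto
  have exp: "(\<Sum>d\<in>D. representation D v d *\<^sub>R d) = v"
    if "independent D" "span D = UNIV" "finite D" for D and v :: 'a
    using that by (intro real_vector.sum_representation_eq) auto
  note lin = real_vector.representation_add real_vector.representation_scale real_vector.representation_sum
  have "(\<Sum>b\<in>B. representation B (f b) b) = (\<Sum>b\<in>B. representation B (\<Sum>c\<in>C. representation C (f b) c *\<^sub>R c) b)"
    by (simp add: exp C fC)
  also have "\<dots> = (\<Sum>b\<in>B. \<Sum>c\<in>C. representation C (f b) c * representation B c b)"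
    using B by (simp add: lin)
  also have "\<dots> = (\<Sum>c\<in>C. \<Sum>b\<in>B. representation B c b * representation C (f b) c)"
    by (subst sum.swap) (simp add: mult.commute)
  also have "\<dots> = (\<Sum>c\<in>C. representation C (f (\<Sum>b\<in>B. representation B c b *\<^sub>R b)) c)"
    using C by (simp add: lin linear_sum[OF f] linear_scale[OF f])
  also have "\<dots> = (\<Sum>c\<in>C. representation C (f c) c)" by (simp add: exp B)
  finally show ?thesis by (simp add: endo_trace_def C_def)
qed

locale metric =
  fixes ip :: "'g::real_vector \<Rightarrow> 'g \<Rightarrow> real"
  assumes inner_product: "inner_product ip"
begin

lemma bilinear_ip: "bilinear ip"
  using inner_product by (simp add: inner_product_def)

lemma ip_simps:
  "ip (x + y) z = ip x z + ip y z" "ip x (y + z) = ip x y + ip x z"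
  "ip (x - y) z = ip x z - ip y z" "ip x (y - z) = ip x y - ip x z"
  "ip (r *\<^sub>R x) z = r * ip x z" "ip x (r *\<^sub>R z) = r * ip x z"
  "ip 0 z = 0" "ip x 0 = 0" "ip (- x) z = - ip x z" "ip x (- z) = - ip x z"
  using bilinear_ip by (simp_all add: bilinear_ladd bilinear_radd bilinear_lsub bilinear_rsub bilinear_lmul
      bilinear_rmul bilinear_lzero bilinear_rzero bilinear_lneg bilinear_rneg)

lemma ip_sum: "ip (\<Sum>i\<in>I. f i) z = (\<Sum>i\<in>I. ip (f i) z)" "ip z (\<Sum>i\<in>I. f i) = (\<Sum>i\<in>I. ip z (f i))"
  by (induction I rule: infinite_finite_induct) (simp_all add: ip_simps)

lemma ip_sym: "ip x y = ip y x"
  using inner_product by (simp add: inner_product_def)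

lemma ip_pos: "x \<noteq> 0 \<Longrightarrow> ip x x > 0"
  using inner_product by (simp add: inner_product_def)

lemma ip_nonneg: "ip x x \<ge> 0"
  using ip_pos[of x] by (cases "x = 0") (auto simp: ip_simps)

definition orthonormal :: "'g set \<Rightarrow> bool" where
  "orthonormal S \<longleftrightarrow> finite S \<and> (\<forall>e\<in>S. \<forall>f\<in>S. ip e f = (if e = f then 1 else 0))"

lemma orthonormal_basis_iff: "orthonormal_basis ip E \<longleftrightarrow> orthonormal E \<and> span E = UNIV"
  by (auto simp: orthonormal_basis_def orthonormal_def)

text \<open>Gram-Schmidt. Keeping the given system \<open>S\<close> makes it possible to adapt an orthonormal basis to a
  subspace.\<close>

lemma orthonormal_extend:
  assumes "orthonormal S" "finite C"
  obtains T where "S \<subseteq> T" "orthonormal T" "span T = span (S \<union> C)"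
proof -
  have "\<exists>T. S \<subseteq> T \<and> orthonormal T \<and> span T = span (S \<union> C)"
    using assms(2)
  proof induction
    case empty show ?case using assms(1) by auto
  next
    case (insert c C)
    then obtain T where T: "S \<subseteq> T" "orthonormal T" "span T = span (S \<union> C)" by blast
    have fT: "finite T" and oT: "\<And>e f. e \<in> T \<Longrightarrow> f \<in> T \<Longrightarrow> ip e f = (if e = f then 1 else 0)"
      using T(2) by (auto simp: orthonormal_def)
    define p where "p = (\<Sum>e\<in>T. ip c e *\<^sub>R e)"
    define d where "d = c - p"
    have p: "p \<in> span T" unfolding p_def by (intro span_sum span_scale span_base)
    have d: "ip d e = 0" if "e \<in> T" for e
    proof -
      have "ip p e = (\<Sum>f\<in>T. ip c f * (if f = e then 1 else 0))"
        using that by (auto simp: p_def ip_sum ip_simps oT intro!: sum.cong)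
      also have "\<dots> = ip c e" using that fT by (simp add: mult_delta_right)
      finally show ?thesis by (simp add: d_def ip_simps)
    qed
    have sp: "span (S \<union> insert c C) = span (insert c T)"
      using T(3) by (simp add: span_insert)
    show ?case
    proof (cases "d = 0")
      case True
      then have "c \<in> span T" using p by (simp add: d_def)
      then have "span (insert c T) = span T" by (rule real_vector.span_redundant)
      then show ?thesis using T sp by auto
    next
      case False
      define r where "r = sqrt (ip d d)"
      have r: "r > 0" "r * r = ip d d" using ip_pos[OF False] by (simp_all add: r_def)
      define e where "e = (1 / r) *\<^sub>R d"
      have ee: "ip e e = 1" using r ip_pos[OF False] by (simp add: e_def ip_simps)
      have eT: "ip e f = 0" "ip f e = 0" if "f \<in> T" for f
        using d[OF that] ip_sym[of f e] by (auto simp: e_def ip_simps)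
      have "e \<notin> T" using ee eT by force
      then have "orthonormal (insert e T)"
        using T(2) ee eT by (auto simp: orthonormal_def)
      moreover have "span (insert e T) = span (insert c T)"
        unfolding span_eq
      proof (intro conjI)
        have "e = (1 / r) *\<^sub>R (c - p)" by (simp add: e_def d_def)
        moreover have "(1 / r) *\<^sub>R (c - p) \<in> span (insert c T)"
          using p span_mono[of T "insert c T"] by (intro span_scale span_diff) (auto intro: span_base)
        ultimately show "insert e T \<subseteq> span (insert c T)" by (auto intro: span_base)
        have "c = r *\<^sub>R e + p" using r by (simp add: e_def d_def)
        moreover have "r *\<^sub>R e + p \<in> span (insert e T)"
          using p span_mono[of T "insert e T"] by (intro span_scale span_add) (auto intro: span_base)
        ultimately show "insert c T \<subseteq> span (insert e T)" by (auto intro: span_base)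
      qed
      ultimately show ?thesis using T(1) sp by (intro exI[of _ "insert e T"]) auto
    qed
  qed
  then show thesis using that by blast
qed

lemma orthonormal_basis_exists:
  assumes "finite (C::'g set)" "span C = UNIV"
  obtains E where "orthonormal_basis ip E"
proof -
  have "orthonormal {}" by (simp add: orthonormal_def)
  then obtain T where "orthonormal T" "span T = span ({} \<union> C)"
    using orthonormal_extend assms(1) by metis
  then show thesis using that assms(2) by (simp add: orthonormal_basis_iff)
qed

lemma orthonormal_expansion:
  assumes E: "orthonormal E" and x: "x \<in> span E"
  shows "(\<Sum>e\<in>E. ip x e *\<^sub>R e) = x"
  using x
proof (induction rule: span_induct_alt)
  case base show ?case by (simp add: ip_simps)
next
  case (step c b y)
  have "(\<Sum>e\<in>E. ip b e *\<^sub>R e) = (\<Sum>e\<in>E. if e = b then e else 0)"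
    using E step(1) by (intro sum.cong) (auto simp: orthonormal_def)
  also have "\<dots> = b" using E step(1) by (simp add: orthonormal_def)
  finally have "(\<Sum>e\<in>E. ip b e *\<^sub>R e) = b" .
  moreover have "(\<Sum>e\<in>E. ip (c *\<^sub>R b + y) e *\<^sub>R e) = c *\<^sub>R (\<Sum>e\<in>E. ip b e *\<^sub>R e) + (\<Sum>e\<in>E. ip y e *\<^sub>R e)"
    by (simp add: ip_simps scaleR_add_left sum.distrib scaleR_sum_right)
  ultimately show ?case using step.IH by simp
qed

lemma orthonormal_parseval:
  assumes E: "orthonormal E" and x: "x \<in> span E"
  shows "ip x y = (\<Sum>e\<in>E. ip x e * ip y e)"
proof -
  have "ip x y = ip (\<Sum>e\<in>E. ip x e *\<^sub>R e) y" using orthonormal_expansion[OF assms] by simp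
  then show ?thesis by (simp add: ip_sum ip_simps ip_sym)
qed

lemma orthonormal_independent:
  assumes "orthonormal E"
  shows "independent E"
proof (rule real_vector.independent_if_scalars_zero)
  show "finite E" using assms by (simp add: orthonormal_def)
  fix f x assume s: "(\<Sum>x\<in>E. f x *\<^sub>R x) = 0" and x: "x \<in> E"
  have "0 = ip (\<Sum>x\<in>E. f x *\<^sub>R x) x" by (simp add: s ip_simps)
  also have "\<dots> = (\<Sum>y\<in>E. f y * (if y = x then 1 else 0))"
    using assms x by (auto simp: ip_sum ip_simps orthonormal_def intro!: sum.cong)
  also have "\<dots> = f x" using assms x by (simp add: orthonormal_def mult_delta_right)
  finally show "f x = 0" by simp
qed

lemma endo_trace_orthonormal:
  assumes f: "linear f" and E: "orthonormal_basis ip E"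
  shows "endo_trace f = (\<Sum>e\<in>E. ip (f e) e)"
proof -
  have o: "orthonormal E" "span E = UNIV" "finite E"
    using E by (auto simp: orthonormal_basis_iff orthonormal_def)
  have "representation E x e = ip x e" if "e \<in> E" for x e
  proof -
    have "representation E x = (\<lambda>e. if e \<in> E then ip x e else 0)"
    proof (rule real_vector.representation_eqI)
      show "independent E" using o orthonormal_independent by blast
      show "(\<Sum>b | (if b \<in> E then ip x b else 0) \<noteq> 0. (if b \<in> E then ip x b else 0) *\<^sub>R b) = x"
      proof -
        have "(\<Sum>b | (if b \<in> E then ip x b else 0) \<noteq> 0. (if b \<in> E then ip x b else 0) *\<^sub>R b) =
            (\<Sum>b\<in>E. ip x b *\<^sub>R b)"
          using o(3) by (intro sum.mono_neutral_cong_left) auto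
        then show ?thesis using orthonormal_expansion[OF o(1)] o(2) by simp
      qed
    qed (use o in \<open>auto split: if_splits\<close>)
    then show ?thesis using that by simp
  qed
  then show ?thesis
    using endo_trace_basis[OF f, of E] o orthonormal_independent by simp
qed

text \<open>Every sum over the orthonormal basis in the Ricci form has this shape, so the form does not depend on
  the basis.\<close>

lemma bilinear_trace_independent:
  assumes Q: "bilinear (Q :: 'g \<Rightarrow> 'g \<Rightarrow> real)" and E: "orthonormal_basis ip E" and F: "orthonormal_basis ip F"
  shows "(\<Sum>e\<in>E. Q e e) = (\<Sum>f\<in>F. Q f f)"
proof -
  have oE: "orthonormal E" "span E = UNIV" "finite E" and oF: "orthonormal F" "span F = UNIV" "finite F"
    using E F by (auto simp: orthonormal_basis_iff orthonormal_def)
  have exp: "Q x y = (\<Sum>f\<in>F. \<Sum>g\<in>F. ip x f * ip y g * Q f g)" for x y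
  proof -
    have "Q x y = Q (\<Sum>f\<in>F. ip x f *\<^sub>R f) (\<Sum>g\<in>F. ip y g *\<^sub>R g)"
      using orthonormal_expansion[OF oF(1)] oF(2) by simp
    also have "\<dots> = (\<Sum>(f, g)\<in>F \<times> F. Q (ip x f *\<^sub>R f) (ip y g *\<^sub>R g))"
      by (rule bilinear_sum[OF Q])
    also have "\<dots> = (\<Sum>f\<in>F. \<Sum>g\<in>F. ip x f * ip y g * Q f g)"
      by (simp add: sum.cartesian_product[symmetric] bilinear_lmul[OF Q] bilinear_rmul[OF Q] mult_ac)
    finally show ?thesis .
  qed
  have "(\<Sum>e\<in>E. Q e e) = (\<Sum>e\<in>E. \<Sum>f\<in>F. \<Sum>g\<in>F. ip e f * ip e g * Q f g)"
    by (subst exp) simp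
  also have "\<dots> = (\<Sum>f\<in>F. \<Sum>g\<in>F. \<Sum>e\<in>E. ip e f * ip e g * Q f g)"
    by (simp add: sum.swap[of _ _ E])
  also have "\<dots> = (\<Sum>f\<in>F. \<Sum>g\<in>F. ip f g * Q f g)"
  proof (intro sum.cong refl)
    fix f g
    have "(\<Sum>e\<in>E. ip e f * ip e g) = ip f g"
      using orthonormal_parseval[OF oE(1), of f g] oE(2) by (simp add: ip_sym)
    then show "(\<Sum>e\<in>E. ip e f * ip e g * Q f g) = ip f g * Q f g" by (simp flip: sum_distrib_right)
  qed
  also have "\<dots> = (\<Sum>f\<in>F. \<Sum>g\<in>F. if g = f then Q f g else 0)"
    using oF(1) by (intro sum.cong) (auto simp: orthonormal_def)
  also have "\<dots> = (\<Sum>f\<in>F. Q f f)" using oF(3) by simp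
  finally show ?thesis .
qed

end

section \<open>The mean curvature vector and the Ricci form\<close>

locale metric_lie_algebra = fd_lie_algebra br gens + metric ip
  for br :: "'g::real_vector \<Rightarrow> 'g \<Rightarrow> 'g" and gens and ip :: "'g \<Rightarrow> 'g \<Rightarrow> real"
begin

lemma mean_curvature_vector: "ip (mean_curvature_vector br ip) x = endo_trace (br x)"
proof -
  obtain E where E: "orthonormal_basis ip E"
    using orthonormal_basis_exists[OF finite_gens span_gens] .
  then have oE: "orthonormal E" "span E = UNIV" by (auto simp: orthonormal_basis_iff)
  define h where "h = (\<Sum>e\<in>E. endo_trace (br e) *\<^sub>R e)"
  have tr: "endo_trace (br x) = (\<Sum>e\<in>E. ip (br x e) e)" for x
    by (rule endo_trace_orthonormal[OF linear_br E])
  have lin: "linear (\<lambda>x. endo_trace (br x))"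
    by (rule linearI) (simp_all add: tr br_simps ip_simps sum.distrib sum_distrib_left)
  have h: "ip h x = endo_trace (br x)" for x
  proof -
    have "endo_trace (br x) = endo_trace (br (\<Sum>e\<in>E. ip x e *\<^sub>R e))"
      using orthonormal_expansion[OF oE(1)] oE(2) by simp
    also have "\<dots> = (\<Sum>e\<in>E. ip x e * endo_trace (br e))"
      using linear_sum[OF lin, of "\<lambda>e. ip x e *\<^sub>R e" E] linear_scale[OF lin] by simp
    also have "\<dots> = ip h x" by (simp add: h_def ip_sum ip_simps ip_sym[of x] mult.commute)
    finally show ?thesis by simp
  qed
  have "(THE h. \<forall>x. ip h x = endo_trace (br x)) = h"
  proof (rule the_equality)
    show "\<forall>x. ip h x = endo_trace (br x)" using h by blast
    fix k assume k: "\<forall>x. ip k x = endo_trace (br x)"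
    then have "ip (k - h) (k - h) = 0" using h[of "k - h"] by (simp add: ip_simps(3))
    then have "k - h = 0" using ip_pos[of "k - h"] by fastforce
    then show "k = h" by simp
  qed
  then show ?thesis using h by (simp add: mean_curvature_vector_def)
qed

lemma ricci_formula:
  assumes E: "orthonormal_basis ip E"
  shows "ricci br ip x =
    - ip (br (mean_curvature_vector br ip) x) x
    - 1/2 * (\<Sum>e\<in>E. ip (br x (br x e)) e)
    - 1/2 * (\<Sum>e\<in>E. ip (br x e) (br x e))
    + 1/4 * (\<Sum>e\<in>E. \<Sum>f\<in>E. (ip (br e f) x)\<^sup>2)"
proof -
  define F where "F = (SOME E. orthonormal_basis ip E)"
  have F: "orthonormal_basis ip F" unfolding F_def using E by (rule someI)
  have bil: "bilinear (\<lambda>y z. ip (br x y) (br x z))"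
    by (auto simp: bilinear_def br_simps ip_simps intro!: linearI)
  have s1: "(\<Sum>e\<in>F. ip (br x e) (br x e)) = (\<Sum>e\<in>E. ip (br x e) (br x e))"
    by (rule bilinear_trace_independent[OF bil F E])
  have b1: "bilinear (\<lambda>y z. \<Sum>f\<in>F. ip (br y f) x * ip (br z f) x)"
    by (auto simp: bilinear_def br_simps ip_simps sum.distrib sum_distrib_left algebra_simps intro!: linearI)
  have b2: "bilinear (\<lambda>y z. \<Sum>f\<in>E. ip (br f y) x * ip (br f z) x)"
    by (auto simp: bilinear_def br_simps ip_simps sum.distrib sum_distrib_left algebra_simps intro!: linearI)
  have "(\<Sum>e\<in>F. \<Sum>f\<in>F. (ip (br e f) x)\<^sup>2) = (\<Sum>e\<in>E. \<Sum>f\<in>F. (ip (br e f) x)\<^sup>2)"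
    using bilinear_trace_independent[OF b1 F E] by (simp add: power2_eq_square)
  also have "\<dots> = (\<Sum>f\<in>F. \<Sum>e\<in>E. (ip (br e f) x)\<^sup>2)" by (rule sum.swap)
  also have "\<dots> = (\<Sum>f\<in>E. \<Sum>e\<in>E. (ip (br e f) x)\<^sup>2)"
    using bilinear_trace_independent[OF b2 F E] by (simp add: power2_eq_square)
  also have "\<dots> = (\<Sum>e\<in>E. \<Sum>f\<in>E. (ip (br e f) x)\<^sup>2)" by (rule sum.swap)
  finally have s2: "(\<Sum>e\<in>F. \<Sum>f\<in>F. (ip (br e f) x)\<^sup>2) = (\<Sum>e\<in>E. \<Sum>f\<in>E. (ip (br e f) x)\<^sup>2)" .
  have k: "killing_form br x x = (\<Sum>e\<in>E. ip (br x (br x e)) e)"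
    unfolding killing_form_def
    using endo_trace_orthonormal[OF linear_compose[OF linear_br linear_br] E] by simp
  show ?thesis by (simp add: ricci_def Let_def F_def[symmetric] s1 s2 k)
qed

end

section \<open>Negative Ricci curvature forces positive eigenvalues on the centre\<close>

context metric_lie_algebra
begin

text \<open>For \<open>x\<close> in an abelian ideal, \<open>ad x\<close> squares to zero, so the Killing form does not contribute. In the
  last sum of the Ricci form, pairs of basis vectors within \<open>D\<close> contribute nothing, mixed pairs occur
  twice, and the remaining ones are nonnegative and are dropped. The inner sum over \<open>D\<close> is the
  squared length of the adjoint of \<open>ad e\<close> on the ideal, applied to \<open>x\<close>.\<close>

lemma ricci_abelian_ideal:
  assumes Z: "lie_ideal br Z" "\<And>x y. x \<in> Z \<Longrightarrow> y \<in> Z \<Longrightarrow> br x y = 0"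
    and E: "orthonormal_basis ip E" and D: "D \<subseteq> E" "span D = Z" and x: "x \<in> Z"
  shows "ricci br ip x \<ge> - ip (br (mean_curvature_vector br ip) x) x
    + 1/2 * (\<Sum>e\<in>E. (\<Sum>f\<in>D. (ip (br e f) x)\<^sup>2) - ip (br e x) (br e x))"
proof -
  have brZ: "br y x \<in> Z" "br x y \<in> Z" for y
    using Z(1) x br_anticomm[of x y] by (auto simp: lie_ideal_def subspace_neg)
  have fE: "finite E" using E by (simp add: orthonormal_basis_def)
  have DZ: "f \<in> Z" if "f \<in> D" for f using that D(2) by (auto intro: span_base)
  let ?q = "\<lambda>e f. (ip (br e f) x)\<^sup>2"
  have q0: "?q e f = 0" if "e \<in> D" "f \<in> D" for e f using Z(2) DZ that by (simp add: ip_simps)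
  have qsym: "?q e f = ?q f e" for e f using br_anticomm[of e f] by (simp add: ip_simps)
  have kill: "(\<Sum>e\<in>E. ip (br x (br x e)) e) = 0"
    using Z(2)[OF x brZ(2)] by (simp add: ip_simps)
  have sq: "(\<Sum>e\<in>E. ip (br x e) (br x e)) = (\<Sum>e\<in>E. ip (br e x) (br e x))"
    by (intro sum.cong refl) (subst (1 2) br_anticomm, simp add: ip_simps)
  have split: "(\<Sum>e\<in>E. g e) = (\<Sum>e\<in>E - D. g e) + (\<Sum>e\<in>D. g e)" for g :: "'g \<Rightarrow> real"
    using D(1) fE by (simp add: sum.subset_diff)
  have "(\<Sum>e\<in>E. \<Sum>f\<in>E. ?q e f) =
      (\<Sum>e\<in>E - D. \<Sum>f\<in>E - D. ?q e f) + (\<Sum>e\<in>E - D. \<Sum>f\<in>D. ?q e f) + (\<Sum>e\<in>D. \<Sum>f\<in>E - D. ?q e f)"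
    by (simp add: split sum.distrib q0)
  moreover have "(\<Sum>e\<in>D. \<Sum>f\<in>E - D. ?q e f) = (\<Sum>e\<in>E - D. \<Sum>f\<in>D. ?q e f)"
    by (subst sum.swap) (simp add: qsym)
  moreover have "(\<Sum>e\<in>E - D. \<Sum>f\<in>E - D. ?q e f) \<ge> 0" by (intro sum_nonneg) simp
  moreover have "(\<Sum>e\<in>E. \<Sum>f\<in>D. ?q e f) = (\<Sum>e\<in>E - D. \<Sum>f\<in>D. ?q e f)"
    by (simp add: split q0)
  ultimately have "(\<Sum>e\<in>E. \<Sum>f\<in>E. ?q e f) \<ge> 2 * (\<Sum>e\<in>E. \<Sum>f\<in>D. ?q e f)" by linarith
  then show ?thesis
    by (simp add: ricci_formula[OF E] kill sq sum_subtractf algebra_simps)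
qed

text \<open>The pair \<open>(u, w)\<close> stands for a common eigenvector \<open>u + i w\<close>, with eigenvalue \<open>a x + i b x\<close> of
  \<open>ad x\<close>. The adjoint of an operator maps an eigenvector to something at least as long as the
  operator itself does. In the sum of the estimates for \<open>u\<close> and \<open>w\<close> only the term with \<open>H\<close> is
  therefore left, and it equals \<open>- a H\<close> times the positive number \<open>M\<close>.\<close>

lemma eigenvalue_positive:
  assumes neg: "negative_ricci br ip"
    and Z: "lie_ideal br Z" "\<And>x y. x \<in> Z \<Longrightarrow> y \<in> Z \<Longrightarrow> br x y = 0"
    and uw: "u \<in> Z" "w \<in> Z" "u \<noteq> 0 \<or> w \<noteq> 0"
    and act: "\<And>x. br x u = a x *\<^sub>R u - b x *\<^sub>R w" "\<And>x. br x w = b x *\<^sub>R u + a x *\<^sub>R w"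
  shows "a (mean_curvature_vector br ip) > 0"
proof -
  define H where "H = mean_curvature_vector br ip"
  define M where "M = ip u u + ip w w"
  have M: "M > 0"
    using uw(3) ip_pos[of u] ip_pos[of w] ip_nonneg[of u] ip_nonneg[of w] by (auto simp: M_def)
  have sZ: "subspace Z" using Z by (simp add: lie_ideal_def)
  obtain C where C: "C \<subseteq> Z" "independent C" "Z \<subseteq> span C"
    using real_vector.maximal_independent_subset[of Z] by blast
  then have spC: "span C = Z" using span_minimal[OF C(1) sZ] by blast
  have "orthonormal {}" by (simp add: orthonormal_def)
  then obtain D where D: "orthonormal D" "span D = Z"
    using orthonormal_extend[of "{}" C] finite_independent[OF C(2)] spC by auto
  then obtain E where "D \<subseteq> E" "orthonormal E" "span E = span (D \<union> gens)"
    using orthonormal_extend[OF D(1) finite_gens] by metis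
  moreover have "span (D \<union> gens) = UNIV"
    using span_mono[of gens "D \<union> gens"] span_gens by auto
  ultimately have E: "D \<subseteq> E" "orthonormal_basis ip E" by (auto simp: orthonormal_basis_iff)
  have key: "(\<Sum>f\<in>D. (ip (br e f) u)\<^sup>2) + (\<Sum>f\<in>D. (ip (br e f) w)\<^sup>2) \<ge>
      ip (br e u) (br e u) + ip (br e w) (br e w)" for e
  proof -
    let ?p = "\<lambda>f. ip (br e f) u" and ?q = "\<lambda>f. ip (br e f) w"
    have adj: "(\<Sum>f\<in>D. ip (br e f) y * ip x f) = ip (br e x) y" if x: "x \<in> Z" for x y
    proof -
      have "ip (br e x) y = ip (br e (\<Sum>f\<in>D. ip x f *\<^sub>R f)) y"
        using orthonormal_expansion[OF D(1)] x D(2) by simp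
      then show ?thesis
        by (simp add: linear_sum[OF linear_br] br_simps ip_sum ip_simps mult.commute)
    qed
    have par: "(\<Sum>f\<in>D. ip x f * ip y f) = ip x y" if "x \<in> Z" for x y
      using orthonormal_parseval[OF D(1)] that D(2) by simp
    define \<alpha> where "\<alpha> = a e"
    define \<beta> where "\<beta> = b e"
    \<comment> \<open>The squared length of \<open>A\<^sup>* v - cnj \<lambda> v\<close> for \<open>v = u + i w\<close>, \<open>\<lambda> = \<alpha> + i \<beta>\<close> and
        \<open>A = ad e\<close>; expanded, it is \<open>\<parallel>A\<^sup>* v\<parallel>\<^sup>2 - \<bar>\<lambda>\<bar>\<^sup>2 \<parallel>v\<parallel>\<^sup>2\<close>.\<close>
    have "0 \<le> (\<Sum>f\<in>D. (?p f - \<alpha> * ip u f - \<beta> * ip w f)\<^sup>2 + (?q f - \<alpha> * ip w f + \<beta> * ip u f)\<^sup>2)"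
      by (intro sum_nonneg) simp
    also have "\<dots> = (\<Sum>f\<in>D. (?p f)\<^sup>2 + (?q f)\<^sup>2 + (\<alpha>\<^sup>2 + \<beta>\<^sup>2) * (ip u f * ip u f + ip w f * ip w f)
        - 2 * \<alpha> * (?p f * ip u f + ?q f * ip w f) - 2 * \<beta> * (?p f * ip w f - ?q f * ip u f))"
      by (intro sum.cong refl) (simp add: power2_eq_square algebra_simps)
    also have "\<dots> = (\<Sum>f\<in>D. (?p f)\<^sup>2) + (\<Sum>f\<in>D. (?q f)\<^sup>2) + (\<alpha>\<^sup>2 + \<beta>\<^sup>2) * M
        - 2 * \<alpha> * (ip (br e u) u + ip (br e w) w) - 2 * \<beta> * (ip (br e w) u - ip (br e u) w)"
      using uw by (simp add: sum.distrib sum_subtractf sum_distrib_left[symmetric] adj par M_def)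
    also have "\<dots> = (\<Sum>f\<in>D. (?p f)\<^sup>2) + (\<Sum>f\<in>D. (?q f)\<^sup>2) - (\<alpha>\<^sup>2 + \<beta>\<^sup>2) * M"
      by (simp add: act ip_simps \<alpha>_def[symmetric] \<beta>_def[symmetric] M_def ip_sym[of w u] power2_eq_square algebra_simps)
    finally have "(\<Sum>f\<in>D. (?p f)\<^sup>2) + (\<Sum>f\<in>D. (?q f)\<^sup>2) \<ge> (\<alpha>\<^sup>2 + \<beta>\<^sup>2) * M" by simp
    moreover have "ip (br e u) (br e u) + ip (br e w) (br e w) = (\<alpha>\<^sup>2 + \<beta>\<^sup>2) * M"
      by (simp add: act ip_simps \<alpha>_def[symmetric] \<beta>_def[symmetric] M_def ip_sym[of w u] power2_eq_square algebra_simps)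
    ultimately show ?thesis by simp
  qed
  \<comment> \<open>One of \<open>u\<close> and \<open>w\<close> may be zero, where negativity says nothing.\<close>
  have ric0: "ricci br ip 0 = 0"
    by (simp add: ricci_formula[OF E(2)] br_simps ip_simps)
  have le: "ricci br ip x \<le> 0" for x using neg ric0 by (cases "x = 0") (auto simp: negative_ricci_def intro: less_imp_le)
  define S where "S y = (\<Sum>e\<in>E. (\<Sum>f\<in>D. (ip (br e f) y)\<^sup>2) - ip (br e y) (br e y))" for y
  have "ricci br ip u + ricci br ip w < 0"
    using uw(3) neg le[of u] le[of w] by (auto simp: negative_ricci_def intro: add_neg_nonpos add_nonpos_neg)
  moreover have "ricci br ip u \<ge> - ip (br H u) u + 1/2 * S u" "ricci br ip w \<ge> - ip (br H w) w + 1/2 * S w"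
    unfolding S_def H_def
    using ricci_abelian_ideal[OF Z E(2,1) D(2) uw(1)] ricci_abelian_ideal[OF Z E(2,1) D(2) uw(2)] by auto
  moreover have "S u + S w \<ge> 0"
    unfolding S_def sum.distrib[symmetric]
  proof (rule sum_nonneg)
    fix e show "0 \<le> (\<Sum>f\<in>D. (ip (br e f) u)\<^sup>2) - ip (br e u) (br e u) +
         ((\<Sum>f\<in>D. (ip (br e f) w)\<^sup>2) - ip (br e w) (br e w))"
      using key[of e] by simp
  qed
  moreover have "ip (br H u) u + ip (br H w) w = a H * M"
    by (simp add: act ip_simps M_def ip_sym[of w u] algebra_simps)
  ultimately have "a H * M > 0" by linarith
  then show ?thesis using M by (simp add: H_def zero_less_mult_iff)
qed

text \<open>The witness is the mean curvature vector. Given an eigenvalue \<open>c\<close>, Lie's theorem is applied to the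
  \<open>c\<close>-eigenspace inside the complexified centre, not to the centre itself, so that the common
  eigenvector belongs to \<open>c\<close>.\<close>

theorem negative_ricci_imp_positive_eigenvalues:
  assumes solv: "solvable br" and nonzero: "\<exists>x::'g. x \<noteq> 0" and neg: "negative_ricci br ip"
  shows "\<exists>Y. endo_trace (br Y) > 0 \<and>
    (\<forall>c. complex_eigenvalue_on (br Y) (centre br (nilradical br)) c \<longrightarrow> Re c > 0)"
proof -
  define H where "H = mean_curvature_vector br ip"
  define N where "N = nilradical br"
  define Z where "Z = centre br N"
  have N: "lie_ideal br N" "nilpotent br N" "\<And>x y. br x y \<in> N" "N \<noteq> {0}"
    using nilradical_solvable[OF solv] nilradical_nonzero[OF solv nonzero] by (auto simp: N_def)
  have Z: "lie_ideal br Z" unfolding Z_def by (rule centre_ideal[OF N(1)])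
  then have sZ: "subspace Z" and iZ: "\<And>x y. y \<in> Z \<Longrightarrow> br x y \<in> Z" by (auto simp: lie_ideal_def)
  have comm: "br x y = 0" if "x \<in> N" "y \<in> Z" for x y
    using that br_anticomm[of x y] by (simp add: Z_def centre_def)
  have ZN: "Z \<subseteq> N" by (auto simp: Z_def centre_def)
  have pos: "Re c > 0" if ev: "complex_eigenvalue_on (br H) Z c" for c
  proof -
    obtain BB :: "('g \<times> 'g) set" where BB: "complex_fd_space complex_scale BB"
      using complexification_finite_dimensional[OF finite_gens span_gens] by blast
    interpret C: complex_fd_space complex_scale BB by (rule BB)
    interpret R: lie_representation br complex_scale BB "\<lambda>x. map_prod (br x) (br x)"
      by unfold_locales (simp_all add: prod_eq_iff complex_scale_def br_simps br_br)
    let ?r = "\<lambda>x. map_prod (br x) (br x)"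
    define K where "K = {v \<in> Z \<times> Z. ?r H v = complex_scale c v}"
    have "C.subspace (Z \<times> Z)"
      using sZ by (auto simp: C.subspace_def complex_scale_def subspace_0 zero_prod_def
          intro!: subspace_add subspace_diff subspace_scale)
    then have "C.subspace K" unfolding K_def by (rule C.eigenspace_subspace[OF R.rho_linear])
    moreover have "K \<noteq> {0}"
    proof -
      obtain v where "v \<in> Z \<times> Z" "v \<noteq> 0" "?r H v = complex_scale c v"
        using ev unfolding complex_eigenvalue_on_def by blast
      then have "v \<in> K" unfolding K_def by (intro CollectI conjI)
      with \<open>v \<noteq> 0\<close> show ?thesis by blast
    qed
    moreover have "?r x v \<in> K" if v: "v \<in> K" for x v
    proof -
      have vZ: "fst v \<in> Z" "snd v \<in> Z" and ev: "?r H v = complex_scale c v" using v by (auto simp: K_def)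
      have "?r (br H x) v = 0" using vZ N(3) comm by (simp add: prod_eq_iff)
      then have "?r H (?r x v) = ?r x (?r H v)" using R.rho_br[of H x v] by simp
      also have "\<dots> = complex_scale c (?r x v)"
        unfolding ev by (simp add: prod_eq_iff complex_scale_def br_simps)
      finally show ?thesis using vZ iZ by (cases v) (auto simp: K_def)
    qed
    ultimately obtain v d where v: "v \<in> K" "v \<noteq> 0" and d: "\<And>x. ?r x v = complex_scale (d x) v"
      by (rule R.lie_theorem[OF solv]) (assumption | rule that)+
    have "complex_scale (d H) v = complex_scale c v" using v(1) d[of H] by (simp add: K_def)
    then have dH: "d H = c" using v(2) by simp
    obtain u w where uw: "v = (u, w)" by (cases v)
    have "Re (d H) > 0"
      unfolding H_def
    proof (rule eigenvalue_positive[OF neg Z, of u w _ "\<lambda>x. Im (d x)"])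
      show "br x y = 0" if "x \<in> Z" "y \<in> Z" for x y using comm ZN that by blast
      show "u \<in> Z" "w \<in> Z" "u \<noteq> 0 \<or> w \<noteq> 0" using v by (auto simp: K_def uw zero_prod_def)
      show "br x u = Re (d x) *\<^sub>R u - Im (d x) *\<^sub>R w" "br x w = Im (d x) *\<^sub>R u + Re (d x) *\<^sub>R w" for x
        using d[of x] by (auto simp: uw complex_scale_def)
    qed
    then show ?thesis by (simp add: dH)
  qed
  have "H \<noteq> 0"
  proof
    assume H: "H = 0"
    obtain x where x: "x \<in> Z" "x \<noteq> 0"
      using centre_of_nilpotent_nonzero[OF N(1,2,4)] by (auto simp: Z_def)
    have "complex_eigenvalue_on (br H) Z 0"
      unfolding complex_eigenvalue_on_def
      using x sZ by (intro bexI[of _ "(x, 0)"]) (auto simp: H br_simps complex_scale_def zero_prod_def subspace_0)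
    from pos[OF this] show False by simp
  qed
  then have "endo_trace (br H) > 0"
    using mean_curvature_vector[of H] ip_pos[of H] by (simp add: H_def)
  with pos show ?thesis by (auto simp: Z_def N_def)
qed

end

section \<open>The Ricci form in coordinates\<close>

text \<open>The Ricci form in an orthonormal basis with structure constants \<open>c i j l = \<langle>[e i, e j], e l\<rangle>\<close>. It
  makes sense for arbitrary constants, and this lets the structure constants go to a limit.\<close>

definition coord_ricci :: "'i set \<Rightarrow> ('i \<Rightarrow> 'i \<Rightarrow> 'i \<Rightarrow> real) \<Rightarrow> ('i \<Rightarrow> real) \<Rightarrow> real" where
  "coord_ricci B c y =
    - (\<Sum>i\<in>B. \<Sum>j\<in>B. y i * y j * (\<Sum>k\<in>B. (\<Sum>l\<in>B. c k l l) * c k i j))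
    - 1/2 * (\<Sum>k\<in>B. \<Sum>l\<in>B. (\<Sum>i\<in>B. y i * c i k l) * (\<Sum>i\<in>B. y i * c i l k))
    - 1/2 * (\<Sum>k\<in>B. \<Sum>l\<in>B. (\<Sum>i\<in>B. y i * c i k l)\<^sup>2)
    + 1/4 * (\<Sum>k\<in>B. \<Sum>l\<in>B. (\<Sum>i\<in>B. y i * c k l i)\<^sup>2)"

text \<open>A matrix of the quadratic form \<open>coord_ricci B c\<close>, not symmetrised. Its entries are polynomials in the
  structure constants.\<close>

definition ricci_coeff :: "'i set \<Rightarrow> ('i \<Rightarrow> 'i \<Rightarrow> 'i \<Rightarrow> real) \<Rightarrow> 'i \<Rightarrow> 'i \<Rightarrow> real" where
  "ricci_coeff B c i j =
    - (\<Sum>k\<in>B. (\<Sum>l\<in>B. c k l l) * c k i j)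
    - 1/2 * (\<Sum>k\<in>B. \<Sum>l\<in>B. c i k l * c j l k)
    - 1/2 * (\<Sum>k\<in>B. \<Sum>l\<in>B. c i k l * c j k l)
    + 1/4 * (\<Sum>k\<in>B. \<Sum>l\<in>B. c k l i * c k l j)"

lemma coord_ricci_cong:
  assumes "\<And>i j k. i \<in> B \<Longrightarrow> j \<in> B \<Longrightarrow> k \<in> B \<Longrightarrow> c i j k = d i j k"
  shows "coord_ricci B c y = coord_ricci B d y"
  using assms by (simp add: coord_ricci_def cong: sum.cong)

lemma sum_product_forms:
  "(\<Sum>k\<in>B. \<Sum>l\<in>B. (\<Sum>i\<in>B. y i * a i k l) * (\<Sum>j\<in>B. y j * b j k l)) =
    (\<Sum>i\<in>B. \<Sum>j\<in>B. y i * y j * (\<Sum>k\<in>B. \<Sum>l\<in>B. a i k l * (b j k l :: real)))"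
proof -
  let ?f = "\<lambda>i j k l. y i * y j * (a i k l * b j k l)"
  have "(\<Sum>k\<in>B. \<Sum>l\<in>B. (\<Sum>i\<in>B. y i * a i k l) * (\<Sum>j\<in>B. y j * b j k l)) =
      (\<Sum>k\<in>B. \<Sum>l\<in>B. \<Sum>i\<in>B. \<Sum>j\<in>B. ?f i j k l)"
    by (simp add: sum_product mult_ac)
  also have "\<dots> = (\<Sum>k\<in>B. \<Sum>i\<in>B. \<Sum>l\<in>B. \<Sum>j\<in>B. ?f i j k l)"
    by (rule sum.cong[OF refl], rule sum.swap)
  also have "\<dots> = (\<Sum>i\<in>B. \<Sum>k\<in>B. \<Sum>l\<in>B. \<Sum>j\<in>B. ?f i j k l)"
    by (rule sum.swap)
  also have "\<dots> = (\<Sum>i\<in>B. \<Sum>k\<in>B. \<Sum>j\<in>B. \<Sum>l\<in>B. ?f i j k l)"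
    by (rule sum.cong[OF refl], rule sum.cong[OF refl], rule sum.swap)
  also have "\<dots> = (\<Sum>i\<in>B. \<Sum>j\<in>B. \<Sum>k\<in>B. \<Sum>l\<in>B. ?f i j k l)"
    by (rule sum.cong[OF refl], rule sum.swap)
  finally show ?thesis by (simp add: sum_distrib_left)
qed

lemma coord_ricci_quadratic:
  "coord_ricci B c y = (\<Sum>i\<in>B. \<Sum>j\<in>B. y i * y j * ricci_coeff B c i j)"
  unfolding coord_ricci_def ricci_coeff_def power2_eq_square sum_product_forms
  by (simp add: sum.distrib sum_subtractf sum_negf sum_distrib_left algebra_simps)

lemma (in metric_lie_algebra) ricci_coordinates:
  assumes E: "orthonormal_basis ip (e ` B)" and inj: "inj_on e B"
  shows "ricci br ip x = coord_ricci B (\<lambda>i j l. ip (br (e i) (e j)) (e l)) (\<lambda>i. ip x (e i))"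
proof -
  let ?H = "mean_curvature_vector br ip"
  let ?c = "\<lambda>i j l. ip (br (e i) (e j)) (e l)" and ?y = "\<lambda>i. ip x (e i)"
  have o: "orthonormal (e ` B)" "span (e ` B) = UNIV" using E by (auto simp: orthonormal_basis_iff)
  have exp: "(\<Sum>i\<in>B. ip v (e i) *\<^sub>R e i) = v" for v
    using orthonormal_expansion[OF o(1), of v] o(2) by (simp add: sum.reindex[OF inj])
  have par: "ip v w = (\<Sum>i\<in>B. ip v (e i) * ip w (e i))" for v w
    using orthonormal_parseval[OF o(1), of v w] o(2) by (simp add: sum.reindex[OF inj])
  have brx: "br v w = (\<Sum>i\<in>B. ip v (e i) *\<^sub>R br (e i) w)" for v w
    using linear_sum[OF linear_br_left[of w], of "\<lambda>i. ip v (e i) *\<^sub>R e i" B] exp[of v] by (simp add: br_simps)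
  have brx2: "br w v = (\<Sum>i\<in>B. ip v (e i) *\<^sub>R br w (e i))" for v w
    using linear_sum[OF linear_br[of w], of "\<lambda>i. ip v (e i) *\<^sub>R e i" B] exp[of v] by (simp add: br_simps)
  have M: "ip (br x (e k)) (e l) = (\<Sum>i\<in>B. ?y i * ?c i k l)" for k l
    by (subst brx) (simp add: ip_sum ip_simps)
  have H: "ip ?H (e k) = (\<Sum>l\<in>B. ?c k l l)" for k
    using endo_trace_orthonormal[OF linear_br E] by (simp add: mean_curvature_vector sum.reindex[OF inj])
  have t1: "ip (br ?H x) x = (\<Sum>i\<in>B. \<Sum>j\<in>B. ?y i * ?y j * (\<Sum>k\<in>B. (\<Sum>l\<in>B. ?c k l l) * ?c k i j))"
  proof -
    have "ip (br ?H x) x = (\<Sum>i\<in>B. ?y i * ip (br ?H (e i)) x)"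
      by (subst brx2) (simp add: ip_sum ip_simps)
    also have "\<dots> = (\<Sum>i\<in>B. ?y i * (\<Sum>j\<in>B. ip (br ?H (e i)) (e j) * ?y j))"
      by (subst (2) par) (rule refl)
    also have "\<dots> = (\<Sum>i\<in>B. ?y i * (\<Sum>j\<in>B. (\<Sum>k\<in>B. (\<Sum>l\<in>B. ?c k l l) * ?c k i j) * ?y j))"
      by (subst brx) (simp add: ip_sum ip_simps H)
    finally show ?thesis by (simp add: sum_distrib_left mult_ac)
  qed
  have t2: "(\<Sum>k\<in>e ` B. ip (br x (br x k)) k) =
      (\<Sum>k\<in>B. \<Sum>l\<in>B. (\<Sum>i\<in>B. ?y i * ?c i k l) * (\<Sum>i\<in>B. ?y i * ?c i l k))"
    by (simp add: sum.reindex[OF inj] brx2[of x "br x _"] ip_sum ip_simps M)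
  have t3: "(\<Sum>k\<in>e ` B. ip (br x k) (br x k)) = (\<Sum>k\<in>B. \<Sum>l\<in>B. (\<Sum>i\<in>B. ?y i * ?c i k l)\<^sup>2)"
    by (simp add: sum.reindex[OF inj] par[of "br x _" "br x _"] M power2_eq_square)
  have t4: "(\<Sum>k\<in>e ` B. \<Sum>l\<in>e ` B. (ip (br k l) x)\<^sup>2) = (\<Sum>k\<in>B. \<Sum>l\<in>B. (\<Sum>i\<in>B. ?y i * ?c k l i)\<^sup>2)"
    by (simp add: sum.reindex[OF inj] par[of _ x] mult.commute)
  show ?thesis by (simp add: ricci_formula[OF E] t1 t2 t3 t4 coord_ricci_def)
qed

section \<open>Stability of negative definiteness\<close>

text \<open>A quantitative comparison of a form with an inner product; it replaces compactness of the unit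
  sphere.\<close>

lemma (in metric) bilinear_form_bounded:
  assumes q: "bilinear (q :: 'g \<Rightarrow> 'g \<Rightarrow> real)" and gens: "finite (C::'g set)" "span C = UNIV"
  obtains K where "K > 0" "\<And>x. q x x \<le> K * ip x x"
proof -
  obtain E where "orthonormal_basis ip E" using orthonormal_basis_exists[OF gens] .
  then have E: "orthonormal E" "span E = UNIV" "finite E"
    by (auto simp: orthonormal_basis_iff orthonormal_def)
  let ?K = "\<Sum>e\<in>E. \<Sum>f\<in>E. \<bar>q e f\<bar>"
  have "q x x \<le> (1 + ?K) * ip x x" for x
  proof -
    have ipx: "ip x x = (\<Sum>e\<in>E. (ip x e)\<^sup>2)"
      using orthonormal_parseval[OF E(1), of x x] E(2) by (simp only: power2_eq_square UNIV_I)
    have "q x x = q (\<Sum>e\<in>E. ip x e *\<^sub>R e) (\<Sum>f\<in>E. ip x f *\<^sub>R f)"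
      using orthonormal_expansion[OF E(1)] E(2) by simp
    also have "\<dots> = (\<Sum>(e, f)\<in>E \<times> E. q (ip x e *\<^sub>R e) (ip x f *\<^sub>R f))"
      by (rule bilinear_sum[OF q])
    also have "\<dots> = (\<Sum>e\<in>E. \<Sum>f\<in>E. ip x e * ip x f * q e f)"
      by (simp add: sum.cartesian_product[symmetric] bilinear_lmul[OF q] bilinear_rmul[OF q] mult_ac)
    also have "\<dots> \<le> (\<Sum>e\<in>E. \<Sum>f\<in>E. ip x x * \<bar>q e f\<bar>)"
    proof (intro sum_mono)
      fix e f assume ef: "e \<in> E" "f \<in> E"
      have "(ip x e)\<^sup>2 \<le> ip x x" "(ip x f)\<^sup>2 \<le> ip x x"
        unfolding ipx using ef E(3) by (intro member_le_sum; simp)+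
      moreover have "2 * \<bar>ip x e * ip x f\<bar> \<le> (ip x e)\<^sup>2 + (ip x f)\<^sup>2"
        using sum_squares_bound[of "\<bar>ip x e\<bar>" "\<bar>ip x f\<bar>"] by (simp add: abs_mult)
      ultimately have "\<bar>ip x e * ip x f\<bar> \<le> ip x x" by linarith
      then have "\<bar>ip x e * ip x f\<bar> * \<bar>q e f\<bar> \<le> ip x x * \<bar>q e f\<bar>" by (intro mult_right_mono) auto
      then show "ip x e * ip x f * q e f \<le> ip x x * \<bar>q e f\<bar>"
        by (metis abs_ge_self abs_mult order_trans)
    qed
    also have "\<dots> = ?K * ip x x" by (simp add: sum_distrib_left mult.commute)
    finally show ?thesis using ip_nonneg[of x] by (simp add: distrib_right)
  qed
  moreover have "1 + ?K > 0" by (intro add_pos_nonneg sum_nonneg) auto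
  ultimately show thesis using that by blast
qed

text \<open>Minus the symmetrised form \<open>Q0\<close> is an inner product on the space with basis \<open>B\<close>. It dominates the
  sum of squares of the coordinates, with a factor \<open>1 / K\<close>, and \<open>\<epsilon>\<close> is chosen so that the
  perturbation is at most half of that.\<close>

lemma negative_definite_stable:
  fixes B :: "'g::real_vector set" and Q0 :: "'g \<Rightarrow> 'g \<Rightarrow> real"
  assumes B: "finite B" "independent B" "span B = UNIV"
    and neg: "\<And>y. \<exists>b\<in>B. y b \<noteq> 0 \<Longrightarrow> (\<Sum>i\<in>B. \<Sum>j\<in>B. y i * y j * Q0 i j) < 0"
  shows "\<exists>\<epsilon>>0. \<forall>Q (y :: 'g \<Rightarrow> real). (\<forall>i\<in>B. \<forall>j\<in>B. \<bar>Q i j - Q0 i j\<bar> \<le> \<epsilon>) \<longrightarrow> (\<exists>b\<in>B. y b \<noteq> 0) \<longrightarrow>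
     (\<Sum>i\<in>B. \<Sum>j\<in>B. y i * y j * Q i j) < 0"
proof -
  let ?r = "representation B"
  have rep: "?r (x + y) b = ?r x b + ?r y b" "?r (c *\<^sub>R x) b = c * ?r x b" for x y b c
    using B by (simp_all add: real_vector.representation_add real_vector.representation_scale)
  define ip where "ip x z = - (1/2) * (\<Sum>i\<in>B. \<Sum>j\<in>B. ?r x i * ?r z j * (Q0 i j + Q0 j i))" for x z
  define q where "q x z = (\<Sum>b\<in>B. ?r x b * ?r z b)" for x z
  have symm: "(\<Sum>i\<in>B. \<Sum>j\<in>B. y i * z j * Q0 j i) = (\<Sum>i\<in>B. \<Sum>j\<in>B. z i * y j * Q0 i j)" for y z
    by (subst sum.swap) (simp add: mult_ac)
  have ipx: "ip x x = - (\<Sum>i\<in>B. \<Sum>j\<in>B. ?r x i * ?r x j * Q0 i j)" for x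
    by (simp add: ip_def distrib_left sum.distrib symm)
  have nz: "\<exists>b\<in>B. ?r x b \<noteq> 0" if "x \<noteq> 0" for x
  proof (rule ccontr)
    assume "\<not> ?thesis"
    then have "x = 0" using real_vector.sum_representation_eq[of B x B] B by simp
    with that show False by simp
  qed
  interpret metric ip
  proof
    have "bilinear ip"
      unfolding bilinear_def ip_def
      by (intro allI conjI linearI; simp add: rep distrib_left distrib_right sum.distrib sum_distrib_left sum_negf right_diff_distrib mult_ac)
    moreover have "ip x y = ip y x" for x y
      by (simp add: ip_def distrib_left sum.distrib symm)
    moreover have "ip x x > 0" if "x \<noteq> 0" for x
      using neg[OF nz[OF that]] by (simp add: ipx)
    ultimately show "inner_product ip" by (auto simp: inner_product_def)
  qed
  have "bilinear q"
    unfolding bilinear_def q_def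
    by (intro allI conjI linearI; simp add: rep distrib_left distrib_right sum.distrib sum_distrib_left mult_ac)
  then obtain K where K: "K > 0" "\<And>x. q x x \<le> K * ip x x"
    using bilinear_form_bounded B(1,3) by blast
  define \<epsilon> where "\<epsilon> = 1 / (2 * K * (1 + real (card B) ^ 2))"
  have n: "1 + real (card B) ^ 2 > 0" by (simp add: add_pos_nonneg)
  have eps: "\<epsilon> > 0" using K n by (simp add: \<epsilon>_def)
  show ?thesis
  proof (intro exI[of _ \<epsilon>] conjI allI impI eps)
    fix Q and y :: "'g \<Rightarrow> real" assume Q: "\<forall>i\<in>B. \<forall>j\<in>B. \<bar>Q i j - Q0 i j\<bar> \<le> \<epsilon>" and y: "\<exists>b\<in>B. y b \<noteq> 0"
    define x where "x = (\<Sum>b\<in>B. y b *\<^sub>R b)"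
    define S where "S = (\<Sum>b\<in>B. (y b)\<^sup>2)"
    have ry: "?r x b = y b" if "b \<in> B" for b
    proof -
      have "?r x b = (\<Sum>d\<in>B. y d * (if b = d then 1 else 0))"
        using B unfolding x_def
        by (simp add: real_vector.representation_sum real_vector.representation_scale real_vector.representation_basis)
      then show ?thesis using that B(1) by (simp add: mult_delta_right)
    qed
    have "S \<le> K * - (\<Sum>i\<in>B. \<Sum>j\<in>B. y i * y j * Q0 i j)"
      using K(2)[of x] by (simp add: q_def S_def ipx ry power2_eq_square cong: sum.cong)
    then have b0: "(\<Sum>i\<in>B. \<Sum>j\<in>B. y i * y j * Q0 i j) \<le> - S / K"
      using K(1) by (simp add: field_simps)
    have S: "S > 0"
    proof -
      obtain b where "b \<in> B" "y b \<noteq> 0" using y by blast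
      then have "0 < (y b)\<^sup>2" "(y b)\<^sup>2 \<le> S" unfolding S_def using B(1) by (auto intro!: member_le_sum)
      then show ?thesis by linarith
    qed
    have "(\<Sum>i\<in>B. \<Sum>j\<in>B. y i * y j * Q i j) - (\<Sum>i\<in>B. \<Sum>j\<in>B. y i * y j * Q0 i j) =
        (\<Sum>i\<in>B. \<Sum>j\<in>B. y i * y j * (Q i j - Q0 i j))"
      by (simp add: sum_subtractf right_diff_distrib)
    also have "\<dots> \<le> (\<Sum>i\<in>B. \<Sum>j\<in>B. S * \<epsilon>)"
    proof (intro sum_mono)
      fix i j assume ij: "i \<in> B" "j \<in> B"
      have "(y i)\<^sup>2 \<le> S" "(y j)\<^sup>2 \<le> S" unfolding S_def using ij B(1) by (intro member_le_sum; simp)+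
      moreover have "2 * \<bar>y i * y j\<bar> \<le> (y i)\<^sup>2 + (y j)\<^sup>2"
        using sum_squares_bound[of "\<bar>y i\<bar>" "\<bar>y j\<bar>"] by (simp add: abs_mult)
      ultimately have "\<bar>y i * y j\<bar> \<le> S" by linarith
      then have "\<bar>y i * y j\<bar> * \<bar>Q i j - Q0 i j\<bar> \<le> S * \<epsilon>" using Q ij S by (intro mult_mono) auto
      then show "y i * y j * (Q i j - Q0 i j) \<le> S * \<epsilon>"
        by (metis abs_ge_self abs_mult order_trans)
    qed
    also have "\<dots> = S * \<epsilon> * real (card B) ^ 2" by (simp add: power2_eq_square)
    also have "\<dots> \<le> S * \<epsilon> * (1 + real (card B) ^ 2)" using S eps by (intro mult_left_mono) auto
    also have "\<dots> = S / (2 * K)" using n by (simp add: \<epsilon>_def)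
    also have "\<dots> < S / K" using S K by (simp add: field_simps)
    finally show "(\<Sum>i\<in>B. \<Sum>j\<in>B. y i * y j * Q i j) < 0" using b0 by simp
  qed
qed

lemma coord_ricci_negative_limit:
  fixes B :: "'g::real_vector set" and c :: "real \<Rightarrow> 'g \<Rightarrow> 'g \<Rightarrow> 'g \<Rightarrow> real"
  assumes B: "finite B" "independent B" "span B = UNIV"
    and neg: "\<And>y. \<exists>b\<in>B. y b \<noteq> 0 \<Longrightarrow> coord_ricci B c0 y < 0"
    and lim: "\<And>i j k. i \<in> B \<Longrightarrow> j \<in> B \<Longrightarrow> k \<in> B \<Longrightarrow> ((\<lambda>t. c t i j k) \<longlongrightarrow> c0 i j k) F"
  shows "\<forall>\<^sub>F t in F. \<forall>y. (\<exists>b\<in>B. y b \<noteq> 0) \<longrightarrow> coord_ricci B (c t) y < 0"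
proof -
  obtain \<epsilon> where e: "\<epsilon> > 0" "\<forall>Q y. (\<forall>i\<in>B. \<forall>j\<in>B. \<bar>Q i j - ricci_coeff B c0 i j\<bar> \<le> \<epsilon>) \<longrightarrow>
      (\<exists>b\<in>B. y b \<noteq> 0) \<longrightarrow> (\<Sum>i\<in>B. \<Sum>j\<in>B. y i * y j * Q i j) < 0"
    using negative_definite_stable[OF B, of "ricci_coeff B c0"] neg[unfolded coord_ricci_quadratic] by auto
  have "((\<lambda>t. ricci_coeff B (c t) i j) \<longlongrightarrow> ricci_coeff B c0 i j) F" if "i \<in> B" "j \<in> B" for i j
    unfolding ricci_coeff_def using that by (intro tendsto_intros lim)
  then have "\<forall>\<^sub>F t in F. \<bar>ricci_coeff B (c t) i j - ricci_coeff B c0 i j\<bar> < \<epsilon>" if "i \<in> B" "j \<in> B" for i j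
    using that e(1) by (auto simp: tendsto_iff dist_real_def)
  then have "\<forall>\<^sub>F t in F. \<forall>i\<in>B. \<forall>j\<in>B. \<bar>ricci_coeff B (c t) i j - ricci_coeff B c0 i j\<bar> < \<epsilon>"
    using B(1) by (intro eventually_ball_finite ballI) auto
  then show ?thesis
  proof (rule eventually_mono)
    fix t assume t: "\<forall>i\<in>B. \<forall>j\<in>B. \<bar>ricci_coeff B (c t) i j - ricci_coeff B c0 i j\<bar> < \<epsilon>"
    show "\<forall>y. (\<exists>b\<in>B. y b \<noteq> 0) \<longrightarrow> coord_ricci B (c t) y < 0"
      unfolding coord_ricci_quadratic
      using t by (intro allI impI e(2)[rule_format]) (auto intro: less_imp_le)
  qed
qed

section \<open>Ricci curvature of an abelian-by-abelian model\<close>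

text \<open>The index sets \<open>A\<close> and \<open>N\<close> number orthonormal bases of an abelian algebra and of an abelian ideal
  on which it acts. The block of \<open>b\<close> in \<open>N\<close> is the complex number \<open>al b + i be b\<close>, written in a basis
  whose two vectors have been rescaled; \<open>r b\<close> is the ratio of the factors of \<open>b\<close> and \<open>star b\<close>. The
  last assumption says that the mean curvature vector is a multiple of the basis vector \<open>Y\<close>.\<close>

locale semidirect_model =
  fixes A N :: "'i set" and star :: "'i \<Rightarrow> 'i" and al be :: "'i \<Rightarrow> 'i \<Rightarrow> real"
    and r :: "'i \<Rightarrow> real" and Y :: 'i
  assumes finA: "finite A" and finN: "finite N" and disj: "A \<inter> N = {}"
    and star: "b \<in> N \<Longrightarrow> star b \<in> N" "b \<in> N \<Longrightarrow> star (star b) = b"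
    and al_star: "b \<in> N \<Longrightarrow> al (star b) k = al b k"
    and be_star: "b \<in> N \<Longrightarrow> be (star b) k = - be b k"
    and r_star: "b \<in> N \<Longrightarrow> r b * r (star b) = 1"
    and Y: "Y \<in> A" and traceless: "k \<in> A \<Longrightarrow> k \<noteq> Y \<Longrightarrow> (\<Sum>b\<in>N. al b k) = 0"
begin

definition act :: "'i \<Rightarrow> 'i \<Rightarrow> 'i \<Rightarrow> real" where
  "act i j l = (if l = j then al j i else 0) + (if l = star j then be j i * r j else 0)"

definition const :: "'i \<Rightarrow> 'i \<Rightarrow> 'i \<Rightarrow> real" where
  "const i j l = (if i \<in> A \<and> j \<in> N then act i j l else if i \<in> N \<and> j \<in> A then - act j i l else 0)"

lemma notA: "b \<in> N \<Longrightarrow> b \<notin> A" and notN: "b \<in> A \<Longrightarrow> b \<notin> N"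
  using disj by auto

text \<open>Sums over \<open>N\<close> may be compared after adding the terms of \<open>b\<close> and \<open>star b\<close>. All cancellations
  between the two vectors of a block are handled in this way.\<close>

lemma sum_star: "(\<Sum>b\<in>N. h (star b)) = (sum h N :: real)"
  by (rule sum.reindex_bij_witness[of N star star]) (auto simp: star)

lemma star_sum_le:
  assumes "\<And>b. b \<in> N \<Longrightarrow> f b + f (star b) \<le> g b + g (star b)"
  shows "sum f N \<le> (sum g N :: real)"
proof -
  have "2 * sum f N = (\<Sum>b\<in>N. f b + f (star b))" by (simp add: sum.distrib sum_star)
  also have "\<dots> \<le> (\<Sum>b\<in>N. g b + g (star b))" using assms by (intro sum_mono)
  also have "\<dots> = 2 * sum g N" by (simp add: sum.distrib sum_star)
  finally show ?thesis by simp
qed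

lemma star_sum_eq:
  assumes "\<And>b. b \<in> N \<Longrightarrow> f b + f (star b) = g b + g (star b)"
  shows "sum f N = (sum g N :: real)"
  by (rule antisym; rule star_sum_le; simp add: assms)

lemma be_fixed: "b \<in> N \<Longrightarrow> star b = b \<Longrightarrow> be b k = 0"
  using be_star[of b k] by simp

lemma sum_split: "sum f (A \<union> N) = sum f A + (sum f N :: real)"
  using finA finN disj by (rule sum.union_disjoint)

lemma act_A: "j \<in> N \<Longrightarrow> l \<in> A \<Longrightarrow> act i j l = 0"
  using notA star by (auto simp: act_def)

lemma sum_act: "j \<in> N \<Longrightarrow> (\<Sum>l\<in>N. g l * act i j l) = al j i * g j + be j i * r j * g (star j)"
  using finN star by (simp add: act_def distrib_left sum.distrib mult_delta_right)

lemma sum_act': 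
  assumes l: "l \<in> N"
  shows "(\<Sum>j\<in>N. g j * act i j l) = al l i * g l - be l i * r (star l) * g (star l)"
proof -
  have "(\<Sum>j\<in>N. g j * act i j l) =
      (\<Sum>j\<in>N. (if j = l then g l * al l i else 0) + (if j = star l then g (star l) * (be (star l) i * r (star l)) else 0))"
    by (intro sum.cong refl) (use star l in \<open>auto simp: act_def distrib_left\<close>)
  then show ?thesis using finN l star be_star by (simp add: sum.distrib)
qed

lemma const_simps:
  "i \<in> A \<Longrightarrow> j \<in> N \<Longrightarrow> const i j l = act i j l"
  "i \<in> N \<Longrightarrow> j \<in> A \<Longrightarrow> const i j l = - act j i l"
  "i \<in> A \<Longrightarrow> j \<in> A \<Longrightarrow> const i j l = 0"
  "i \<in> N \<Longrightarrow> j \<in> N \<Longrightarrow> const i j l = 0"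
  using notA notN by (auto simp: const_def)

abbreviation T :: real where "T \<equiv> \<Sum>b\<in>N. al b Y"

lemma const_trace:
  assumes "k \<in> A \<union> N"
  shows "(\<Sum>l\<in>A \<union> N. const k l l) = (if k = Y then T else 0)"
proof (cases "k \<in> A")
  case True
  have "act k l l = al l k" if "l \<in> N" for l using be_fixed[OF that] by (auto simp: act_def)
  then have "(\<Sum>l\<in>A \<union> N. const k l l) = (\<Sum>l\<in>N. al l k)"
    using True by (simp add: sum_split const_simps)
  then show ?thesis using traceless True by auto
next
  case False
  then have "k \<in> N" "k \<noteq> Y" using assms Y by auto
  then show ?thesis by (simp add: sum_split const_simps act_A)
qed

text \<open>There are no terms that mix \<open>A\<close> and \<open>N\<close>. On \<open>A\<close> the form is minus the sum of squares of the
  symmetric parts of the blocks: the rotational part \<open>be b\<close> is seen only through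
  \<open>r b - r (star b)\<close>. On \<open>N\<close> it is \<open>- T\<close> times the symmetric part of the action of \<open>Y\<close>, up to terms
  that vanish when \<open>r b = r (star b)\<close> and that measure how far the blocks are from being normal.\<close>

lemma coord_ricci_const:
  "coord_ricci (A \<union> N) const y =
    - (\<Sum>b\<in>N. (\<Sum>i\<in>A. y i * al b i)\<^sup>2 + 1/4 * ((\<Sum>i\<in>A. y i * be b i) * (r b - r (star b)))\<^sup>2)
    - (\<Sum>b\<in>N. T * al b Y * (y b)\<^sup>2 + 1/2 * T * be b Y * (r b - r (star b)) * y b * y (star b)
        + 1/2 * (\<Sum>k\<in>A. (be b k)\<^sup>2) * ((r b)\<^sup>2 - (r (star b))\<^sup>2) * (y b)\<^sup>2)"
proof -
  define p where "p b = (\<Sum>i\<in>A. y i * al b i)" for b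
  define q where "q b = (\<Sum>i\<in>A. y i * be b i)" for b
  have q_star: "q (star b) = - q b" and p_star: "p (star b) = p b" if "b \<in> N" for b
    using that by (simp_all add: q_def p_def be_star al_star sum_negf)
  have q_fixed: "q b = 0" if "b \<in> N" "star b = b" for b
    using q_star[OF that(1)] that(2) by simp
  define M where "M k l = (\<Sum>i\<in>A \<union> N. y i * const i k l)" for k l
  have M_A: "M k l = 0" if "k \<in> A \<union> N" "l \<in> A" for k l
    using that by (auto simp: M_def sum_split const_simps act_A)
  have M_NN: "M k l = (if l = k then p k else 0) + (if l = star k then q k * r k else 0)"
    if "k \<in> N" for k l
    using that by (simp add: M_def sum_split const_simps act_def p_def q_def distrib_left sum.distrib
        sum_distrib_left mult_ac)
  define V where "V k l = al l k * y l - be l k * r (star l) * y (star l)" for k l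
  define W where "W k l = al l k * y l + be l k * r l * y (star l)" for k l
  have M_AN: "M k l = - V k l" if "k \<in> A" "l \<in> N" for k l
    using that by (simp add: M_def V_def sum_split const_simps sum_negf sum_act')
  define P where "P k l = (\<Sum>i\<in>A \<union> N. y i * const k l i)" for k l
  have P_AN: "P k l = W k l" "P l k = - W k l" if "k \<in> A" "l \<in> N" for k l
    using that by (simp_all add: P_def W_def sum_split const_simps act_A sum_negf sum_act)
  have P_0: "P k l = 0" if "k \<in> A \<and> l \<in> A \<or> k \<in> N \<and> l \<in> N" for k l
    using that by (auto simp: P_def sum_split const_simps)
  have t1: "(\<Sum>i\<in>A \<union> N. \<Sum>j\<in>A \<union> N. y i * y j * (\<Sum>k\<in>A \<union> N. (\<Sum>l\<in>A \<union> N. const k l l) * const k i j)) =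
      (\<Sum>b\<in>N. T * al b Y * (y b)\<^sup>2 + 1/2 * T * be b Y * (r b - r (star b)) * y b * y (star b))"
  proof -
    have "(\<Sum>k\<in>A \<union> N. (\<Sum>l\<in>A \<union> N. const k l l) * const k i j) = T * const Y i j" for i j
    proof -
      have "(\<Sum>k\<in>A \<union> N. (\<Sum>l\<in>A \<union> N. const k l l) * const k i j) =
          (\<Sum>k\<in>A \<union> N. if k = Y then T * const Y i j else 0)"
        by (intro sum.cong refl) (auto simp: const_trace)
      also have "\<dots> = T * const Y i j" using finA finN Y by simp
      finally show ?thesis .
    qed
    then have "(\<Sum>i\<in>A \<union> N. \<Sum>j\<in>A \<union> N. y i * y j * (\<Sum>k\<in>A \<union> N. (\<Sum>l\<in>A \<union> N. const k l l) * const k i j)) =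
        (\<Sum>i\<in>N. \<Sum>j\<in>N. y i * y j * (T * act Y i j))"
      using Y by (simp add: sum_split const_simps act_A)
    also have "\<dots> = (\<Sum>i\<in>N. T * (y i * (\<Sum>j\<in>N. y j * act Y i j)))"
      by (simp add: sum_distrib_left mult_ac)
    also have "\<dots> = (\<Sum>b\<in>N. T * (y b * (al b Y * y b + be b Y * r b * y (star b))))"
      by (intro sum.cong refl) (simp add: sum_act)
    also have "\<dots> = (\<Sum>b\<in>N. T * al b Y * (y b)\<^sup>2 + 1/2 * T * be b Y * (r b - r (star b)) * y b * y (star b))"
      by (rule star_sum_eq) (simp add: star al_star be_star power2_eq_square field_simps)
    finally show ?thesis .
  qed
  have MMk: "M k k = p k" "M (star k) k = p k * of_bool (star k = k) - q k * r (star k)"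
      "M k (star k) = p k * of_bool (star k = k) + q k * r k" if "k \<in> N" for k
    using that star q_star q_fixed p_star by (auto simp: M_NN)
  have Msum: "(\<Sum>l\<in>N. M k l * g l) = p k * g k + q k * r k * g (star k)" if "k \<in> N" for k g
    using that finN star by (simp add: M_NN distrib_right sum.distrib mult_delta_left)
  have t2: "(\<Sum>k\<in>A \<union> N. \<Sum>l\<in>A \<union> N. M k l * M l k) = (\<Sum>b\<in>N. (p b)\<^sup>2 - (q b)\<^sup>2)"
  proof -
    have "(\<Sum>k\<in>A \<union> N. \<Sum>l\<in>A \<union> N. M k l * M l k) = (\<Sum>k\<in>N. \<Sum>l\<in>N. M k l * M l k)"
      by (simp add: sum_split M_A)
    also have "\<dots> = (\<Sum>b\<in>N. (p b)\<^sup>2 - (q b)\<^sup>2)"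
    proof (intro sum.cong refl)
      fix k assume k: "k \<in> N"
      have "q k * r k * (q k * r (star k)) = (q k)\<^sup>2 * (r k * r (star k))"
        by (simp add: power2_eq_square)
      then have "q k * r k * (q k * r (star k)) = (q k)\<^sup>2" using r_star[OF k] by simp
      then show "(\<Sum>l\<in>N. M k l * M l k) = (p k)\<^sup>2 - (q k)\<^sup>2"
        using q_fixed[OF k] by (auto simp: Msum[OF k] MMk[OF k] right_diff_distrib power2_eq_square)
    qed
    finally show ?thesis .
  qed
  have t3: "(\<Sum>k\<in>A \<union> N. \<Sum>l\<in>A \<union> N. (M k l)\<^sup>2) =
      (\<Sum>b\<in>N. (p b)\<^sup>2 + (q b)\<^sup>2 * (r b)\<^sup>2) + (\<Sum>k\<in>A. \<Sum>l\<in>N. (V k l)\<^sup>2)"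
  proof -
    have "(\<Sum>l\<in>N. (M k l)\<^sup>2) = (p k)\<^sup>2 + (q k)\<^sup>2 * (r k)\<^sup>2" if k: "k \<in> N" for k
      using q_fixed[OF k] Msum[OF k, of "M k"] by (auto simp: MMk[OF k] distrib_left power2_eq_square)
    then show ?thesis by (simp add: sum_split M_A M_AN)
  qed
  have t4: "(\<Sum>k\<in>A \<union> N. \<Sum>l\<in>A \<union> N. (P k l)\<^sup>2) = 2 * (\<Sum>k\<in>A. \<Sum>l\<in>N. (W k l)\<^sup>2)"
  proof -
    have "(\<Sum>k\<in>A \<union> N. \<Sum>l\<in>A \<union> N. (P k l)\<^sup>2) = (\<Sum>k\<in>A. \<Sum>l\<in>N. (W k l)\<^sup>2) + (\<Sum>k\<in>N. \<Sum>l\<in>A. (W l k)\<^sup>2)"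
      by (simp add: sum_split P_0 P_AN)
    also have "(\<Sum>k\<in>N. \<Sum>l\<in>A. (W l k)\<^sup>2) = (\<Sum>k\<in>A. \<Sum>l\<in>N. (W k l)\<^sup>2)" by (rule sum.swap)
    finally show ?thesis by simp
  qed
  have wv: "(\<Sum>k\<in>A. \<Sum>l\<in>N. (W k l)\<^sup>2) - (\<Sum>k\<in>A. \<Sum>l\<in>N. (V k l)\<^sup>2) =
      - (\<Sum>b\<in>N. (\<Sum>k\<in>A. (be b k)\<^sup>2) * ((r b)\<^sup>2 - (r (star b))\<^sup>2) * (y b)\<^sup>2)"
  proof -
    have "(\<Sum>l\<in>N. (W k l)\<^sup>2 - (V k l)\<^sup>2) = (\<Sum>l\<in>N. - ((be l k)\<^sup>2 * ((r l)\<^sup>2 - (r (star l))\<^sup>2) * (y l)\<^sup>2))" for k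
      by (rule star_sum_eq) (simp add: W_def V_def star al_star be_star power2_eq_square algebra_simps)
    then have "(\<Sum>k\<in>A. \<Sum>l\<in>N. (W k l)\<^sup>2) - (\<Sum>k\<in>A. \<Sum>l\<in>N. (V k l)\<^sup>2) =
       (\<Sum>k\<in>A. \<Sum>l\<in>N. - ((be l k)\<^sup>2 * ((r l)\<^sup>2 - (r (star l))\<^sup>2) * (y l)\<^sup>2))"
      by (simp add: sum_subtractf[symmetric])
    also have "\<dots> = (\<Sum>l\<in>N. \<Sum>k\<in>A. - ((be l k)\<^sup>2 * ((r l)\<^sup>2 - (r (star l))\<^sup>2) * (y l)\<^sup>2))"
      by (rule sum.swap)
    finally show ?thesis by (simp add: sum_negf sum_distrib_right)
  qed
  have pq: "1/2 * (\<Sum>b\<in>N. (p b)\<^sup>2 - (q b)\<^sup>2) + 1/2 * (\<Sum>b\<in>N. (p b)\<^sup>2 + (q b)\<^sup>2 * (r b)\<^sup>2) =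
      (\<Sum>b\<in>N. (p b)\<^sup>2 + 1/4 * (q b * (r b - r (star b)))\<^sup>2)"
  proof -
    have "(\<Sum>b\<in>N. (p b)\<^sup>2 + 1/2 * ((q b)\<^sup>2 * ((r b)\<^sup>2 - 1))) = (\<Sum>b\<in>N. (p b)\<^sup>2 + 1/4 * (q b * (r b - r (star b)))\<^sup>2)"
    proof (rule star_sum_eq)
      fix b assume b: "b \<in> N"
      have "(q b * (r b - r (star b)))\<^sup>2 = (q b)\<^sup>2 * ((r b)\<^sup>2 + (r (star b))\<^sup>2 - 2 * (r b * r (star b)))"
        by (simp add: power2_eq_square algebra_simps)
      then have e: "(q b * (r b - r (star b)))\<^sup>2 = (q b)\<^sup>2 * ((r b)\<^sup>2 + (r (star b))\<^sup>2 - 2)"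
        using r_star[OF b] by simp
      have e': "(q (star b) * (r (star b) - r (star (star b))))\<^sup>2 = (q b * (r b - r (star b)))\<^sup>2"
        by (simp add: q_star[OF b] star(2)[OF b] power2_eq_square algebra_simps)
      show "(p b)\<^sup>2 + 1/2 * ((q b)\<^sup>2 * ((r b)\<^sup>2 - 1)) + ((p (star b))\<^sup>2 + 1/2 * ((q (star b))\<^sup>2 * ((r (star b))\<^sup>2 - 1))) =
          (p b)\<^sup>2 + 1/4 * (q b * (r b - r (star b)))\<^sup>2 + ((p (star b))\<^sup>2 + 1/4 * (q (star b) * (r (star b) - r (star (star b))))\<^sup>2)"
        unfolding e' e by (simp add: q_star[OF b] algebra_simps)
    qed
    moreover have "1/2 * (\<Sum>b\<in>N. (p b)\<^sup>2 - (q b)\<^sup>2) + 1/2 * (\<Sum>b\<in>N. (p b)\<^sup>2 + (q b)\<^sup>2 * (r b)\<^sup>2) =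
        (\<Sum>b\<in>N. (p b)\<^sup>2 + 1/2 * ((q b)\<^sup>2 * ((r b)\<^sup>2 - 1)))"
      by (simp add: sum_distrib_left sum.distrib[symmetric] algebra_simps)
    ultimately show ?thesis by simp
  qed
  have last: "(\<Sum>b\<in>N. T * al b Y * (y b)\<^sup>2 + 1/2 * T * be b Y * (r b - r (star b)) * y b * y (star b)
        + 1/2 * (\<Sum>k\<in>A. (be b k)\<^sup>2) * ((r b)\<^sup>2 - (r (star b))\<^sup>2) * (y b)\<^sup>2) =
      (\<Sum>b\<in>N. T * al b Y * (y b)\<^sup>2 + 1/2 * T * be b Y * (r b - r (star b)) * y b * y (star b))
      + 1/2 * (\<Sum>b\<in>N. (\<Sum>k\<in>A. (be b k)\<^sup>2) * ((r b)\<^sup>2 - (r (star b))\<^sup>2) * (y b)\<^sup>2)"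
    unfolding sum_distrib_left[of "1/2" "\<lambda>b. (\<Sum>k\<in>A. (be b k)\<^sup>2) * ((r b)\<^sup>2 - (r (star b))\<^sup>2) * (y b)\<^sup>2" N]
    by (simp only: sum.distrib mult.assoc)
  show ?thesis
    unfolding coord_ricci_def t1 last M_def[symmetric] P_def[symmetric] t2 t3 t4
      p_def[symmetric] q_def[symmetric] pq[symmetric]
    using wv by (simp add: algebra_simps)
qed

text \<open>If the ratios are close to \<open>1\<close>, the terms on \<open>N\<close> with \<open>al b Y\<close> dominate; this is the assumption
  \<open>pos\<close>. The assumption \<open>faithful\<close> makes the form definite on \<open>A\<close>.\<close>

lemma coord_ricci_const_negative:
  assumes T: "T > 0"
    and pos: "\<And>b. b \<in> N \<Longrightarrow> T * al b Y - 1/2 * (T * \<bar>be b Y\<bar> * \<bar>r b - r (star b)\<bar>)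
        - 1/2 * ((\<Sum>k\<in>A. (be b k)\<^sup>2) * \<bar>(r b)\<^sup>2 - (r (star b))\<^sup>2\<bar>) > 0"
    and faithful: "\<And>y. (\<And>b. b \<in> N \<Longrightarrow> (\<Sum>i\<in>A. y i * al b i) = 0 \<and> (\<Sum>i\<in>A. y i * be b i) * (r b - r (star b)) = 0) \<Longrightarrow>
        \<forall>i\<in>A. y i = 0"
    and y: "\<exists>b\<in>A \<union> N. y b \<noteq> 0"
  shows "coord_ricci (A \<union> N) const y < 0"
proof -
  define G where "G b = T * al b Y - 1/2 * (T * \<bar>be b Y\<bar> * \<bar>r b - r (star b)\<bar>)
        - 1/2 * ((\<Sum>k\<in>A. (be b k)\<^sup>2) * \<bar>(r b)\<^sup>2 - (r (star b))\<^sup>2\<bar>)" for b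
  define U where "U b = (\<Sum>i\<in>A. y i * al b i)\<^sup>2 + 1/4 * ((\<Sum>i\<in>A. y i * be b i) * (r b - r (star b)))\<^sup>2" for b
  define X where "X b = T * al b Y * (y b)\<^sup>2 + 1/2 * T * be b Y * (r b - r (star b)) * y b * y (star b)
        + 1/2 * (\<Sum>k\<in>A. (be b k)\<^sup>2) * ((r b)\<^sup>2 - (r (star b))\<^sup>2) * (y b)\<^sup>2" for b
  have XG: "(\<Sum>b\<in>N. G b * (y b)\<^sup>2) \<le> (\<Sum>b\<in>N. X b)"
  proof (rule star_sum_le)
    fix b assume b: "b \<in> N"
    define d where "d = r b - r (star b)"
    define s where "s = (r b)\<^sup>2 - (r (star b))\<^sup>2"
    define K where "K = (\<Sum>k\<in>A. (be b k)\<^sup>2)"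
    define u where "u = y b"
    define v where "v = y (star b)"
    have K0: "K \<ge> 0" unfolding K_def by (intro sum_nonneg) simp
    have Ks: "(\<Sum>k\<in>A. (be (star b) k)\<^sup>2) = K" by (simp add: K_def be_star[OF b])
    have ds: "r (star b) - r b = - d" "(r (star b))\<^sup>2 - (r b)\<^sup>2 = - s" by (simp_all add: d_def s_def)
    have Gs: "G b = T * al b Y - 1/2 * (T * \<bar>be b Y\<bar> * \<bar>d\<bar>) - 1/2 * (K * \<bar>s\<bar>)" "G (star b) = G b"
      using b by (simp_all add: G_def star al_star be_star Ks ds K_def[symmetric] d_def[symmetric] s_def[symmetric])
    have Xs: "X b = T * al b Y * u\<^sup>2 + 1/2 * T * be b Y * d * u * v + 1/2 * K * s * u\<^sup>2"
      "X (star b) = T * al b Y * v\<^sup>2 + 1/2 * T * be b Y * d * u * v - 1/2 * K * s * v\<^sup>2"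
      using b by (simp_all add: X_def star al_star be_star Ks ds K_def[symmetric] d_def[symmetric] s_def[symmetric] u_def v_def)
    have "\<bar>be b Y * d * (u * v)\<bar> \<le> \<bar>be b Y\<bar> * \<bar>d\<bar> * ((u\<^sup>2 + v\<^sup>2) / 2)"
      unfolding abs_mult[of "be b Y * d"] abs_mult[of "be b Y"]
      using sum_squares_bound[of "\<bar>u\<bar>" "\<bar>v\<bar>"] by (intro mult_left_mono) (auto simp: abs_mult)
    then have "- (be b Y * d * (u * v)) \<le> \<bar>be b Y\<bar> * \<bar>d\<bar> * ((u\<^sup>2 + v\<^sup>2) / 2)" by linarith
    then have i1: "T * - (be b Y * d * (u * v)) \<le> T * (\<bar>be b Y\<bar> * \<bar>d\<bar> * ((u\<^sup>2 + v\<^sup>2) / 2))"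
      using T by (intro mult_left_mono) auto
    have i2: "- (K * \<bar>s\<bar> * u\<^sup>2) \<le> K * s * u\<^sup>2" "- (K * \<bar>s\<bar> * v\<^sup>2) \<le> - (K * s * v\<^sup>2)"
    proof -
      have "K * u\<^sup>2 * - \<bar>s\<bar> \<le> K * u\<^sup>2 * s" "K * v\<^sup>2 * s \<le> K * v\<^sup>2 * \<bar>s\<bar>"
        using K0 by (intro mult_left_mono; simp)+
      then show "- (K * \<bar>s\<bar> * u\<^sup>2) \<le> K * s * u\<^sup>2" "- (K * \<bar>s\<bar> * v\<^sup>2) \<le> - (K * s * v\<^sup>2)"
        by (simp_all add: mult_ac)
    qed
    show "G b * (y b)\<^sup>2 + G (star b) * (y (star b))\<^sup>2 \<le> X b + X (star b)"
      unfolding Gs Xs u_def[symmetric] v_def[symmetric] using i1 i2 by (simp add: algebra_simps)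
  qed
  have U0: "U b \<ge> 0" for b by (simp add: U_def)
  have G0: "G b * (y b)\<^sup>2 \<ge> 0" if "b \<in> N" for b
    using pos[OF that] unfolding G_def[symmetric] by simp
  have "(\<Sum>b\<in>N. U b) + (\<Sum>b\<in>N. G b * (y b)\<^sup>2) > 0"
  proof (rule ccontr)
    assume "\<not> ?thesis"
    moreover have "(\<Sum>b\<in>N. U b) \<ge> 0" using U0 by (intro sum_nonneg)
    moreover have "(\<Sum>b\<in>N. G b * (y b)\<^sup>2) \<ge> 0" using G0 by (intro sum_nonneg)
    ultimately have "(\<Sum>b\<in>N. U b) = 0" "(\<Sum>b\<in>N. G b * (y b)\<^sup>2) = 0" by linarith+
    then have z: "U b = 0" "G b * (y b)\<^sup>2 = 0" if "b \<in> N" for b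
      using sum_nonneg_eq_0_iff[OF finN, of U] sum_nonneg_eq_0_iff[OF finN, of "\<lambda>b. G b * (y b)\<^sup>2"] U0 G0 that by auto
    have "y b = 0" if "b \<in> N" for b
      using z(2)[OF that] pos[OF that] unfolding G_def[symmetric] by simp
    moreover have "\<forall>i\<in>A. y i = 0"
    proof (rule faithful)
      fix b assume "b \<in> N"
      then have "U b = 0" by (rule z)
      then show "(\<Sum>i\<in>A. y i * al b i) = 0 \<and> (\<Sum>i\<in>A. y i * be b i) * (r b - r (star b)) = 0"
        unfolding U_def by (subst (asm) add_nonneg_eq_0_iff) auto
    qed
    ultimately show False using y by auto
  qed
  then show ?thesis
    unfolding coord_ricci_const U_def[symmetric] X_def[symmetric] using XG by linarith
qed

end

section \<open>Positive eigenvalues yield a metric of negative Ricci curvature\<close>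

text \<open>Stated for invariant subspaces with a finite spanning set because the ambient type carries no
  dimension; the reason is a comparison of the sizes of two independent sets.\<close>

lemma linear_injective_image_span:
  fixes f :: "'a::real_vector \<Rightarrow> 'a"
  assumes f: "linear f" and D: "finite D" and sub: "f ` span D \<subseteq> span D"
    and ker: "\<And>v. v \<in> span D \<Longrightarrow> f v = 0 \<Longrightarrow> v = 0"
  shows "f ` span D = span D"
proof -
  obtain C where C: "C \<subseteq> D" "independent C" "D \<subseteq> span C"
    using real_vector.maximal_independent_subset[of D] by blast
  have fC: "finite C" using C D finite_subset by blast
  have sp: "span C = span D" using C by (intro span_eq[THEN iffD2]) (auto intro: span_base)
  have inj: "inj_on f (span C)"
  proof (rule inj_onI)
    fix a b assume ab: "a \<in> span C" "b \<in> span C" "f a = f b"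
    then have "a - b = 0" using ker[of "a - b"] by (simp add: sp span_diff linear_diff[OF f])
    then show "a = b" by simp
  qed
  have ind: "independent (f ` C)"
    by (rule real_vector.linear_independent_injective_image[OF f C(2) inj])
  have fCC: "f ` C \<subseteq> span C" using sub sp span_superset[of C] by blast
  have cardC: "card (f ` C) = card C"
    by (rule card_image[OF inj_on_subset[OF inj]]) (auto intro: span_base)
  have "x \<in> span (f ` C)" if x: "x \<in> span C" for x
  proof (rule ccontr)
    assume nx: "x \<notin> span (f ` C)"
    then have "independent (insert x (f ` C))" using ind by (rule real_vector.independent_insertI)
    then have "card (insert x (f ` C)) \<le> card C"
      using real_vector.independent_span_bound[OF fC] fCC x by auto
    moreover have "x \<notin> f ` C" using nx by (auto intro: span_base)
    ultimately show False using cardC fC by simp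
  qed
  then have "span C \<subseteq> f ` span C" using linear_span_image[OF f, of C] by blast
  then show ?thesis using sub sp by auto
qed

lemma independent_Un:
  fixes A N :: "'a::real_vector set"
  assumes "finite A" "finite N" "independent A" "independent N" "span A \<inter> span N = {0}"
  shows "independent (A \<union> N)" "A \<inter> N = {}"
proof -
  have "x \<notin> N" if "x \<in> A" for x
  proof
    assume "x \<in> N"
    then have "x = 0" using assms(5) that by (auto intro: span_base)
    then show False using that assms(3) real_vector.dependent_zero by blast
  qed
  then show disj: "A \<inter> N = {}" by auto
  show "independent (A \<union> N)"
  proof (rule real_vector.independent_if_scalars_zero)
    fix f x assume s: "(\<Sum>x\<in>A \<union> N. f x *\<^sub>R x) = 0" and x: "x \<in> A \<union> N"
    let ?a = "\<Sum>x\<in>A. f x *\<^sub>R x" and ?n = "\<Sum>x\<in>N. f x *\<^sub>R x"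
    have an: "?a + ?n = 0" using s disj assms by (simp add: sum.union_disjoint)
    have "?a \<in> span A" "?n \<in> span N" by (auto intro!: span_sum span_scale intro: span_base)
    moreover have "?a = - ?n" using an by (simp add: eq_neg_iff_add_eq_0)
    ultimately have "?a \<in> span A \<inter> span N" by (simp add: span_neg)
    then have "?a = 0" "?n = 0" using assms(5) an by auto
    then show "f x = 0"
      using x real_vector.independentD[OF assms(3,1) subset_refl, of f x]
        real_vector.independentD[OF assms(4,2) subset_refl, of f x] by blast
  qed (use assms in auto)
qed

lemma scaled_basis_metric:
  fixes B :: "'g::real_vector set" and \<tau> :: "'g \<Rightarrow> real"
  assumes B: "finite B" "independent B" "span B = UNIV" and pos: "\<And>b. b \<in> B \<Longrightarrow> \<tau> b > 0"
    and ip_def: "\<And>x y. ip x y = (\<Sum>b\<in>B. representation B x b * representation B y b / (\<tau> b)\<^sup>2)"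
  shows "inner_product ip" "inj_on (\<lambda>b. \<tau> b *\<^sub>R b) B" "orthonormal_basis ip ((\<lambda>b. \<tau> b *\<^sub>R b) ` B)"
    "b \<in> B \<Longrightarrow> ip x (\<tau> b *\<^sub>R b) = representation B x b / \<tau> b"
proof -
  let ?r = "representation B"
  have rep: "?r (x + y) b = ?r x b + ?r y b" "?r (c *\<^sub>R x) b = c * ?r x b" for x y b c
    using B by (simp_all add: real_vector.representation_add real_vector.representation_scale)
  have repb: "?r b d = (if d = b then 1 else 0)" if "b \<in> B" for b d
    using B that by (simp add: real_vector.representation_basis)
  have "bilinear ip"
    unfolding bilinear_def ip_def
    by (intro allI conjI linearI; simp add: rep distrib_left distrib_right add_divide_distrib sum.distrib sum_distrib_left mult_ac)
  moreover have "ip x y = ip y x" for x y by (simp add: ip_def mult.commute)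
  moreover have "ip x x > 0" if x: "x \<noteq> 0" for x
  proof -
    have "\<exists>b\<in>B. ?r x b \<noteq> 0"
    proof (rule ccontr)
      assume "\<not> ?thesis"
      then have "x = 0" using real_vector.sum_representation_eq[of B x B] B by simp
      with x show False by simp
    qed
    then obtain b where b: "b \<in> B" "?r x b \<noteq> 0" by blast
    have "0 < ?r x b * ?r x b / (\<tau> b)\<^sup>2" using b pos[OF b(1)]
      by (intro divide_pos_pos) (auto simp: zero_less_mult_iff linorder_neq_iff)
    also have "\<dots> \<le> ip x x" unfolding ip_def using b(1) B(1) by (intro member_le_sum) auto
    finally show ?thesis .
  qed
  ultimately show "inner_product ip" by (auto simp: inner_product_def)
  show ipb: "ip x (\<tau> b *\<^sub>R b) = ?r x b / \<tau> b" if b: "b \<in> B" for x b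
  proof -
    have "ip x (\<tau> b *\<^sub>R b) = (\<Sum>d\<in>B. if d = b then ?r x b * \<tau> b / (\<tau> b)\<^sup>2 else 0)"
      unfolding ip_def by (intro sum.cong refl) (auto simp: rep repb[OF b])
    also have "\<dots> = ?r x b * \<tau> b / (\<tau> b)\<^sup>2" using b B(1) by simp
    also have "\<dots> = ?r x b / \<tau> b" using pos[OF b] by (simp add: power2_eq_square)
    finally show ?thesis .
  qed
  have on: "ip (\<tau> a *\<^sub>R a) (\<tau> b *\<^sub>R b) = (if a = b then 1 else 0)" if "a \<in> B" "b \<in> B" for a b
    using pos[OF that(2)] by (simp add: ipb[OF that(2)] rep repb[OF that(1)])
  show inj: "inj_on (\<lambda>b. \<tau> b *\<^sub>R b) B"
  proof (rule inj_onI)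
    fix a b assume ab: "a \<in> B" "b \<in> B" "\<tau> a *\<^sub>R a = \<tau> b *\<^sub>R b"
    then show "a = b" using on[of a b] on[of b b] by (auto split: if_splits)
  qed
  have "span ((\<lambda>b. \<tau> b *\<^sub>R b) ` B) = span B"
    using B(1) pos by (intro real_vector.span_image_scale) (auto simp: less_imp_neq[THEN not_sym])
  then show "orthonormal_basis ip ((\<lambda>b. \<tau> b *\<^sub>R b) ` B)"
    using B on by (auto simp: orthonormal_basis_def inj_on_eq_iff[OF inj])
qed

lemma power_quotient_tendsto_0:
  assumes "m < n"
  shows "((\<lambda>t::real. t ^ n / t ^ m) \<longlongrightarrow> 0) (at_right 0)"
proof -
  have "((\<lambda>t::real. t ^ (n - m)) \<longlongrightarrow> 0 ^ (n - m)) (at_right 0)" by (intro tendsto_intros)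
  then have "((\<lambda>t::real. t ^ (n - m)) \<longlongrightarrow> 0) (at_right 0)" using assms by (simp add: zero_power)
  moreover have "\<forall>\<^sub>F t::real in at_right 0. t ^ (n - m) = t ^ n / t ^ m"
    using eventually_at_right_less[of "0::real"]
    by eventually_elim (use assms in \<open>simp add: power_diff\<close>)
  ultimately show ?thesis using tendsto_cong by fast
qed

context fd_lie_algebra
begin

text \<open>An eigenvalue on a quotient is an eigenvalue of the operator. If \<open>f = ad x - c\<close> had no kernel on the
  complexification of \<open>V\<close>, it would map the complexification of the lower levels onto itself. But it
  also maps the eigenvector \<open>b - i star b\<close> of the block into the lower levels.\<close>

lemma flag_eigenvalue:
  assumes fl: "flag_basis V B lev star al be" and b: "b \<in> B"
  shows "complex_eigenvalue_on (br x) V (Complex (al b x) (be b x))"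
proof (rule ccontr)
  assume none: "\<not> ?thesis"
  note s = flag_basisD[OF fl]
  define c where "c = Complex (al b x) (be b x)"
  define D where "D = {b' \<in> B. lev b' < lev b}"
  define S where "S = (\<lambda>d. (d, 0::'g)) ` D \<union> (\<lambda>d. (0, d)) ` D"
  define f where "f v = map_prod (br x) (br x) v - complex_scale c v" for v
  have lin: "linear f"
    by (rule linearI) (simp_all add: f_def complex_scale_def prod_eq_iff br_simps algebra_simps)
  have spS: "span S = span D \<times> span D"
  proof (rule antisym)
    have "S \<subseteq> span D \<times> span D" by (auto simp: S_def span_base span_0)
    then show "span S \<subseteq> span D \<times> span D" by (intro span_minimal subspace_Times subspace_span)
    have 1: "(u, 0) \<in> span S" "(0, u) \<in> span S" if "u \<in> span D" for u
    proof -
      have "linear (\<lambda>u::'g. (u, 0::'g))" "linear (\<lambda>u::'g. (0::'g, u))" by (rule linearI; simp)+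
      from linear_span_image[OF this(1), of D] linear_span_image[OF this(2), of D]
      have "(u, 0) \<in> span ((\<lambda>d. (d, 0::'g)) ` D)" "(0, u) \<in> span ((\<lambda>d. (0::'g, d)) ` D)"
        using that by auto
      then show "(u, 0) \<in> span S" "(0, u) \<in> span S"
        by (auto simp: S_def elim!: rev_subsetD[OF _ span_mono])
    qed
    show "span D \<times> span D \<subseteq> span S"
    proof
      fix p assume "p \<in> span D \<times> span D"
      then have "(fst p, 0) + (0, snd p) \<in> span S" by (intro span_add 1) auto
      then show "p \<in> span S" by simp
    qed
  qed
  have DV: "span D \<subseteq> V" using span_mono[of D B] s(2) by (auto simp: D_def)
  have bV: "b \<in> V" "star b \<in> V" using b s(2,4) by (auto intro: span_base)
  have sV: "subspace V" using s(2) by auto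
  have inv: "br x u \<in> span D" if "u \<in> span D" for u
    using flag_invariant[OF fl] that by (simp add: D_def)
  have inj: "v = 0" if "v \<in> V \<times> V" "f v = 0" for v
  proof (rule ccontr)
    assume "v \<noteq> 0"
    then have "complex_eigenvalue_on (br x) V c"
      unfolding complex_eigenvalue_on_def using that by (intro bexI[of _ v]) (auto simp: f_def)
    then show False using none by (simp add: c_def)
  qed
  have "f ` span S = span S"
  proof (rule linear_injective_image_span[OF lin])
    show "finite S" using s(3) by (simp add: S_def D_def)
    show "f ` span S \<subseteq> span S"
      unfolding spS by (auto simp: f_def complex_scale_def intro!: span_diff span_add span_scale inv)
    show "v = 0" if "v \<in> span S" "f v = 0" for v
    proof (rule inj)
      show "v \<in> V \<times> V" using that(1) DV unfolding spS by auto
    qed (rule that(2))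
  qed
  moreover have "f (b, - star b) \<in> span S"
  proof -
    have "br x b - al b x *\<^sub>R b - be b x *\<^sub>R star b \<in> span D" using s(13)[OF b] by (simp add: D_def)
    moreover have "br x (star b) - al b x *\<^sub>R star b + be b x *\<^sub>R b \<in> span D"
      using s(13)[OF s(4)[OF b], of x] s(5,6,9,10)[OF b] by (simp add: D_def)
    ultimately have "(br x b - al b x *\<^sub>R b - be b x *\<^sub>R star b, - (br x (star b) - al b x *\<^sub>R star b + be b x *\<^sub>R b)) \<in> span S"
      unfolding spS by (intro SigmaI span_neg)
    then show ?thesis by (simp add: f_def c_def complex_scale_def br_simps algebra_simps)
  qed
  ultimately obtain v where v: "v \<in> span S" "f v = f (b, - star b)" by (metis imageE)
  have "(b, - star b) - v = 0"
  proof (rule inj)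
    show "(b, - star b) - v \<in> V \<times> V"
    proof (rule subspace_diff)
      show "subspace (V \<times> V)" by (rule subspace_Times[OF sV sV])
      show "(b, - star b) \<in> V \<times> V" using bV subspace_neg[OF sV] by simp
      show "v \<in> V \<times> V" using v(1) DV unfolding spS by auto
    qed
    show "f ((b, - star b) - v) = 0" using v(2) by (simp add: linear_diff[OF lin])
  qed
  then have "(b, - star b) \<in> span S" using v(1) by simp
  then have "b \<in> span D" unfolding spS by auto
  then have "b \<in> span (B - {b})" by (rule rev_subsetD[OF _ span_mono]) (auto simp: D_def)
  then show False using s(1) b by (auto simp: real_vector.dependent_def)
qed

lemma flag_nilpotent:
  assumes fl: "flag_basis V B lev star al be" and x: "\<forall>b\<in>B. al b x = 0 \<and> be b x = 0"
  obtains m where "\<And>v. v \<in> V \<Longrightarrow> (br x ^^ m) v = 0"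
proof -
  obtain K where K: "{b \<in> B. lev b < K} = B" using flag_space_top flag_basisD(3)[OF fl] by blast
  have "(br x ^^ k) v \<in> span {b \<in> B. lev b < K - k}" if v: "v \<in> V" and "k \<le> K" for v k
    using \<open>k \<le> K\<close>
  proof (induction k)
    case 0 show ?case using v K flag_basisD(2)[OF fl] by simp
  next
    case (Suc k)
    then have "(br x ^^ k) v \<in> span {b \<in> B. lev b < Suc (K - Suc k)}" by (simp add: Suc_diff_Suc)
    then show ?case using flag_strict[OF fl x] by simp
  qed
  from this[of _ K] show thesis using that[of K] by simp
qed

text \<open>The inner product makes a rescaled basis \<open>\<tau> t b *\<^sub>R b\<close> orthonormal, for a small \<open>\<epsilon>\<close> and then a
  small \<open>t\<close>, both positive. On \<open>\<nn>\<close> the factor is \<open>\<sigma> \<epsilon> b * t ^ Suc (lev b)\<close>, and on the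
  complement \<open>A\<close> it is \<open>1\<close>. A bracket coefficient that lowers the level, or that comes from two vectors
  of \<open>\<nn>\<close>, gets multiplied by a positive power of \<open>t\<close>: for the latter, \<open>[i, j]\<close> has level at
  most that of \<open>j\<close>, while \<open>i\<close> contributes at least one factor \<open>t\<close>. This is why levels are shifted
  by one. What survives are the diagonal blocks.\<close>

theorem positive_eigenvalues_imp_negative_ricci:
  assumes solv: "solvable br" and nonzero: "\<exists>x::'g. x \<noteq> 0"
    and Y: "\<And>c. complex_eigenvalue_on (br Y) (nilradical br) c \<Longrightarrow> Re c > 0"
  shows "\<exists>ip. inner_product ip \<and> negative_ricci br ip"
proof -
  define n where "n = nilradical br"
  have n: "lie_ideal br n" "\<And>x y. br x y \<in> n" "n \<noteq> {0}"
    and n_nil: "\<And>z m. (\<And>v. (br z ^^ m) v = 0) \<Longrightarrow> z \<in> n"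
    unfolding n_def
    by (fact nilradical_solvable[OF solv] nilradical_nonzero[OF solv nonzero])+
  have sn: "subspace n" using n(1) by (simp add: lie_ideal_def)
  obtain N lev star al be where fl: "flag_basis n N lev star al be"
    using flag_basis_exists[OF solv n(1)] .
  note s = flag_basisD[OF fl]
  have alY: "al b Y > 0" if "b \<in> N" for b
    using Y[OF flag_eigenvalue[OF fl that, of Y, unfolded n_def]] by simp
  define T where "T = (\<Sum>b\<in>N. al b Y)"
  have "N \<noteq> {}" using n(3) s(2) by auto
  then have T: "T > 0" unfolding T_def using s(3) alY by (intro sum_pos) auto

  \<comment> \<open>The abelian complement of \<open>n\<close>.\<close>
  define a where "a = {x. br Y x = 0}"
  have sa: "subspace a" by (auto simp: a_def subspace_def br_simps)
  have Ya: "Y \<in> a" by (simp add: a_def alternating)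
  have Yinj: "x = 0" if "x \<in> n" "br Y x = 0" for x
  proof (rule ccontr)
    assume "x \<noteq> 0"
    then have "complex_eigenvalue_on (br Y) n 0"
      unfolding complex_eigenvalue_on_def using that sn
      by (intro bexI[of _ "(x, 0)"]) (auto simp: br_simps complex_scale_def zero_prod_def subspace_0)
    then show False using Y[of 0] by (simp add: n_def)
  qed
  have an: "a \<inter> n = {0}" using Yinj sa sn by (auto simp: a_def subspace_0 br_simps)
  have abel: "br x y = 0" if "x \<in> a" "y \<in> a" for x y
  proof (rule Yinj[OF n(2)])
    have "br x (br Y y) = 0" "br (br Y x) y = 0" using that by (simp_all add: a_def br_simps)
    then show "br Y (br x y) = 0" using br_br[of Y x y] by simp
  qed
  have Ysurj: "br Y ` n = n"
    using linear_injective_image_span[OF linear_br s(3), of Y] s(2) n(2) Yinj by auto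
  have decomp: "\<exists>u\<in>a. \<exists>v\<in>n. x = u + v" for x
  proof -
    obtain v where v: "v \<in> n" "br Y x = br Y v" using Ysurj n(2)[of Y x] by (metis imageE)
    then have "x - v \<in> a" by (simp add: a_def br_simps)
    then show ?thesis using v(1) by (intro bexI[of _ "x - v"] bexI[of _ v]) auto
  qed

  \<comment> \<open>The basis of \<open>a\<close> consists of \<open>Y\<close> and traceless elements, which makes the mean curvature
      vector of the limit proportional to \<open>Y\<close>.\<close>
  define tr where "tr x = (\<Sum>b\<in>N. al b x)" for x
  have lin_tr: "linear tr"
    using s(7) by (intro linearI) (auto simp: tr_def linear_add linear_scale sum.distrib sum_distrib_left)
  define a0 where "a0 = {x \<in> a. tr x = 0}"
  have sa0: "subspace a0"
    using sa by (auto simp: a0_def subspace_def linear_0[OF lin_tr] linear_add[OF lin_tr] linear_scale[OF lin_tr])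
  obtain A0 where A0: "A0 \<subseteq> a0" "independent A0" "a0 \<subseteq> span A0"
    using real_vector.maximal_independent_subset[of a0] by blast
  have spA0: "span A0 = a0" using A0 sa0 span_minimal by blast
  have trY: "tr Y = T" by (simp add: tr_def T_def)
  define A where "A = insert Y A0"
  have "Y \<notin> span A0" using trY T by (simp add: spA0 a0_def)
  then have indA: "independent A" using A0(2) by (simp add: A_def real_vector.independent_insertI)
  have spA: "span A = a"
  proof (rule antisym)
    show "span A \<subseteq> a" using Ya A0(1) sa by (intro span_minimal) (auto simp: A_def a0_def)
    show "a \<subseteq> span A"
    proof
      fix x assume x: "x \<in> a"
      have "x - (tr x / T) *\<^sub>R Y \<in> a0"
        using x Ya sa T trY
        by (auto simp: a0_def linear_diff[OF lin_tr] linear_scale[OF lin_tr] intro!: subspace_diff subspace_scale)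
      then show "x \<in> span A" using spA0 by (auto simp: A_def span_insert)
    qed
  qed
  have finA: "finite A" using finite_independent indA by blast
  define B where "B = A \<union> N"
  have indB: "independent B" and disj: "A \<inter> N = {}"
    unfolding B_def using independent_Un[OF finA s(3) indA s(1)] an spA s(2) by auto
  have finB: "finite B" using finA s(3) by (simp add: B_def)
  have spB: "span B = UNIV"
  proof -
    have "x \<in> span B" for x
    proof -
      obtain u v where "u \<in> span A" "v \<in> span N" "x = u + v" using decomp[of x] spA s(2) by auto
      then show ?thesis
        using span_mono[of A B] span_mono[of N B] by (auto simp: B_def intro!: span_add)
    qed
    then show ?thesis by auto
  qed
  have A_a: "x \<in> a" if "x \<in> A" for x using that spA by (auto intro: span_base)
  have N_n: "x \<in> n" if "x \<in> N" for x using that s(2) by (auto intro: span_base)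

  \<comment> \<open>Injectivity of \<open>g\<close> gives the two vectors of a rotation block different factors.\<close>
  obtain g :: "'g \<Rightarrow> nat" where g: "inj_on g N"
    using finite_imp_inj_to_nat_seg[OF s(3)] by blast
  define \<sigma> where "\<sigma> \<epsilon> b = 1 + \<epsilon> * real (g b)" for \<epsilon> b
  define r where "r \<epsilon> b = \<sigma> \<epsilon> b / \<sigma> \<epsilon> (star b)" for \<epsilon> b
  define G where "G \<epsilon> b = T * al b Y - 1/2 * (T * \<bar>be b Y\<bar> * \<bar>r \<epsilon> b - r \<epsilon> (star b)\<bar>)
        - 1/2 * ((\<Sum>k\<in>A. (be b k)\<^sup>2) * \<bar>(r \<epsilon> b)\<^sup>2 - (r \<epsilon> (star b))\<^sup>2\<bar>)" for \<epsilon> b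
  have "\<forall>\<^sub>F \<epsilon> in at_right 0. G \<epsilon> b > 0" if b: "b \<in> N" for b
  proof -
    have r1: "((\<lambda>\<epsilon>. r \<epsilon> b) \<longlongrightarrow> (1 + 0 * real (g b)) / (1 + 0 * real (g (star b)))) (at_right 0)" for b
      unfolding r_def \<sigma>_def by (intro tendsto_intros) auto
    then have "((\<lambda>\<epsilon>. G \<epsilon> b) \<longlongrightarrow> T * al b Y - 1/2 * (T * \<bar>be b Y\<bar> * \<bar>1 - 1\<bar>)
        - 1/2 * ((\<Sum>k\<in>A. (be b k)\<^sup>2) * \<bar>1\<^sup>2 - 1\<^sup>2\<bar>)) (at_right 0)"
      unfolding G_def using r1[of b] r1[of "star b"] by (intro tendsto_intros) auto
    from order_tendstoD(1)[OF this, of 0] show ?thesis using T alY[OF b] by simp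
  qed
  then have "\<forall>\<^sub>F \<epsilon> in at_right 0. (\<forall>b\<in>N. G \<epsilon> b > 0) \<and> \<epsilon> > 0"
    using s(3) eventually_at_right_less[of "0::real"] by (intro eventually_conj eventually_ball_finite) auto
  then obtain \<epsilon> where eps: "\<epsilon> > 0" and Gpos: "\<And>b. b \<in> N \<Longrightarrow> G \<epsilon> b > 0"
    using eventually_happens'[OF trivial_limit_at_right_real] by blast
  have sig: "\<sigma> \<epsilon> b > 0" for b using eps by (simp add: \<sigma>_def add_pos_nonneg)
  interpret model: semidirect_model A N star al be "r \<epsilon>" Y
  proof
    show "r \<epsilon> b * r \<epsilon> (star b) = 1" if "b \<in> N" for b
      using sig[of b] sig[of "star b"] that by (simp add: r_def s(5))
    show "(\<Sum>b\<in>N. al b k) = 0" if "k \<in> A" "k \<noteq> Y" for k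
      using that A0(1) by (auto simp: A_def a0_def tr_def)
    show "Y \<in> A" by (simp add: A_def)
  qed (use finA s disj in auto)
  \<comment> \<open>An element of \<open>a\<close> all of whose weights vanish is ad-nilpotent, so it lies in \<open>a \<inter> n\<close>.\<close>
  have faithful: "\<forall>i\<in>A. y i = 0"
    if y: "\<And>b. b \<in> N \<Longrightarrow> (\<Sum>i\<in>A. y i * al b i) = 0 \<and> (\<Sum>i\<in>A. y i * be b i) * (r \<epsilon> b - r \<epsilon> (star b)) = 0" for y
  proof -
    define z where "z = (\<Sum>i\<in>A. y i *\<^sub>R i)"
    have za: "z \<in> a" unfolding z_def spA[symmetric] by (auto intro!: span_sum span_scale intro: span_base)
    have lin_z: "h z = (\<Sum>i\<in>A. y i * h i)" if "linear h" for h :: "'g \<Rightarrow> real"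
      unfolding z_def by (simp add: linear_sum[OF that] linear_scale[OF that])
    have "al b z = 0 \<and> be b z = 0" if b: "b \<in> N" for b
    proof
      show "al b z = 0" using y[OF b] by (simp add: lin_z[OF s(7)[OF b]])
      show "be b z = 0"
      proof (cases "star b = b")
        case True then show ?thesis using s(10)[OF b, of z] by simp
      next
        case False
        have "r \<epsilon> b \<noteq> r \<epsilon> (star b)"
        proof
          assume "r \<epsilon> b = r \<epsilon> (star b)"
          then have "\<sigma> \<epsilon> b * \<sigma> \<epsilon> b = \<sigma> \<epsilon> (star b) * \<sigma> \<epsilon> (star b)"
            using sig[of b] sig[of "star b"] by (simp add: r_def s(5)[OF b] field_simps)
          then have "\<sigma> \<epsilon> b = \<sigma> \<epsilon> (star b)"
            using sig[of b] sig[of "star b"] by (metis abs_of_pos real_sqrt_abs2)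
          then have "g b = g (star b)" using eps by (simp add: \<sigma>_def)
          then show False using g b s(4)[OF b] False by (auto dest: inj_onD)
        qed
        then show ?thesis using y[OF b] by (simp add: lin_z[OF s(8)[OF b]])
      qed
    qed
    then obtain m where m: "\<And>v. v \<in> n \<Longrightarrow> (br z ^^ m) v = 0"
      using flag_nilpotent[OF fl, of z] by blast
    have "(br z ^^ Suc m) v = 0" for v
      using m[OF n(2)[of z v]] by (simp only: funpow_Suc_right o_apply)
    then have "z \<in> n" by (rule n_nil)
    then have "z = 0" using za an by auto
    then show ?thesis
      using real_vector.independentD[OF indA finA subset_refl, of y] by (simp add: z_def)
  qed
  have neg: "coord_ricci B model.const y < 0" if "\<exists>b\<in>B. y b \<noteq> 0" for y
    unfolding B_def
  proof (rule model.coord_ricci_const_negative)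
    show "\<exists>b\<in>A \<union> N. y b \<noteq> 0" using that by (simp add: B_def)
  qed (use T Gpos faithful in \<open>auto simp: T_def[symmetric] G_def\<close>)

  \<comment> \<open>\<open>C t\<close> are the structure constants in the basis rescaled by \<open>\<tau> t\<close>.\<close>
  define \<tau> where "\<tau> t b = (if b \<in> N then \<sigma> \<epsilon> b * t ^ Suc (lev b) else 1)" for t b
  define R where "R x b = representation B x b" for x b
  define C where "C t i j l = R (br i j) l * \<tau> t i * \<tau> t j / \<tau> t l" for t i j l
  have Radd: "R (x + y) b = R x b + R y b" and Rscale: "R (c *\<^sub>R x) b = c * R x b"
    and Rneg: "R (- x) b = - R x b" for x y b c
    using indB spB by (simp_all add: R_def real_vector.representation_add real_vector.representation_scale
        real_vector.representation_neg)
  have Rbasis: "R b d = (if d = b then 1 else 0)" if "b \<in> B" for b d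
    using indB that by (simp add: R_def real_vector.representation_basis)
  have Rout: "R x l = 0" if "x \<in> span S" "S \<subseteq> B" "l \<notin> S" for x l S
    unfolding R_def using representation_zero_outside[OF indB that(2,1,3)] .
  have R_A: "R (br i j) l = 0" if "l \<in> A" for i j l
    using Rout[of "br i j" N l] n(2) s(2) that disj by (auto simp: B_def)
  have AN: "((\<lambda>t. C t i j l) \<longlongrightarrow> model.act i j l) (at_right 0)" if i: "i \<in> A" and j: "j \<in> N" and l: "l \<in> N" for i j l
  proof -
    have iN: "i \<notin> N" using i disj by auto
    have Ceq: "C t i j l = R (br i j) l * (\<sigma> \<epsilon> j / \<sigma> \<epsilon> l) * (t ^ Suc (lev j) / t ^ Suc (lev l))" for t
      using iN j l by (simp add: C_def \<tau>_def mult_ac del: power_Suc)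
    show ?thesis
    proof (cases "lev l < lev j")
      case True
      have "((\<lambda>t. C t i j l) \<longlongrightarrow> R (br i j) l * (\<sigma> \<epsilon> j / \<sigma> \<epsilon> l) * 0) (at_right 0)"
        unfolding Ceq using True by (intro tendsto_mult tendsto_const power_quotient_tendsto_0) simp
      moreover have "model.act i j l = 0" using True s(6)[OF j] by (auto simp: model.act_def)
      ultimately show ?thesis by simp
    next
      case False
      define e where "e = br i j - al j i *\<^sub>R j - be j i *\<^sub>R star j"
      have "R e l = 0"
        by (rule Rout[of _ "{b' \<in> N. lev b' < lev j}"]) (use s(13)[OF j, of i] False in \<open>auto simp: e_def B_def\<close>)
      moreover have "br i j = e + al j i *\<^sub>R j + be j i *\<^sub>R star j" by (simp add: e_def)
      moreover have "j \<in> B" "star j \<in> B" using j s(4) by (auto simp: B_def)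
      ultimately have R: "R (br i j) l = al j i * (if l = j then 1 else 0) + be j i * (if l = star j then 1 else 0)"
        by (simp only: Radd Rscale Rbasis add_0)
      have "\<forall>\<^sub>F t in at_right 0. C t i j l = model.act i j l"
        using eventually_at_right_less[of "0::real"]
      proof eventually_elim
        case (elim t)
        have "C t i j l = R (br i j) l * (\<sigma> \<epsilon> j / \<sigma> \<epsilon> l)" if "l = j \<or> l = star j"
          using that s(6)[OF j] elim by (auto simp: Ceq)
        moreover have "C t i j l = 0" if "l \<noteq> j \<and> l \<noteq> star j"
          using that by (simp add: Ceq R)
        ultimately show ?case
          using sig[of j] by (auto simp: R model.act_def r_def)
      qed
      then show ?thesis by (rule tendsto_eventually)
    qed
  qed
  have NN: "((\<lambda>t. C t i j l) \<longlongrightarrow> 0) (at_right 0)" if i: "i \<in> N" and j: "j \<in> N" and l: "l \<in> N" for i j l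
  proof (cases "lev l \<le> lev j")
    case True
    have Ceq: "C t i j l = R (br i j) l * (\<sigma> \<epsilon> i * \<sigma> \<epsilon> j / \<sigma> \<epsilon> l) * (t ^ (Suc (lev i) + Suc (lev j)) / t ^ Suc (lev l))" for t
      using i j l by (simp add: C_def \<tau>_def power_add mult_ac)
    have "((\<lambda>t. C t i j l) \<longlongrightarrow> R (br i j) l * (\<sigma> \<epsilon> i * \<sigma> \<epsilon> j / \<sigma> \<epsilon> l) * 0) (at_right 0)"
      unfolding Ceq using True by (intro tendsto_mult tendsto_const power_quotient_tendsto_0) simp
    then show ?thesis by simp
  next
    case False
    have "j \<in> span {b \<in> N. lev b < Suc (lev j)}" using j by (auto intro: span_base)
    then have "br i j \<in> span {b \<in> N. lev b < Suc (lev j)}" by (rule flag_invariant[OF fl])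
    then have "R (br i j) l = 0"
      by (rule Rout) (use False in \<open>auto simp: B_def\<close>)
    then show ?thesis by (simp add: C_def)
  qed
  have lim: "((\<lambda>t. C t i j l) \<longlongrightarrow> model.const i j l) (at_right 0)" if ijl: "i \<in> B" "j \<in> B" "l \<in> B" for i j l
  proof (cases "l \<in> A")
    case True
    have "model.const i j l = 0" using True that model.act_A by (auto simp: model.const_def)
    then show ?thesis using R_A[OF True] by (simp add: C_def)
  next
    case False
    then have l: "l \<in> N" using that by (auto simp: B_def)
    consider "i \<in> A" "j \<in> A" | "i \<in> A" "j \<in> N" | "i \<in> N" "j \<in> A" | "i \<in> N" "j \<in> N"
      using ijl by (auto simp: B_def)
    then show ?thesis
    proof cases
      case 1
      then have "br i j = 0" using abel A_a by blast
      then show ?thesis using 1 Rscale[of 0 0] by (simp add: C_def model.const_simps)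
    next
      case 2 then show ?thesis using AN l by (simp add: model.const_simps)
    next
      case 3
      have "C t i j l = - C t j i l" for t
        by (subst C_def, subst br_anticomm) (simp add: C_def Rneg)
      then show ?thesis using AN[of j i l] 3 l by (simp add: model.const_simps tendsto_minus)
    next
      case 4 then show ?thesis using NN l by (simp add: model.const_simps)
    qed
  qed
  have "\<forall>\<^sub>F t in at_right 0. (\<forall>y. (\<exists>b\<in>B. y b \<noteq> 0) \<longrightarrow> coord_ricci B (C t) y < 0) \<and> t > 0"
    using coord_ricci_negative_limit[OF finB indB spB neg lim] eventually_at_right_less[of "0::real"]
    by (intro eventually_conj) auto
  then obtain t where t: "t > 0" and negt: "\<And>y. \<exists>b\<in>B. y b \<noteq> 0 \<Longrightarrow> coord_ricci B (C t) y < 0"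
    using eventually_happens'[OF trivial_limit_at_right_real] by blast
  have tau: "\<tau> t b > 0" for b using t sig by (simp add: \<tau>_def)
  define ip where "ip x y = (\<Sum>b\<in>B. representation B x b * representation B y b / (\<tau> t b)\<^sup>2)" for x y
  let ?e = "\<lambda>b. \<tau> t b *\<^sub>R b"
  note sb = scaled_basis_metric[where \<tau> = "\<tau> t" and ip = ip, OF finB indB spB tau ip_def]
  interpret m: metric_lie_algebra br gens ip
    by unfold_locales (rule sb(1))
  have "ricci br ip x < 0" if x: "x \<noteq> 0" for x
  proof -
    have c: "ip (br (?e i) (?e j)) (?e l) = C t i j l" if "l \<in> B" for i j l
      using sb(4)[OF that] by (simp add: C_def br_simps Rscale R_def[symmetric])
    have "ricci br ip x = coord_ricci B (C t) (\<lambda>i. ip x (?e i))"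
      unfolding m.ricci_coordinates[OF sb(3,2)] by (rule coord_ricci_cong) (rule c)
    also have "\<dots> < 0"
    proof (rule negt, rule ccontr)
      assume "\<not> (\<exists>b\<in>B. ip x (?e b) \<noteq> 0)"
      then have "representation B x b = 0" if "b \<in> B" for b
        using that sb(4)[OF that, of x] tau[of b] by simp
      then have "x = 0" using real_vector.sum_representation_eq[of B x B] finB indB spB by simp
      with x show False by simp
    qed
    finally show ?thesis .
  qed
  then have "negative_ricci br ip" by (simp add: negative_ricci_def)
  with sb(1) show ?thesis by blast
qed

end

theorem theorem2:
  fixes br :: "'g::real_vector \<Rightarrow> 'g \<Rightarrow> 'g"
  assumes lie: "lie_algebra br"
    and fin_dim: "\<exists>B :: 'g set. finite B \<and> span B = UNIV"
    and nonzero: "\<exists>x :: 'g. x \<noteq> 0"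
    and solv: "solvable br"
  shows "((\<exists>ip. inner_product ip \<and> negative_ricci br ip) \<longrightarrow>
           (\<exists>Y. endo_trace (br Y) > 0 \<and>
             (\<forall>c. complex_eigenvalue_on (br Y) (centre br (nilradical br)) c \<longrightarrow> Re c > 0))) \<and>
         ((\<exists>Y. \<forall>c. complex_eigenvalue_on (br Y) (nilradical br) c \<longrightarrow> Re c > 0) \<longrightarrow>
           (\<exists>ip. inner_product ip \<and> negative_ricci br ip))"
proof -
  obtain B :: "'g set" where B: "finite B" "span B = UNIV" using fin_dim by blast
  interpret lie_algebra br by (rule lie)
  interpret fd_lie_algebra br B by unfold_locales (rule B)+
  show ?thesis
  proof (intro conjI impI)
    assume "\<exists>ip. inner_product ip \<and> negative_ricci br ip"
    then obtain ip where ip: "inner_product ip" "negative_ricci br ip" by blast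
    interpret metric_lie_algebra br B ip by unfold_locales (rule ip(1))
    show "\<exists>Y. endo_trace (br Y) > 0 \<and>
        (\<forall>c. complex_eigenvalue_on (br Y) (centre br (nilradical br)) c \<longrightarrow> Re c > 0)"
      by (rule negative_ricci_imp_positive_eigenvalues[OF solv nonzero ip(2)])
  next
    assume "\<exists>Y. \<forall>c. complex_eigenvalue_on (br Y) (nilradical br) c \<longrightarrow> Re c > 0"
    then show "\<exists>ip. inner_product ip \<and> negative_ricci br ip"
      using positive_eigenvalues_imp_negative_ricci[OF solv nonzero] by blast
  qed
qed

end
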